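(* Let $K$ be an algebraically closed field of characteristic zero, let $Q$ be a connected affine algebraic group over $K$, and suppose that $\mathfrak q=\mathrm{Lie}\,Q$ is a contact Lie algebra. Then the ring $\mathcal S(\mathfrak q)_{\mathsf{si}}$ has an algebraically independent set of generators $\{H_1,\ldots,H_m\}$ (as a $K$-algebra) such that each $H_i$ is an irreducible homogeneous semi-invariant of $\mathfrak q$. Furthermore, the fundamental semi-invariant $p$ of $\mathfrak q$ (which is defined up to a non-zero scalar) is equal to $\prod_{i=1}^m H_i^{a_i}$ with integers $a_i\ge 0$.
   Context: A finite-dimensional Lie algebra $\mathfrak q$ is called contact if $\dim\mathfrak q=2n+1$ is odd and there is $\alpha\in\mathfrak q^*$ with $(d_{\mathfrak q}\alpha)^{\wedge n}\wedge\alpha\neq 0$, where $d_{\mathfrak q}\alpha\in\wedge^2\mathfrak q^*$ is the Chevalley--Eilenberg differential, $d_{\mathfrak q}\alpha(\xi,\eta)=-\alpha([\xi,\eta])$ (up to an irrelevant sign convention). The index is $\mathrm{ind}\,\mathfrak q=\min_{\gamma\in\mathfrak q^*}\dim\mathfrak q_\gamma$, where $\mathfrak q_\gamma=\{\xi\in\mathfrak q\mid\gamma([\xi,\mathfrak q])=0\}$. Let $\mathcal S(\mathfrak q)=K[\mathfrak q^*]$ be the symmetric algebra of $\mathfrak q$, on which $\mathfrak q$ acts by derivations extending the adjoint action. An element $F\in\mathcal S(\mathfrak q)$ is a semi-invariant of $\mathfrak q$ if $\xi\cdot F\in KF$ for each $\xi\in\mathfrak q$. Let $\mathcal S(\mathfrak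 q)_{\mathsf{si}}\subset\mathcal S(\mathfrak q)$ be the subring generated by the semi-invariants of $\mathfrak q$. Let $\mathcal W=\bigoplus_i\mathcal W^i$ be the graded skew-symmetric algebra of polynomial polyvector fields on $\mathfrak q^*$, generated over $\mathcal S(\mathfrak q)$ by $\partial_i=\partial_{x_i}$, where $\{x_i\}$ is a basis of $\mathfrak q$. Let $\pi=\sum_{i<j}[x_i,x_j]\,\partial_i\wedge\partial_j\in\mathcal W^2$ be the Poisson tensor of $\mathfrak q$, and let $d=\frac12(\dim\mathfrak q-\mathrm{ind}\,\mathfrak q)$, which is the largest number such that $\pi^{\wedge d}\neq 0$. A fundamental semi-invariant of $\mathfrak q$ is a polynomial $p\in\mathcal S(\mathfrak q)$ such that $\pi^{\wedge d}=p\,\mathcal R$ with $\mathcal R\in\mathcal W^{2d}$ and the zero set of $\mathcal R$ in $\mathfrak q^*$ has codimension at least $2$; it is unique up to a non-zero scalar. *)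

theory Defs
  imports
    "HOL-Library.Poly_Mapping"
    "HOL-Library.Function_Algebras"
    "HOL-Library.Extended_Nat"
    "HOL-Computational_Algebra.Polynomial"
    "HOL-Computational_Algebra.Factorial_Ring"
    "HOL-Algebra.Group"
    "HOL-Analysis.Abstract_Topology"
begin

section \<open>Multivariate polynomials\<close>

text \<open>Polynomials over \<open>'k\<close> with variables indexed by \<open>'v\<close>: finitely supported maps from
  monomials (finitely supported exponent vectors) to coefficients.\<close>

type_synonym ('v, 'k) mpoly = "('v \<Rightarrow>\<^sub>0 nat) \<Rightarrow>\<^sub>0 'k"

definition Const :: "'k::zero \<Rightarrow> ('v, 'k) mpoly" where
  "Const c = Poly_Mapping.single 0 c"

definition Var :: "'v \<Rightarrow> ('v, 'k::zero_neq_one) mpoly" where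
  "Var i = Poly_Mapping.single (Poly_Mapping.single i 1) 1"

text \<open>The value of \<open>P\<close> under a map \<open>h\<close> on coefficients and a substitution \<open>a\<close> for the variables.\<close>

definition mp_eval :: "('k::comm_ring_1 \<Rightarrow> 'r::comm_ring_1) \<Rightarrow> ('v \<Rightarrow> 'r) \<Rightarrow> ('v, 'k) mpoly \<Rightarrow> 'r" where
  "mp_eval h a P =
     (\<Sum>m\<in>Poly_Mapping.keys P. h (Poly_Mapping.lookup P m) *
        (\<Prod>v\<in>Poly_Mapping.keys m. a v ^ Poly_Mapping.lookup m v))"

abbreviation eval :: "('v \<Rightarrow> 'k::comm_ring_1) \<Rightarrow> ('v, 'k) mpoly \<Rightarrow> 'k" where
  "eval \<equiv> mp_eval (\<lambda>c. c)"

abbreviation subst_poly ::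
    "('i \<Rightarrow> ('v, 'k) mpoly) \<Rightarrow> ('i, 'k::comm_ring_1) mpoly \<Rightarrow> ('v, 'k) mpoly" where
  "subst_poly \<equiv> mp_eval Const"

definition vars :: "('v, 'k::zero) mpoly \<Rightarrow> 'v set" where
  "vars P = (\<Union>m\<in>Poly_Mapping.keys P. Poly_Mapping.keys m)"

definition homogeneous :: "('v, 'k::zero) mpoly \<Rightarrow> bool" where
  "homogeneous P \<longleftrightarrow>
     (\<exists>d. \<forall>m\<in>Poly_Mapping.keys P. (\<Sum>v\<in>Poly_Mapping.keys m. Poly_Mapping.lookup m v) = d)"

definition pderiv_var :: "'v \<Rightarrow> ('v, 'k::comm_ring_1) mpoly \<Rightarrow> ('v, 'k) mpoly" where
  "pderiv_var i P =
     (\<Sum>m\<in>Poly_Mapping.keys P.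
        Poly_Mapping.single (m - Poly_Mapping.single i 1)
          (of_nat (Poly_Mapping.lookup m i) * Poly_Mapping.lookup P m))"

definition is_subring :: "'r::comm_ring_1 set \<Rightarrow> bool" where
  "is_subring R \<longleftrightarrow> 1 \<in> R \<and> (\<forall>a\<in>R. \<forall>b\<in>R. a - b \<in> R \<and> a * b \<in> R)"

definition is_subalgebra :: "('v, 'k::comm_ring_1) mpoly set \<Rightarrow> bool" where
  "is_subalgebra R \<longleftrightarrow> is_subring R \<and> (\<forall>c. Const c \<in> R)"

definition alg_independent :: "'i set \<Rightarrow> ('i \<Rightarrow> ('v, 'k::comm_ring_1) mpoly) \<Rightarrow> bool" where
  "alg_independent I H \<longleftrightarrow>
     (\<forall>P :: ('i, 'k) mpoly. vars P \<subseteq> I \<longrightarrow> subst_poly H P = 0 \<longrightarrow> P = 0)"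

lemma mp_eval_superset:
  assumes "finite A" "Poly_Mapping.keys P \<subseteq> A" "h 0 = 0"
  shows "mp_eval h a P =
     (\<Sum>m\<in>A. h (Poly_Mapping.lookup P m) *
        (\<Prod>v\<in>Poly_Mapping.keys m. a v ^ Poly_Mapping.lookup m v))"
  unfolding mp_eval_def
  by (rule sum.mono_neutral_left) (use assms in \<open>auto simp: in_keys_iff\<close>)

lemma eval_zero [simp]: "eval a 0 = 0"
  by (simp add: mp_eval_def)

lemma eval_add: "eval a (P + Q) = eval a P + eval a Q"
proof -
  let ?A = "Poly_Mapping.keys P \<union> Poly_Mapping.keys Q"
  have "Poly_Mapping.keys (P + Q) \<subseteq> ?A"
    by (rule Poly_Mapping.keys_add)
  then show ?thesis
    by (simp add: mp_eval_superset[of ?A] lookup_add sum.distrib distrib_right)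
qed

lemma eval_sum: "eval a (\<Sum>i\<in>A. f i) = (\<Sum>i\<in>A. eval a (f i))"
  by (induction A rule: infinite_finite_induct) (auto simp: eval_add)

lemma eval_single:
  "eval a (Poly_Mapping.single m c) =
     c * (\<Prod>v\<in>Poly_Mapping.keys m. a v ^ Poly_Mapping.lookup m v)"
  by (cases "c = 0") (auto simp: mp_eval_def)

lemma mpoly_sum_monomials:
  "P = (\<Sum>m\<in>Poly_Mapping.keys P. Poly_Mapping.single m (Poly_Mapping.lookup P m))"
proof (rule poly_mapping_eqI)
  fix k
  have "(\<Sum>m\<in>Poly_Mapping.keys P.
           Poly_Mapping.lookup (Poly_Mapping.single m (Poly_Mapping.lookup P m)) k) =
        (\<Sum>m\<in>Poly_Mapping.keys P. if m = k then Poly_Mapping.lookup P k else 0)"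
    by (rule sum.cong) (auto simp: lookup_single when_def)
  also have "\<dots> = Poly_Mapping.lookup P k"
    by (simp add: in_keys_iff)
  finally show "Poly_Mapping.lookup P k = Poly_Mapping.lookup
      (\<Sum>m\<in>Poly_Mapping.keys P. Poly_Mapping.single m (Poly_Mapping.lookup P m)) k"
    by (simp add: lookup_sum)
qed

lemma monomial_value_add:
  fixes a :: "'v \<Rightarrow> 'k::comm_ring_1"
  shows "(\<Prod>v\<in>Poly_Mapping.keys (m + n). a v ^ Poly_Mapping.lookup (m + n) v) =
    (\<Prod>v\<in>Poly_Mapping.keys m. a v ^ Poly_Mapping.lookup m v) *
    (\<Prod>v\<in>Poly_Mapping.keys n. a v ^ Poly_Mapping.lookup n v)"
proof -
  let ?A = "Poly_Mapping.keys m \<union> Poly_Mapping.keys n"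
  have *: "(\<Prod>v\<in>Poly_Mapping.keys k. a v ^ Poly_Mapping.lookup k v) =
           (\<Prod>v\<in>?A. a v ^ Poly_Mapping.lookup k v)" if "Poly_Mapping.keys k \<subseteq> ?A" for k
    by (rule prod.mono_neutral_left) (use that in \<open>auto simp: in_keys_iff\<close>)
  have "(\<Prod>v\<in>Poly_Mapping.keys (m + n). a v ^ Poly_Mapping.lookup (m + n) v) =
        (\<Prod>v\<in>?A. a v ^ Poly_Mapping.lookup (m + n) v)"
    by (intro * Poly_Mapping.keys_add)
  also have "\<dots> = (\<Prod>v\<in>?A. a v ^ Poly_Mapping.lookup m v) * (\<Prod>v\<in>?A. a v ^ Poly_Mapping.lookup n v)"
    by (simp add: lookup_add power_add prod.distrib)
  finally show ?thesis
    by (simp add: *)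
qed

lemma eval_mult: "eval a (P * Q) = eval a P * eval a Q"
proof -
  have "P * Q = (\<Sum>m\<in>Poly_Mapping.keys P. Poly_Mapping.single m (Poly_Mapping.lookup P m)) *
                (\<Sum>n\<in>Poly_Mapping.keys Q. Poly_Mapping.single n (Poly_Mapping.lookup Q n))"
    using mpoly_sum_monomials by metis
  then have "eval a (P * Q) =
    (\<Sum>m\<in>Poly_Mapping.keys P. \<Sum>n\<in>Poly_Mapping.keys Q.
       Poly_Mapping.lookup P m * Poly_Mapping.lookup Q n *
       ((\<Prod>v\<in>Poly_Mapping.keys m. a v ^ Poly_Mapping.lookup m v) *
        (\<Prod>v\<in>Poly_Mapping.keys n. a v ^ Poly_Mapping.lookup n v)))"
    by (simp add: sum_product eval_sum mult_single eval_single monomial_value_add)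
  also have "\<dots> = eval a P * eval a Q"
    by (simp add: mp_eval_def sum_product mult_ac)
  finally show ?thesis .
qed

section \<open>The Zariski topology on affine space and codimension\<close>

definition zeros :: "('n, 'k::comm_ring_1) mpoly set \<Rightarrow> ('n \<Rightarrow> 'k) set" where
  "zeros P = {a. \<forall>p\<in>P. eval a p = 0}"

definition zariski :: "('n \<Rightarrow> 'k::idom) topology" where
  "zariski = topology (\<lambda>U. \<exists>P. U = - zeros P)"

lemma openin_zariski:
  fixes U :: "('n \<Rightarrow> 'k::idom) set"
  shows "openin zariski U \<longleftrightarrow> (\<exists>P. U = - zeros P)"
proof -
  have "istopology (\<lambda>U :: ('n \<Rightarrow> 'k) set. \<exists>P. U = - zeros P)"
    unfolding istopology_def
  proof (intro conjI allI impI)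
    fix S T :: "('n \<Rightarrow> 'k) set"
    assume "\<exists>P. S = - zeros P" "\<exists>P. T = - zeros P"
    then obtain P Q where "S = - zeros P" "T = - zeros Q" by blast
    then have "S \<inter> T = - zeros {p * q |p q. p \<in> P \<and> q \<in> Q}"
      unfolding zeros_def by (fastforce simp: eval_mult)
    then show "\<exists>P. S \<inter> T = - zeros P" ..
  next
    fix \<K> :: "('n \<Rightarrow> 'k) set set"
    assume "\<forall>S\<in>\<K>. \<exists>P. S = - zeros P"
    then obtain f where "\<And>S. S \<in> \<K> \<Longrightarrow> S = - zeros (f S)" by metis
    then have "\<Union>\<K> = - zeros (\<Union>S\<in>\<K>. f S)"
      unfolding zeros_def by (auto; blast)
    then show "\<exists>P. \<Union>\<K> = - zeros P" ..
  qed
  then show ?thesis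
    by (simp add: zariski_def topology_inverse')
qed

lemma closedin_zariski:
  fixes Z :: "('n \<Rightarrow> 'k::idom) set"
  shows "closedin zariski Z \<longleftrightarrow> (\<exists>P. Z = zeros P)"
proof -
  have "openin zariski (UNIV :: ('n \<Rightarrow> 'k) set)"
    unfolding openin_zariski
    by (rule exI[of _ "{1}"]) (auto simp: zeros_def mp_eval_def)
  then have "topspace zariski = (UNIV :: ('n \<Rightarrow> 'k) set)"
    using openin_subset by blast
  then show ?thesis
    by (metis closedin_def Compl_eq_Diff_UNIV double_complement openin_zariski subset_UNIV)
qed

definition irreducible_closed :: "'a topology \<Rightarrow> 'a set \<Rightarrow> bool" where
  "irreducible_closed X Y \<longleftrightarrow> closedin X Y \<and> Y \<noteq> {} \<and>
     (\<forall>A B. closedin X A \<longrightarrow> closedin X B \<longrightarrow> Y \<subseteq> A \<union> B \<longrightarrow> Y \<subseteq> A \<or> Y \<subseteq> B)"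

text \<open>For irreducible closed \<open>Y\<close>, the supremum of the lengths of chains of irreducible closed
  sets ascending from \<open>Y\<close>; in general the infimum over all irreducible closed subsets.  The
  empty set has codimension \<open>\<infinity>\<close>.\<close>

definition codimension :: "'a topology \<Rightarrow> 'a set \<Rightarrow> enat" where
  "codimension X Z =
     (INF Y\<in>{Y. irreducible_closed X Y \<and> Y \<subseteq> Z}.
        SUP k\<in>{k. \<exists>C. C 0 = Y \<and> (\<forall>i\<le>k. irreducible_closed X (C i)) \<and> (\<forall>i<k. C i \<subset> C (Suc i))}.
          enat k)"

section \<open>Affine algebraic groups and their Lie algebras\<close>

text \<open>Over an algebraically closed field: a Zariski closed subset of some affine space \<open>'m \<Rightarrow> 'k\<close>
  with a group structure whose multiplication and inversion are polynomial maps.\<close>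

definition affine_algebraic_group :: "('m::finite \<Rightarrow> 'k::idom) monoid \<Rightarrow> bool" where
  "affine_algebraic_group G \<longleftrightarrow>
     group G \<and> closedin zariski (carrier G) \<and>
     (\<exists>M :: 'm \<Rightarrow> ('m + 'm, 'k) mpoly. \<forall>g\<in>carrier G. \<forall>h\<in>carrier G. \<forall>i.
        (g \<otimes>\<^bsub>G\<^esub> h) i = eval (case_sum g h) (M i)) \<and>
     (\<exists>J :: 'm \<Rightarrow> ('m, 'k) mpoly. \<forall>g\<in>carrier G. \<forall>i. (inv\<^bsub>G\<^esub> g) i = eval g (J i))"

text \<open>Regular functions, extended by \<open>0\<close> outside the group.\<close>

definition coordinate_ring :: "('m \<Rightarrow> 'k::comm_ring_1) monoid \<Rightarrow> (('m \<Rightarrow> 'k) \<Rightarrow> 'k) set" where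
  "coordinate_ring G = {f. \<exists>P. f = (\<lambda>g. if g \<in> carrier G then eval g P else 0)}"

definition left_translate ::
    "('m \<Rightarrow> 'k::comm_ring_1) monoid \<Rightarrow> ('m \<Rightarrow> 'k) \<Rightarrow> (('m \<Rightarrow> 'k) \<Rightarrow> 'k) \<Rightarrow> (('m \<Rightarrow> 'k) \<Rightarrow> 'k)" where
  "left_translate G g f = (\<lambda>h. if h \<in> carrier G then f (inv\<^bsub>G\<^esub> g \<otimes>\<^bsub>G\<^esub> h) else 0)"

record ('k, 'v) lie_alg =
  lspace :: "'v set"
  lscale :: "'k \<Rightarrow> 'v \<Rightarrow> 'v"
  lbracket :: "'v \<Rightarrow> 'v \<Rightarrow> 'v"

text \<open>The left invariant \<open>'k\<close>-derivations of the coordinate ring with the commutator bracket.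
  Operators are set to \<open>0\<close> outside the coordinate ring, so that each derivation is
  represented by exactly one HOL function.\<close>

definition Lie :: "('m \<Rightarrow> 'k::comm_ring_1) monoid \<Rightarrow>
    ('k, (('m \<Rightarrow> 'k) \<Rightarrow> 'k) \<Rightarrow> (('m \<Rightarrow> 'k) \<Rightarrow> 'k)) lie_alg" where
  "Lie G = \<lparr>
     lspace = {D. let A = coordinate_ring G in
       (\<forall>f. f \<notin> A \<longrightarrow> D f = 0) \<and>
       (\<forall>f\<in>A. D f \<in> A) \<and>
       (\<forall>f\<in>A. \<forall>g\<in>A. D (f + g) = D f + D g) \<and>
       (\<forall>c. \<forall>f\<in>A. D (\<lambda>h. c * f h) = (\<lambda>h. c * D f h)) \<and>
       (\<forall>f\<in>A. \<forall>g\<in>A. D (f * g) = D f * g + f * D g) \<and>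
       (\<forall>g\<in>carrier G. \<forall>f\<in>A. D (left_translate G g f) = left_translate G g (D f))},
     lscale = (\<lambda>c D f h. c * D f h),
     lbracket = (\<lambda>D E f. D (E f) - E (D f)) \<rparr>"

section \<open>Lie algebras with a basis\<close>

abbreviation ldim :: "('k::field, 'v::ab_group_add) lie_alg \<Rightarrow> 'v set \<Rightarrow> nat" where
  "ldim L \<equiv> vector_space.dim (lscale L)"

definition lie_basis :: "('k::field, 'v::ab_group_add) lie_alg \<Rightarrow> ('n::finite \<Rightarrow> 'v) \<Rightarrow> bool" where
  "lie_basis L x \<longleftrightarrow> inj x \<and> \<not> module.dependent (lscale L) (range x) \<and>
     module.span (lscale L) (range x) = lspace L"

definition lie_dual :: "('k::field, 'v::ab_group_add) lie_alg \<Rightarrow> ('v \<Rightarrow> 'k) set" where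
  "lie_dual L = {\<gamma>. (\<forall>u\<in>lspace L. \<forall>v\<in>lspace L. \<gamma> (u + v) = \<gamma> u + \<gamma> v) \<and>
                    (\<forall>c. \<forall>u\<in>lspace L. \<gamma> (lscale L c u) = c * \<gamma> u)}"

definition lie_stabilizer :: "('k::field, 'v) lie_alg \<Rightarrow> ('v \<Rightarrow> 'k) \<Rightarrow> 'v set" where
  "lie_stabilizer L \<gamma> = {\<xi>\<in>lspace L. \<forall>\<eta>\<in>lspace L. \<gamma> (lbracket L \<xi> \<eta>) = 0}"

definition lie_index :: "('k::field, 'v::ab_group_add) lie_alg \<Rightarrow> nat" where
  "lie_index L = (INF \<gamma>\<in>lie_dual L. ldim L (lie_stabilizer L \<gamma>))"

subsection \<open>Exterior algebras\<close>

text \<open>An element of the exterior algebra over \<open>'r\<close> of the free module with basis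
  \<open>(e\<^sub>i)\<close> is given by its coefficients at the products of the \<open>e\<^sub>i\<close> over \<open>I\<close> in
  increasing order.\<close>

type_synonym ('n, 'r) ext = "'n set \<Rightarrow> 'r"

definition ext_gen :: "'n \<Rightarrow> ('n, 'r::comm_ring_1) ext" where
  "ext_gen i = (\<lambda>I. if I = {i} then 1 else 0)"

definition ext_scale :: "'r::comm_ring_1 \<Rightarrow> ('n, 'r) ext \<Rightarrow> ('n, 'r) ext" where
  "ext_scale c u = (\<lambda>I. c * u I)"

definition wedge ::
    "('n::{finite,linorder}, 'r::comm_ring_1) ext \<Rightarrow> ('n, 'r) ext \<Rightarrow> ('n, 'r) ext" where
  "wedge u v = (\<lambda>K. \<Sum>I\<in>Pow K. (- 1) ^ card {(i, j). i \<in> I \<and> j \<in> K - I \<and> j < i} * u I * v (K - I))"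

fun wedge_power :: "('n::{finite,linorder}, 'r::comm_ring_1) ext \<Rightarrow> nat \<Rightarrow> ('n, 'r) ext" where
  "wedge_power u 0 = (\<lambda>I. if I = {} then 1 else 0)"
| "wedge_power u (Suc k) = wedge u (wedge_power u k)"

definition ext_vector :: "('n::finite \<Rightarrow> 'r::comm_ring_1) \<Rightarrow> ('n, 'r) ext" where
  "ext_vector b = (\<Sum>i\<in>UNIV. ext_scale (b i) (ext_gen i))"

definition ext_bivector :: "('n::{finite,linorder} \<Rightarrow> 'n \<Rightarrow> 'r::comm_ring_1) \<Rightarrow> ('n, 'r) ext" where
  "ext_bivector b =
     (\<Sum>(i, j)\<in>{(i, j). i < j}. ext_scale (b i j) (wedge (ext_gen i) (ext_gen j)))"

subsection \<open>Contact Lie algebras\<close>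

text \<open>The exterior algebra of the dual space is written in the basis dual to \<open>x\<close>; the resulting
  notion does not depend on \<open>x\<close>.\<close>

definition contact ::
    "('k::field, 'v::ab_group_add) lie_alg \<Rightarrow> ('n::{finite,linorder} \<Rightarrow> 'v) \<Rightarrow> bool" where
  "contact L x \<longleftrightarrow>
     (\<exists>n. ldim L (lspace L) = 2 * n + 1 \<and>
       (\<exists>\<alpha>\<in>lie_dual L.
          wedge (wedge_power (ext_bivector (\<lambda>i j. - \<alpha> (lbracket L (x i) (x j)))) n)
                (ext_vector (\<lambda>i. \<alpha> (x i))) \<noteq> 0))"

subsection \<open>The symmetric algebra and semi-invariants\<close>

text \<open>With respect to the basis \<open>x\<close>, the symmetric algebra is the polynomial ring
  \<open>('n, 'k) mpoly\<close>, the variable \<open>Var i\<close> standing for \<open>x i\<close>, and the dual space is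
  \<open>'n \<Rightarrow> 'k\<close>, the point \<open>a\<close> standing for the functional with value \<open>a i\<close> at \<open>x i\<close>.\<close>

definition lie_linear_form ::
    "('k::field, 'v::ab_group_add) lie_alg \<Rightarrow> ('n::finite \<Rightarrow> 'v) \<Rightarrow> 'v \<Rightarrow> ('n, 'k) mpoly" where
  "lie_linear_form L x v =
     (\<Sum>i\<in>UNIV. Const (module.representation (lscale L) (range x) v (x i)) * Var i)"

text \<open>The derivation of the polynomial ring that sends \<open>Var i\<close> to the bracket of \<open>\<xi>\<close> and \<open>x i\<close>.\<close>

definition lie_act :: "('k::field, 'v::ab_group_add) lie_alg \<Rightarrow> ('n::finite \<Rightarrow> 'v) \<Rightarrow>
    'v \<Rightarrow> ('n, 'k) mpoly \<Rightarrow> ('n, 'k) mpoly" where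
  "lie_act L x \<xi> F = (\<Sum>i\<in>UNIV. lie_linear_form L x (lbracket L \<xi> (x i)) * pderiv_var i F)"

definition semi_invariant ::
    "('k::field, 'v::ab_group_add) lie_alg \<Rightarrow> ('n::finite \<Rightarrow> 'v) \<Rightarrow> ('n, 'k) mpoly \<Rightarrow> bool" where
  "semi_invariant L x F \<longleftrightarrow> (\<forall>\<xi>\<in>lspace L. \<exists>c. lie_act L x \<xi> F = Const c * F)"

definition semi_invariant_ring ::
    "('k::field, 'v::ab_group_add) lie_alg \<Rightarrow> ('n::finite \<Rightarrow> 'v) \<Rightarrow> ('n, 'k) mpoly set" where
  "semi_invariant_ring L x = is_subring hull {F. semi_invariant L x F}"

subsection \<open>Polynomial polyvector fields and the fundamental semi-invariant\<close>

text \<open>Polyvector fields on the dual space: \<open>('n, ('n, 'k) mpoly) ext\<close>, with \<open>ext_gen i\<close>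
  standing for the partial derivative in the direction of the variable \<open>Var i\<close>.\<close>

definition poisson_tensor :: "('k::field, 'v::ab_group_add) lie_alg \<Rightarrow>
    ('n::{finite,linorder} \<Rightarrow> 'v) \<Rightarrow> ('n, ('n, 'k) mpoly) ext" where
  "poisson_tensor L x = ext_bivector (\<lambda>i j. lie_linear_form L x (lbracket L (x i) (x j)))"

definition fundamental_semi_invariant :: "('k::field, 'v::ab_group_add) lie_alg \<Rightarrow>
    ('n::{finite,linorder} \<Rightarrow> 'v) \<Rightarrow> ('n, 'k) mpoly \<Rightarrow> bool" where
  "fundamental_semi_invariant L x p \<longleftrightarrow>
     (let d = (ldim L (lspace L) - lie_index L) div 2 in
      \<exists>R :: ('n, ('n, 'k) mpoly) ext.
        (\<forall>I. R I \<noteq> 0 \<longrightarrow> card I = 2 * d) \<and>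
        wedge_power (poisson_tensor L x) d = ext_scale p R \<and>
        codimension zariski (zeros (range R)) \<ge> 2)"

end

theory Submission
  imports Defs "HOL-Analysis.Determinants"
begin

text \<open>
  Write \<open>\<pi>\<close> for the Poisson tensor and \<open>2 n + 1\<close> for the dimension.  At a contact form the
  Hamiltonian vector fields together with the Euler field span the tangent space, hence they do so
  generically, and some determinant \<open>\<Delta>\<close> of combinations of these fields is a nonzero polynomial.
  If \<open>f\<close> is an irreducible homogeneous semi-invariant, then all these fields map \<open>f\<close> into the ideal
  of \<open>f\<close>, so by Cramer's rule \<open>f\<close> divides \<open>\<Delta> \<partial>\<^sub>k f\<close> for every \<open>k\<close>, and therefore \<open>\<Delta>\<close>.  Thus there
  are finitely many such \<open>f\<close> up to scalars, say \<open>H\<^sub>1, \<dots>, H\<^sub>m\<close>.  Homogeneous components and irreducible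
  factors of semi-invariants are semi-invariants, so the \<open>H\<^sub>i\<close> generate.  Two monomials in the \<open>H\<^sub>i\<close> with
  the same weight and degree have the same logarithmic derivative, again by Cramer's rule, and
  hence coincide; so distinct monomials are eigenvectors with distinct eigenvalues, which gives algebraic
  independence.  Finally, the index is at most \<open>1\<close>, so the fundamental semi-invariant is
  the greatest common divisor of the coefficients of \<open>\<pi>\<^sup>n\<close>.  The Lie derivative of \<open>\<pi>\<close> along a
  Hamiltonian field vanishes, so the ideal of these coefficients is stable under the Lie algebra, and every
  irreducible factor of their greatest common divisor is a semi-invariant.
\<close>

text \<open>In odd dimension the Hamiltonian fields alone never span, since a skew-symmetric matrix
  of odd size is singular. A contact form does not vanish on the one-dimensional kernel of its
  differential, and this says exactly that the Euler field supplies the missing direction. The price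
  is that only homogeneous semi-invariants are controlled directly.

  Cramer's rule is applied over the polynomial ring itself, as a statement about divisibility by
  some \<open>f\<close>; its instance \<open>f = 0\<close> yields the equality of logarithmic
  derivatives.

  Three foundations carry the rest. Irreducible polynomials are prime, which is proved by adding one
  variable at a time inside a fixed type. The codimension condition becomes the absence of a common
  irreducible factor; algebraic closedness enters here, through a Nullstellensatz for a single
  irreducible polynomial. Powers of \<pi> are computed with the operators of left multiplication by
  a generator and of contraction, whose anticommutation relations do the work of associativity of
  the wedge product.\<close>

definition is_hom :: "('a::comm_ring_1 \<Rightarrow> 'b::comm_ring_1) \<Rightarrow> bool" where
  "is_hom h \<longleftrightarrow> h 0 = 0 \<and> h 1 = 1 \<and> (\<forall>a b. h (a + b) = h a + h b) \<and> (\<forall>a b. h (a * b) = h a * h b)"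

lemma
  assumes "is_hom h"
  shows hom_zero: "h 0 = 0" and hom_one: "h 1 = 1"
    and hom_add: "h (a + b) = h a + h b" and hom_mult: "h (a * b) = h a * h b"
  using assms unfolding is_hom_def by auto

lemma hom_uminus:
  assumes "is_hom h"
  shows "h (- a) = - h a"
  using hom_add[OF assms, of a "- a"] by (simp add: hom_zero[OF assms] eq_neg_iff_add_eq_0 add.commute)

lemma hom_diff:
  assumes "is_hom h"
  shows "h (a - b) = h a - h b"
  using hom_add[OF assms, of a "- b"] by (simp add: hom_uminus[OF assms])

lemma hom_sum:
  assumes "is_hom h"
  shows "h (\<Sum>i\<in>A. f i) = (\<Sum>i\<in>A. h (f i))"
  by (induction A rule: infinite_finite_induct) (simp_all add: assms hom_zero hom_add)

lemma hom_prod: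
  assumes "is_hom h"
  shows "h (\<Prod>i\<in>A. f i) = (\<Prod>i\<in>A. h (f i))"
  by (induction A rule: infinite_finite_induct) (simp_all add: assms hom_one hom_mult)

lemma hom_power:
  assumes "is_hom h"
  shows "h (a ^ n) = h a ^ n"
  by (induction n) (simp_all add: assms hom_one hom_mult)

lemma hom_dvd:
  assumes "is_hom h" "a dvd b"
  shows "h a dvd h b"
  using assms by (auto simp: hom_mult)

lemma is_hom_id: "is_hom (\<lambda>c. c)"
  by (simp add: is_hom_def)

lemma is_hom_comp: "is_hom g \<Longrightarrow> is_hom h \<Longrightarrow> is_hom (\<lambda>c. g (h c))"
  by (simp add: is_hom_def)

lemma is_hom_Const: "is_hom (Const :: 'k::comm_ring_1 \<Rightarrow> ('v, 'k) mpoly)"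
  by (simp add: is_hom_def Const_def single_add mult_single)

lemma is_hom_const_poly: "is_hom (\<lambda>c. [:c:])"
  by (simp add: is_hom_def one_pCons)

lemma is_hom_poly: "is_hom (\<lambda>p. poly p x)"
  by (simp add: is_hom_def)

lemmas Const_hom_simps =
  hom_zero[OF is_hom_Const] hom_one[OF is_hom_Const] hom_add[OF is_hom_Const]
  hom_mult[OF is_hom_Const] hom_uminus[OF is_hom_Const] hom_diff[OF is_hom_Const]

lemma Const_eq_iff [simp]: "Const c = Const d \<longleftrightarrow> c = d"
  unfolding Const_def by (metis lookup_single_eq)

lemma Const_eq_0_iff [simp]: "Const c = 0 \<longleftrightarrow> c = 0"
  unfolding Const_def by (metis lookup_single_eq lookup_zero single_zero)

section \<open>Evaluation of polynomials as a ring homomorphism\<close>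

lemma mp_eval_single:
  assumes "h 0 = 0"
  shows "mp_eval h a (Poly_Mapping.single m c) =
    h c * (\<Prod>v\<in>Poly_Mapping.keys m. a v ^ Poly_Mapping.lookup m v)"
  using assms by (cases "c = 0") (auto simp: mp_eval_def)

lemma mp_eval_0 [simp]: "mp_eval h a 0 = 0"
  by (simp add: mp_eval_def)

lemma mp_eval_add:
  assumes "is_hom h"
  shows "mp_eval h a (P + Q) = mp_eval h a P + mp_eval h a Q"
proof -
  let ?A = "Poly_Mapping.keys P \<union> Poly_Mapping.keys Q"
  have "Poly_Mapping.keys (P + Q) \<subseteq> ?A"
    by (rule Poly_Mapping.keys_add)
  then show ?thesis
    by (simp add: mp_eval_superset[of ?A] lookup_add sum.distrib distrib_right hom_zero[OF assms]
        hom_add[OF assms])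
qed

lemma mp_eval_sum:
  assumes "is_hom h"
  shows "mp_eval h a (\<Sum>i\<in>A. f i) = (\<Sum>i\<in>A. mp_eval h a (f i))"
  by (induction A rule: infinite_finite_induct) (auto simp: mp_eval_add[OF assms])

lemma mp_eval_mult:
  assumes "is_hom h"
  shows "mp_eval h a (P * Q) = mp_eval h a P * mp_eval h a Q"
proof -
  have "P * Q = (\<Sum>m\<in>Poly_Mapping.keys P. Poly_Mapping.single m (Poly_Mapping.lookup P m)) *
                (\<Sum>n\<in>Poly_Mapping.keys Q. Poly_Mapping.single n (Poly_Mapping.lookup Q n))"
    using mpoly_sum_monomials by metis
  then have "mp_eval h a (P * Q) =
    (\<Sum>m\<in>Poly_Mapping.keys P. \<Sum>n\<in>Poly_Mapping.keys Q.
       h (Poly_Mapping.lookup P m) * h (Poly_Mapping.lookup Q n) *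
       ((\<Prod>v\<in>Poly_Mapping.keys m. a v ^ Poly_Mapping.lookup m v) *
        (\<Prod>v\<in>Poly_Mapping.keys n. a v ^ Poly_Mapping.lookup n v)))"
    by (simp add: sum_product mp_eval_sum[OF assms] mult_single mp_eval_single
        hom_zero[OF assms] hom_mult[OF assms] monomial_value_add)
  also have "\<dots> = mp_eval h a P * mp_eval h a Q"
    by (simp add: mp_eval_def sum_product mult_ac)
  finally show ?thesis .
qed

lemma mp_eval_Const:
  assumes "is_hom h"
  shows "mp_eval h a (Const c) = h c"
  by (simp add: Const_def mp_eval_single hom_zero[OF assms])

lemma mp_eval_Var:
  assumes "is_hom h"
  shows "mp_eval h a (Var v) = a v"
  by (simp add: Var_def mp_eval_single hom_zero[OF assms] hom_one[OF assms])

lemma is_hom_mp_eval: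
  assumes "is_hom h"
  shows "is_hom (mp_eval h a)"
  using mp_eval_Const[OF assms, of a 1]
  by (simp add: is_hom_def hom_one[OF assms] Const_hom_simps mp_eval_add[OF assms] mp_eval_mult[OF assms])

lemma hom_mp_eval:
  assumes "is_hom g"
  shows "g (mp_eval h a P) = mp_eval (\<lambda>c. g (h c)) (\<lambda>v. g (a v)) P"
  unfolding mp_eval_def
  by (simp add: hom_sum[OF assms] hom_mult[OF assms] hom_prod[OF assms] hom_power[OF assms])

lemma mp_eval_cong:
  assumes "\<And>v. v \<in> vars P \<Longrightarrow> a v = b v"
  shows "mp_eval h a P = mp_eval h b P"
  unfolding mp_eval_def
  by (intro sum.cong prod.cong arg_cong2[of _ _ _ _ "(*)"] refl) (use assms in \<open>force simp: vars_def\<close>)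

lemma Var_power: "Var v ^ n = (Poly_Mapping.single (Poly_Mapping.single v n) 1 :: ('v, 'k::comm_ring_1) mpoly)"
  by (induction n) (simp_all add: Var_def mult_single flip: single_add)

lemma prod_single:
  "(\<Prod>v\<in>A. Poly_Mapping.single (f v) 1) = (Poly_Mapping.single (\<Sum>v\<in>A. f v) 1 :: ('v, 'k::comm_ring_1) mpoly)"
  by (induction A rule: infinite_finite_induct) (simp_all add: mult_single)

lemma prod_Var_power:
  "(\<Prod>v\<in>Poly_Mapping.keys m. Var v ^ Poly_Mapping.lookup m v) =
     (Poly_Mapping.single m 1 :: ('v, 'k::comm_ring_1) mpoly)"
proof -
  have "(\<Sum>v\<in>Poly_Mapping.keys m. Poly_Mapping.single v (Poly_Mapping.lookup m v)) = m"
    by (rule poly_mapping_eqI) (auto simp: lookup_sum lookup_single when_def in_keys_iff)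
  then show ?thesis
    by (simp add: Var_power prod_single)
qed

lemma mp_eval_Const_Var [simp]: "mp_eval Const Var P = (P :: ('v, 'k::comm_ring_1) mpoly)"
  unfolding mp_eval_def prod_Var_power
  by (subst (3) mpoly_sum_monomials) (simp add: Const_def mult_single)

text \<open>The set \<open>S\<close> stands for any subsemiring of the target. Its main use takes
  for \<open>S\<close> the univariate polynomials whose coefficients avoid a given variable.\<close>

lemma mp_eval_in:
  fixes h :: "'a::comm_ring_1 \<Rightarrow> 'b::comm_ring_1" and P :: "('c, 'a) mpoly"
  assumes "0 \<in> S" "1 \<in> S" "\<And>x y. x \<in> S \<Longrightarrow> y \<in> S \<Longrightarrow> x + y \<in> S"
    "\<And>x y. x \<in> S \<Longrightarrow> y \<in> S \<Longrightarrow> x * y \<in> S"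
    "\<And>c. h c \<in> S" "\<And>v. v \<in> vars P \<Longrightarrow> a v \<in> S"
  shows "mp_eval h a P \<in> S"
proof -
  have pow: "x ^ n \<in> S" if "x \<in> S" for x n
    using that assms by (induction n) auto
  have prod: "(\<Prod>v\<in>A. f v) \<in> S" if "\<And>v. v \<in> A \<Longrightarrow> f v \<in> S" for f :: "'c \<Rightarrow> 'b" and A
    using that assms by (induction A rule: infinite_finite_induct) auto
  have sum: "(\<Sum>v\<in>A. f v) \<in> S" if "\<And>v. v \<in> A \<Longrightarrow> f v \<in> S"
    for f :: "('c \<Rightarrow>\<^sub>0 nat) \<Rightarrow> 'b" and A
    using that assms by (induction A rule: infinite_finite_induct) auto
  show ?thesis
    unfolding mp_eval_def
  proof (intro sum assms(4) prod pow assms(5))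
    fix m v
    assume "m \<in> Poly_Mapping.keys P" "v \<in> Poly_Mapping.keys m"
    then show "a v \<in> S" by (intro assms(6)) (auto simp: vars_def)
  qed
qed

section \<open>Polynomials in a subset of the variables\<close>

text \<open>An induction on the number of variables cannot change the type of the variables, so the
  smaller polynomial rings are represented as subsets of one type.\<close>

definition polys_in :: "'v set \<Rightarrow> ('v, 'k::comm_ring_1) mpoly set" where
  "polys_in V = {P. vars P \<subseteq> V}"

lemma vars_Const: "vars (Const c) = {}"
  by (auto simp: vars_def Const_def)

lemma vars_Var: "vars (Var v :: ('v, 'k::comm_ring_1) mpoly) = {v}"
  by (auto simp: vars_def Var_def)

lemma vars_add: "vars (P + Q) \<subseteq> vars P \<union> vars Q"
  unfolding vars_def using Poly_Mapping.keys_add[of P Q] by blast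

lemma vars_uminus: "vars (- P :: ('v, 'k::comm_ring_1) mpoly) = vars P"
  by (auto simp: vars_def in_keys_iff)

lemma vars_mult: "vars (P * Q :: ('v, 'k::comm_ring_1) mpoly) \<subseteq> vars P \<union> vars Q"
proof
  fix v
  assume "v \<in> vars (P * Q)"
  then obtain m where m: "m \<in> Poly_Mapping.keys (P * Q)" "v \<in> Poly_Mapping.keys m"
    by (auto simp: vars_def)
  then obtain a b where ab: "m = a + b" "a \<in> Poly_Mapping.keys P" "b \<in> Poly_Mapping.keys Q"
    using keys_mult[of P Q] by blast
  then have "v \<in> Poly_Mapping.keys a \<or> v \<in> Poly_Mapping.keys b"
    using m Poly_Mapping.keys_add[of a b] by blast
  then show "v \<in> vars P \<union> vars Q"
    using ab by (auto simp: vars_def)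
qed

lemma polys_in_Const: "Const c \<in> polys_in V"
  by (simp add: polys_in_def vars_Const)

lemma polys_in_0: "0 \<in> polys_in V"
  by (simp add: polys_in_def vars_def)

lemma polys_in_1: "1 \<in> polys_in V"
  using polys_in_Const[of 1 V] by (simp add: Const_hom_simps)

lemma polys_in_Var: "v \<in> V \<Longrightarrow> Var v \<in> polys_in V"
  by (simp add: polys_in_def vars_Var)

lemma polys_in_add: "P \<in> polys_in V \<Longrightarrow> Q \<in> polys_in V \<Longrightarrow> P + Q \<in> polys_in V"
  using vars_add[of P Q] by (auto simp: polys_in_def)

lemma polys_in_uminus: "P \<in> polys_in V \<Longrightarrow> - P \<in> polys_in V"
  by (simp add: polys_in_def vars_uminus)

lemma polys_in_diff: "P \<in> polys_in V \<Longrightarrow> Q \<in> polys_in V \<Longrightarrow> P - Q \<in> polys_in V"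
  using polys_in_add[of P V "- Q"] polys_in_uminus by auto

lemma polys_in_mult: "P \<in> polys_in V \<Longrightarrow> Q \<in> polys_in V \<Longrightarrow> P * Q \<in> polys_in V"
  using vars_mult[of P Q] by (auto simp: polys_in_def)

lemma polys_in_power: "P \<in> polys_in V \<Longrightarrow> P ^ n \<in> polys_in V"
  by (induction n) (auto intro: polys_in_1 polys_in_mult)

lemma polys_in_sum: "(\<And>i. i \<in> A \<Longrightarrow> f i \<in> polys_in V) \<Longrightarrow> (\<Sum>i\<in>A. f i) \<in> polys_in V"
  by (induction A rule: infinite_finite_induct) (auto intro: polys_in_0 polys_in_add)

text \<open>The polynomial regarded as univariate in \<open>v\<close>. The type would let
  \<open>v\<close> occur in the coefficients as well; \<open>coeff_to_poly_in\<close> excludes this,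
  and \<open>poly_to_poly\<close> recovers the original polynomial.\<close>

definition to_poly :: "'v \<Rightarrow> ('v, 'k::comm_ring_1) mpoly \<Rightarrow> ('v, 'k) mpoly poly" where
  "to_poly v = mp_eval (\<lambda>c. [:Const c:]) (\<lambda>u. if u = v then [:0, 1:] else [:Var u:])"

abbreviation deg_var :: "'v \<Rightarrow> ('v, 'k::comm_ring_1) mpoly \<Rightarrow> nat" where
  "deg_var v P \<equiv> degree (to_poly v P)"

lemma is_hom_to_poly: "is_hom (to_poly v)"
  unfolding to_poly_def
  by (intro is_hom_mp_eval is_hom_comp[OF is_hom_const_poly is_hom_Const])

lemmas to_poly_simps =
  hom_zero[OF is_hom_to_poly] hom_one[OF is_hom_to_poly] hom_add[OF is_hom_to_poly]
  hom_mult[OF is_hom_to_poly] hom_uminus[OF is_hom_to_poly] hom_diff[OF is_hom_to_poly]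
  hom_power[OF is_hom_to_poly]

lemma to_poly_Var: "to_poly v (Var u) = (if u = v then [:0, 1:] else [:Var u:])"
  unfolding to_poly_def by (rule mp_eval_Var) (intro is_hom_comp[OF is_hom_const_poly is_hom_Const])

lemma poly_to_poly [simp]: "poly (to_poly v P) (Var v) = P"
proof -
  have "poly (to_poly v P) (Var v) = mp_eval Const Var P"
    unfolding to_poly_def hom_mp_eval[OF is_hom_poly]
    by (simp add: if_distrib[of "\<lambda>p. poly p (Var v)"])
       (rule arg_cong[of _ _ "\<lambda>a. mp_eval Const a P", THEN trans[OF _ mp_eval_Const_Var]]; auto)
  then show ?thesis by simp
qed

lemma to_poly_inject: "to_poly v P = to_poly v Q \<longleftrightarrow> P = Q"
  by (metis poly_to_poly)

lemma to_poly_eq_0_iff: "to_poly v P = 0 \<longleftrightarrow> P = 0"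
  using to_poly_inject[of v P 0] by (simp add: to_poly_simps)

lemma to_poly_const:
  assumes "v \<notin> vars P"
  shows "to_poly v P = [:P:]"
proof -
  have "to_poly v P = mp_eval (\<lambda>c. [:Const c:]) (\<lambda>u. [:Var u:]) P"
    unfolding to_poly_def by (rule mp_eval_cong) (use assms in auto)
  also have "\<dots> = [:P:]"
    using hom_mp_eval[OF is_hom_const_poly, of Const Var P] by simp
  finally show ?thesis .
qed

lemma coeff_to_poly_in: "coeff (to_poly v P) i \<in> polys_in (vars P - {v})"
proof -
  let ?V = "polys_in (vars P - {v})"
  have "to_poly v P \<in> {p. \<forall>i. coeff p i \<in> ?V}"
    unfolding to_poly_def
    by (rule mp_eval_in)
      (auto simp: coeff_pCons polys_in_0 polys_in_1 polys_in_add coeff_mult one_pCons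
        intro!: polys_in_sum polys_in_mult polys_in_Const polys_in_Var split: nat.split)
  then show ?thesis by simp
qed

lemma deg_var_eq_0_iff: "deg_var v P = 0 \<longleftrightarrow> v \<notin> vars P"
proof
  assume "deg_var v P = 0"
  then obtain c where c: "to_poly v P = [:c:]" by (metis degree_eq_zeroE)
  then have "P = c" by (metis poly_to_poly poly_pCons poly_0 mult_zero_right add_0_right)
  then show "v \<notin> vars P"
    using coeff_to_poly_in[of v P 0] c by (auto simp: polys_in_def)
qed (simp add: to_poly_const)

text \<open>The linear order on the variables orders the monomials, which is what makes the
  polynomial ring an instance of \<open>idom\<close>.\<close>

lemma deg_var_mult:
  fixes P Q :: "('v::linorder, 'k::idom) mpoly"
  assumes "P \<noteq> 0" "Q \<noteq> 0"
  shows "deg_var v (P * Q) = deg_var v P + deg_var v Q"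
  using assms by (simp add: to_poly_simps degree_mult_eq to_poly_eq_0_iff)

text \<open>Over an integral domain the degree in each variable is additive, so no variable of a
  factor can cancel. Hence the rings \<open>polys_in V\<close> are closed under taking factors of
  nonzero elements.\<close>

lemma vars_mult_eq:
  fixes P Q :: "('v::linorder, 'k::idom) mpoly"
  assumes "P \<noteq> 0" "Q \<noteq> 0"
  shows "vars (P * Q) = vars P \<union> vars Q"
proof -
  have "v \<in> vars (P * Q) \<longleftrightarrow> v \<in> vars P \<or> v \<in> vars Q" for v
    using deg_var_mult[OF assms, of v] deg_var_eq_0_iff[of v] by (metis add_is_0)
  then show ?thesis by blast
qed

lemma polys_in_factor:
  fixes P Q :: "('v::linorder, 'k::idom) mpoly"
  assumes "P * Q \<in> polys_in V" "P * Q \<noteq> 0"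
  shows "P \<in> polys_in V" "Q \<in> polys_in V"
  using assms vars_mult_eq[of P Q] by (auto simp: polys_in_def)

section \<open>The grading\<close>

definition mdeg :: "('v \<Rightarrow>\<^sub>0 nat) \<Rightarrow> nat" where
  "mdeg m = (\<Sum>v\<in>Poly_Mapping.keys m. Poly_Mapping.lookup m v)"

lemma mdeg_superset: "finite A \<Longrightarrow> Poly_Mapping.keys m \<subseteq> A \<Longrightarrow> mdeg m = (\<Sum>v\<in>A. Poly_Mapping.lookup m v)"
  unfolding mdeg_def by (rule sum.mono_neutral_left) (auto simp: in_keys_iff)

lemma mdeg_add: "mdeg (m + n) = mdeg m + mdeg n"
proof -
  let ?A = "Poly_Mapping.keys m \<union> Poly_Mapping.keys n"
  have "Poly_Mapping.keys (m + n) \<subseteq> ?A" by (rule Poly_Mapping.keys_add)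
  then show ?thesis
    by (simp add: mdeg_superset[of ?A] lookup_add sum.distrib)
qed

lemma mdeg_0 [simp]: "mdeg 0 = 0"
  by (simp add: mdeg_def)

lemma mdeg_single [simp]: "mdeg (Poly_Mapping.single v n) = n"
  by (simp add: mdeg_def)

lemma mdeg_eq_0_iff: "mdeg m = 0 \<longleftrightarrow> m = 0"
proof
  assume "mdeg m = 0"
  then have "Poly_Mapping.lookup m v = 0" for v
    by (cases "v \<in> Poly_Mapping.keys m") (auto simp: mdeg_def in_keys_iff)
  then show "m = 0" by (intro poly_mapping_eqI) simp
qed simp

text \<open>Substituting \<open>t u\<close> for each variable \<open>u\<close>: the coefficient at \<open>t\<^sup>d\<close> is the homogeneous component
  of degree \<open>d\<close>.\<close>

definition grading :: "('v, 'k::comm_ring_1) mpoly \<Rightarrow> ('v, 'k) mpoly poly" where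
  "grading = mp_eval (\<lambda>c. [:Const c:]) (\<lambda>u. [:0, Var u:])"

abbreviation hcomp :: "nat \<Rightarrow> ('v, 'k::comm_ring_1) mpoly \<Rightarrow> ('v, 'k) mpoly" where
  "hcomp d P \<equiv> coeff (grading P) d"

abbreviation tdeg :: "('v, 'k::comm_ring_1) mpoly \<Rightarrow> nat" where
  "tdeg P \<equiv> degree (grading P)"

lemma is_hom_grading: "is_hom grading"
  unfolding grading_def
  by (intro is_hom_mp_eval is_hom_comp[OF is_hom_const_poly is_hom_Const])

lemmas grading_simps =
  hom_zero[OF is_hom_grading] hom_one[OF is_hom_grading] hom_add[OF is_hom_grading]
  hom_mult[OF is_hom_grading] hom_uminus[OF is_hom_grading] hom_diff[OF is_hom_grading]

lemma grading_Const: "grading (Const c) = [:Const c:]"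
  unfolding grading_def by (rule mp_eval_Const) (intro is_hom_comp[OF is_hom_const_poly is_hom_Const])

lemma poly_grading_1 [simp]: "poly (grading P) 1 = P"
proof -
  have "poly (grading P) 1 = mp_eval Const Var P"
    unfolding grading_def hom_mp_eval[OF is_hom_poly] by simp
  then show ?thesis by simp
qed

lemma grading_eq_0_iff: "grading P = 0 \<longleftrightarrow> P = 0"
  by (metis poly_grading_1 grading_simps(1))

lemma sum_hcomp: "P = (\<Sum>d\<le>tdeg P. hcomp d P)"
  using poly_grading_1[of P] by (simp add: poly_altdef)

lemma grading_single: "grading (Poly_Mapping.single m c) = monom (Poly_Mapping.single m c) (mdeg m)"
proof -
  have "[:0, Var v:] ^ n = monom (Var v ^ n :: ('a, 'b) mpoly) n" for v n
    by (induction n) (simp_all add: monom_Suc one_pCons monom_0 smult_monom)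
  then have "grading (Poly_Mapping.single m c) =
      [:Const c:] * (\<Prod>v\<in>Poly_Mapping.keys m. monom (Var v ^ Poly_Mapping.lookup m v) (Poly_Mapping.lookup m v))"
    unfolding grading_def by (subst mp_eval_single) (simp_all add: Const_hom_simps)
  also have "(\<Prod>v\<in>A. monom (f v) (g v)) = monom (\<Prod>v\<in>A. f v) (\<Sum>v\<in>A. g v)"
    for f :: "'a \<Rightarrow> ('a, 'b) mpoly" and g A
    by (induction A rule: infinite_finite_induct) (simp_all add: mult_monom)
  finally show ?thesis
    by (simp add: prod_Var_power mdeg_def smult_monom Const_def mult_single)
qed

lemma lookup_hcomp:
  "Poly_Mapping.lookup (hcomp d P) m = (if mdeg m = d then Poly_Mapping.lookup P m else 0)"
proof -
  have "hcomp d P = (\<Sum>m\<in>Poly_Mapping.keys P. if mdeg m = d then Poly_Mapping.single m (Poly_Mapping.lookup P m) else 0)"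
    by (subst (1) mpoly_sum_monomials) (simp add: hom_sum[OF is_hom_grading] coeff_sum grading_single)
  also have "Poly_Mapping.lookup \<dots> m =
      (\<Sum>n\<in>Poly_Mapping.keys P. if n = m then (if mdeg m = d then Poly_Mapping.lookup P m else 0) else 0)"
    unfolding lookup_sum by (rule sum.cong) (auto simp: lookup_single when_def)
  finally show ?thesis by (simp add: in_keys_iff)
qed

lemma mdeg_le_tdeg:
  assumes "m \<in> Poly_Mapping.keys P"
  shows "mdeg m \<le> tdeg P"
  by (rule le_degree) (use assms in \<open>auto simp: in_keys_iff poly_mapping_eq_iff lookup_hcomp fun_eq_iff\<close>)

lemma tdeg_attained:
  assumes "P \<noteq> 0"
  shows "\<exists>m\<in>Poly_Mapping.keys P. mdeg m = tdeg P"
proof -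
  have "hcomp (tdeg P) P \<noteq> 0" using assms by (simp add: grading_eq_0_iff)
  then obtain m where "Poly_Mapping.lookup (hcomp (tdeg P) P) m \<noteq> 0"
    by (metis poly_mapping_eqI lookup_zero)
  then show ?thesis by (auto simp: lookup_hcomp in_keys_iff split: if_splits)
qed

definition hom_of_degree :: "nat \<Rightarrow> ('v, 'k::comm_ring_1) mpoly \<Rightarrow> bool" where
  "hom_of_degree d P \<longleftrightarrow> (\<forall>m\<in>Poly_Mapping.keys P. mdeg m = d)"

lemma homogeneous_iff: "homogeneous P \<longleftrightarrow> (\<exists>d. hom_of_degree d P)"
  by (simp add: homogeneous_def hom_of_degree_def mdeg_def)

lemma hom_of_degree_hcomp: "hom_of_degree d (hcomp d P)"
  by (auto simp: hom_of_degree_def in_keys_iff lookup_hcomp split: if_splits)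

lemma hom_of_degree_iff: "hom_of_degree d P \<longleftrightarrow> grading P = monom P d"
proof
  assume "hom_of_degree d P"
  then have "hcomp e P = (if e = d then P else 0)" for e
    by (intro poly_mapping_eqI) (auto simp: lookup_hcomp hom_of_degree_def in_keys_iff)
  then show "grading P = monom P d" by (intro poly_eqI) auto
next
  assume "grading P = monom P d"
  then have "hcomp d P = P" by simp
  then show "hom_of_degree d P" using hom_of_degree_hcomp by metis
qed

lemma hom_of_degree_mult: "hom_of_degree d P \<Longrightarrow> hom_of_degree e Q \<Longrightarrow> hom_of_degree (d + e) (P * Q)"
  by (simp add: hom_of_degree_iff grading_simps mult_monom)

lemma hom_of_degree_add: "hom_of_degree d P \<Longrightarrow> hom_of_degree d Q \<Longrightarrow> hom_of_degree d (P + Q)"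
  by (simp add: hom_of_degree_iff grading_simps add_monom)

lemma hom_of_degree_0: "hom_of_degree d 0"
  by (simp add: hom_of_degree_def)

lemma hom_of_degree_sum: "(\<And>i. i \<in> A \<Longrightarrow> hom_of_degree d (f i)) \<Longrightarrow> hom_of_degree d (\<Sum>i\<in>A. f i)"
  by (induction A rule: infinite_finite_induct) (auto intro: hom_of_degree_0 hom_of_degree_add)

lemma hom_of_degree_Const: "hom_of_degree 0 (Const c)"
  by (simp add: hom_of_degree_iff grading_Const monom_0)

lemma hom_of_degree_Var: "hom_of_degree 1 (Var v)"
  by (simp add: hom_of_degree_def Var_def)

lemma tdeg_mult:
  fixes P Q :: "('v::linorder, 'k::idom) mpoly"
  assumes "P \<noteq> 0" "Q \<noteq> 0"
  shows "tdeg (P * Q) = tdeg P + tdeg Q"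
  using assms by (simp add: grading_simps degree_mult_eq grading_eq_0_iff)

lemma tdeg_Const [simp]: "tdeg (Const c) = 0"
  by (simp add: grading_Const)

lemma tdeg_0_imp_Const:
  assumes "tdeg P = 0"
  obtains c where "P = Const c"
proof -
  have "P = Poly_Mapping.single 0 (Poly_Mapping.lookup P 0)"
  proof (rule poly_mapping_eqI)
    fix m
    show "Poly_Mapping.lookup P m = Poly_Mapping.lookup (Poly_Mapping.single 0 (Poly_Mapping.lookup P 0)) m"
      using mdeg_le_tdeg[of m P] assms mdeg_eq_0_iff[of m]
      by (cases "m = 0") (auto simp: in_keys_iff lookup_single when_def)
  qed
  then show ?thesis using that unfolding Const_def by metis
qed

text \<open>The order of vanishing at 0 is at most the degree, and both are additive on products. A
  monomial has equality, so each of its factors has it too.\<close>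

lemma poly_monom_factor:
  fixes p q :: "'a::idom poly"
  assumes "p * q = monom c n" "c \<noteq> 0"
  shows "\<exists>d. p = monom d (degree p)"
proof -
  have nz: "p \<noteq> 0" "q \<noteq> 0" using assms by auto
  have "order 0 p + order 0 q = degree p + degree q"
    using order_mult[of p q 0] degree_mult_eq[OF nz] assms nz
    by (simp add: degree_monom_eq)
  moreover have "order 0 p \<le> degree p" "order 0 q \<le> degree q"
    using nz by (simp_all add: order_degree)
  ultimately have "order 0 p = degree p"
    by linarith
  then have "[:0, 1:] ^ degree p dvd p"
    using order_1[of 0 p] by simp
  then obtain r where r: "p = [:0, 1:] ^ degree p * r" by blast
  moreover have "degree ([:0, 1:] ^ degree p * r) = degree p + degree r"
    using r nz by (subst degree_mult_eq) (auto simp: degree_power_eq)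
  ultimately have "degree p = degree p + degree r" by metis
  then have "degree r = 0" by simp
  then obtain d where d: "r = [:d:]" by (metis degree_eq_zeroE)
  have "[:0, 1:] ^ degree p * [:d:] = monom d (degree p)"
    by (simp add: monom_altdef)
  then show ?thesis using r d by metis
qed

text \<open>\<open>grading\<close> is multiplicative and sends homogeneous polynomials to monomials,
  so \<open>poly_monom_factor\<close> applies.\<close>

lemma hom_of_degree_factor:
  fixes P Q :: "('v::linorder, 'k::idom) mpoly"
  assumes "hom_of_degree d (P * Q)" "P * Q \<noteq> 0"
  shows "hom_of_degree (tdeg P) P"
proof -
  have "grading P * grading Q = monom (P * Q) d"
    using assms by (simp add: hom_of_degree_iff grading_simps)
  then obtain R where R: "grading P = monom R (tdeg P)"
    using poly_monom_factor assms(2) by blast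
  then have "R = P" by (metis poly_grading_1 poly_monom power_one mult_1_right)
  then show ?thesis using R by (simp add: hom_of_degree_iff)
qed

section \<open>Unique factorization\<close>

text \<open>Primality tested on \<open>S\<close> only, although divisibility refers to the whole
  ring. For \<open>S = polys_in V\<close> and \<open>p\<close> in \<open>S\<close> the two notions
  of divisibility agree, since quotients of elements of \<open>S\<close> stay in
  \<open>S\<close>.\<close>

definition prime_on :: "'a::comm_ring_1 set \<Rightarrow> 'a \<Rightarrow> bool" where
  "prime_on S p \<longleftrightarrow> (\<forall>a\<in>S. \<forall>b\<in>S. p dvd a * b \<longrightarrow> p dvd a \<or> p dvd b)"

lemma Const_inverse:
  fixes d :: "'k::field"
  assumes "d \<noteq> 0"
  shows "Const (inverse d) * Const d = 1"
proof -
  have "Const (inverse d * d) = 1" using assms by (simp add: Const_hom_simps(2))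
  then show ?thesis by (simp only: Const_hom_simps(4))
qed

lemma mpoly_unit_iff:
  fixes P :: "('v::linorder, 'k::field) mpoly"
  shows "P dvd 1 \<longleftrightarrow> (\<exists>c. c \<noteq> 0 \<and> P = Const c)"
proof
  assume "P dvd 1"
  then obtain Q where Q: "1 = P * Q" by blast
  have "P \<noteq> 0" "Q \<noteq> 0" using Q by auto
  then have "tdeg P + tdeg Q = tdeg (1 :: ('v, 'k) mpoly)"
    using Q tdeg_mult by metis
  then have "tdeg P = 0" by (simp add: grading_simps)
  then show "\<exists>c. c \<noteq> 0 \<and> P = Const c"
    using \<open>P \<noteq> 0\<close> by (metis tdeg_0_imp_Const Const_eq_0_iff)
next
  assume "\<exists>c. c \<noteq> 0 \<and> P = Const c"
  then obtain c where c: "c \<noteq> 0" "P = Const c" by blast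
  then have "P * Const (inverse c) = 1"
    by (simp add: Const_inverse mult.commute[of "Const c"])
  then show "P dvd 1" by (metis dvd_triv_left)
qed

lemma tdeg_eq_0_iff:
  fixes P :: "('v::linorder, 'k::field) mpoly"
  assumes "P \<noteq> 0"
  shows "tdeg P = 0 \<longleftrightarrow> P dvd 1"
  unfolding mpoly_unit_iff using assms by (metis Const_eq_0_iff tdeg_0_imp_Const tdeg_Const)

lemma irreducible_factorization:
  fixes P :: "('v::linorder, 'k::field) mpoly"
  assumes "P \<noteq> 0"
  shows "\<exists>c fs. c \<noteq> 0 \<and> P = Const c * prod_list fs \<and> (\<forall>f\<in>set fs. irreducible f)"
  using assms
proof (induction "tdeg P" arbitrary: P rule: less_induct)
  case less
  consider "P dvd 1" | "irreducible P" | Q R where "P = Q * R" "\<not> Q dvd 1" "\<not> R dvd 1"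
    using less.prems by (auto simp: irreducible_def)
  then show ?case
  proof cases
    case 1
    then obtain c where "c \<noteq> 0" "P = Const c * prod_list []"
      by (auto simp: mpoly_unit_iff)
    then show ?thesis by (metis empty_iff empty_set)
  next
    case 2
    then have "P = Const 1 * prod_list [P]" "\<forall>f\<in>set [P]. irreducible f"
      by (auto simp: Const_hom_simps)
    then show ?thesis using one_neq_zero by metis
  next
    case 3
    have nz: "Q \<noteq> 0" "R \<noteq> 0" using 3 less.prems by auto
    have "tdeg P = tdeg Q + tdeg R" using 3 tdeg_mult nz by simp
    moreover have "tdeg Q \<noteq> 0" "tdeg R \<noteq> 0" using 3 nz by (simp_all add: tdeg_eq_0_iff)
    ultimately have "tdeg Q < tdeg P" "tdeg R < tdeg P" by auto
    from less.hyps[OF this(1) nz(1)] less.hyps[OF this(2) nz(2)]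
    obtain c fs d gs where *: "c \<noteq> 0" "d \<noteq> 0" "Q = Const c * prod_list fs" "R = Const d * prod_list gs"
      "\<forall>f\<in>set fs. irreducible f" "\<forall>f\<in>set gs. irreducible f" by metis
    then have "P = Const (c * d) * prod_list (fs @ gs)" "\<forall>f\<in>set (fs @ gs). irreducible f"
      using 3 by (auto simp: Const_hom_simps mult_ac)
    moreover have "c * d \<noteq> 0" using * by simp
    ultimately show ?thesis by blast
  qed
qed

lemma polys_in_prod_list:
  fixes fs :: "('v::linorder, 'k::idom) mpoly list"
  assumes "prod_list fs \<in> polys_in V" "prod_list fs \<noteq> 0" "f \<in> set fs"
  shows "f \<in> polys_in V"
  using assms by (induction fs) (auto dest: polys_in_factor)

lemma irreducible_factorization_in:
  fixes P :: "('v::linorder, 'k::field) mpoly"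
  assumes "P \<noteq> 0" "P \<in> polys_in V"
  shows "\<exists>c fs. c \<noteq> 0 \<and> P = Const c * prod_list fs \<and> (\<forall>f\<in>set fs. irreducible f \<and> f \<in> polys_in V)"
proof -
  obtain c fs where *: "c \<noteq> 0" "P = Const c * prod_list fs" "\<forall>f\<in>set fs. irreducible f"
    using irreducible_factorization[OF assms(1)] by blast
  then have "prod_list fs \<in> polys_in V" "prod_list fs \<noteq> 0"
    using assms polys_in_factor(2)[of "Const c" "prod_list fs" V] by auto
  then show ?thesis using * polys_in_prod_list by blast
qed

lemma irreducible_dvd_irreducible:
  fixes p q :: "'a::idom"
  assumes "irreducible p" "irreducible q" "p dvd q"
  shows "q dvd p"
proof -
  obtain z where z: "q = p * z" using assms by blast
  then have "z dvd 1" using assms by (auto simp: irreducible_def)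
  then obtain w where "1 = z * w" by blast
  then have "p = q * w" using z by (simp add: mult.assoc)
  then show ?thesis by simp
qed

text \<open>Gauss's lemma. Take the first coefficients of \<open>p\<close> and \<open>q\<close>, at
  \<open>i\<close> and \<open>j\<close>, that \<open>c\<close> does not divide: in the coefficient
  of \<open>p * q\<close> at \<open>i + j\<close> every other summand is a multiple of
  \<open>c\<close>.\<close>

lemma prime_on_const_poly:
  fixes c :: "'a::idom"
  assumes prime: "prime_on S c" and sum: "\<And>x y. x \<in> S \<Longrightarrow> y \<in> S \<Longrightarrow> x * y \<in> S"
    and p: "\<And>i. coeff p i \<in> S" and q: "\<And>i. coeff q i \<in> S" and dvd: "[:c:] dvd p * q"
  shows "[:c:] dvd p \<or> [:c:] dvd q"
proof (rule ccontr)
  assume "\<not> ([:c:] dvd p \<or> [:c:] dvd q)"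
  then have ex: "\<exists>i. \<not> c dvd coeff p i" "\<exists>i. \<not> c dvd coeff q i"
    using const_poly_dvd_iff[of c p] const_poly_dvd_iff[of c q] by metis+
  define i where "i = (LEAST i. \<not> c dvd coeff p i)"
  define j where "j = (LEAST j. \<not> c dvd coeff q j)"
  have i: "\<not> c dvd coeff p i" "\<And>k. k < i \<Longrightarrow> c dvd coeff p k"
    unfolding i_def using LeastI_ex[OF ex(1)] not_less_Least by blast+
  have j: "\<not> c dvd coeff q j" "\<And>k. k < j \<Longrightarrow> c dvd coeff q k"
    unfolding j_def using LeastI_ex[OF ex(2)] not_less_Least by blast+
  have "c dvd coeff (p * q) (i + j)"
    using dvd by (simp add: const_poly_dvd_iff)
  also have "coeff (p * q) (i + j) =
      coeff p i * coeff q j + (\<Sum>k\<in>{..i + j} - {i}. coeff p k * coeff q (i + j - k))"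
    by (subst coeff_mult, subst sum.remove[of _ i]) auto
  also have "c dvd \<dots> \<longleftrightarrow> c dvd coeff p i * coeff q j"
  proof (rule dvd_add_left_iff, rule dvd_sum)
    fix k
    assume "k \<in> {..i + j} - {i}"
    then have "k < i \<or> i + j - k < j" by auto
    then show "c dvd coeff p k * coeff q (i + j - k)"
      using i(2) j(2) by (auto intro: dvd_mult dvd_mult2)
  qed
  finally show False
    using prime p q i(1) j(1) by (auto simp: prime_on_def)
qed

lemma const_dvd_to_poly_iff:
  fixes P :: "('v::linorder, 'k::idom) mpoly"
  assumes "v \<notin> vars c"
  shows "[:c:] dvd to_poly v P \<longleftrightarrow> c dvd P"
proof
  assume "[:c:] dvd to_poly v P"
  then have "poly [:c:] (Var v) dvd poly (to_poly v P) (Var v)"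
    by (rule hom_dvd[OF is_hom_poly])
  then show "c dvd P" by simp
next
  assume "c dvd P"
  then have "to_poly v c dvd to_poly v P" by (rule hom_dvd[OF is_hom_to_poly])
  then show "[:c:] dvd to_poly v P" by (simp add: to_poly_const[OF assms])
qed

lemma prime_on_insert:
  fixes c :: "('v::linorder, 'k::field) mpoly"
  assumes "prime_on (polys_in W) c" "c \<in> polys_in W" "v \<notin> W"
  shows "prime_on (polys_in (insert v W)) c"
  unfolding prime_on_def
proof (intro ballI impI)
  fix P Q
  assume P: "P \<in> polys_in (insert v W)" and Q: "Q \<in> polys_in (insert v W)" and "c dvd P * Q"
  have v: "v \<notin> vars c" using assms by (auto simp: polys_in_def)
  have *: "coeff (to_poly v P) i \<in> polys_in W" if "P \<in> polys_in (insert v W)" for P i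
    using that coeff_to_poly_in[of v P i] by (auto simp: polys_in_def)
  have "[:c:] dvd to_poly v P * to_poly v Q"
    using \<open>c dvd P * Q\<close> const_dvd_to_poly_iff[OF v, of "P * Q"] by (simp add: to_poly_simps)
  then have "[:c:] dvd to_poly v P \<or> [:c:] dvd to_poly v Q"
    by (intro prime_on_const_poly[OF assms(1)] polys_in_mult * P Q)
  then show "c dvd P \<or> c dvd Q" by (simp add: const_dvd_to_poly_iff[OF v])
qed

definition irreducibles_prime_on :: "'a::comm_ring_1 set \<Rightarrow> bool" where
  "irreducibles_prime_on S \<longleftrightarrow> (\<forall>f\<in>S. irreducible f \<longrightarrow> prime_on S f)"

section \<open>One more variable: irreducible polynomials remain prime\<close>

context
  fixes W :: "'v::linorder set" and v :: 'v and f :: "('v, 'k::field) mpoly"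
  assumes W: "irreducibles_prime_on (polys_in W :: ('v, 'k) mpoly set)" and v: "v \<notin> W"
    and f: "irreducible f" "f \<in> polys_in (insert v W)"
begin

lemma prime_factor_cases:
  fixes p :: "('v, 'k) mpoly"
  assumes "irreducible p" "p \<in> polys_in W" "p dvd x * y"
    "x \<in> polys_in (insert v W)" "y \<in> polys_in (insert v W)"
  shows "p dvd x \<or> p dvd y"
proof -
  have "prime_on (polys_in (insert v W)) p"
    using W assms(1,2) by (intro prime_on_insert[OF _ assms(2) v]) (auto simp: irreducibles_prime_on_def)
  then show ?thesis using assms(3-5) by (auto simp: prime_on_def)
qed

text \<open>Each \<open>p\<close> is prime in the larger ring by Gauss's lemma and cannot divide
  \<open>f\<close>: it would be associated to \<open>f\<close>, which involves \<open>v\<close>. So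
  \<open>p\<close> divides \<open>u\<close> and can be cancelled from the equation.\<close>

lemma cancel_constants_list:
  assumes "deg_var v f \<noteq> 0" "prod_list ps * y = f * u" "\<forall>p\<in>set ps. irreducible p \<and> p \<in> polys_in W"
    "u \<in> polys_in (insert v W)"
  shows "f dvd y"
  using assms(2-4)
proof (induction ps arbitrary: u)
  case (Cons p ps)
  then have p: "irreducible p" "p \<in> polys_in W" "p \<noteq> 0" by (auto simp: irreducible_def)
  have "p dvd f * u" using Cons.prems(1) by (metis dvd_triv_left mult.assoc prod_list.Cons)
  then have "p dvd f \<or> p dvd u" using prime_factor_cases p f Cons.prems by blast
  moreover have "\<not> p dvd f"
  proof
    assume "p dvd f"
    then obtain z where z: "p = f * z" using irreducible_dvd_irreducible p f by blast
    then have "f \<in> polys_in W" using polys_in_factor(1) p by blast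
    then show False using assms(1) v by (auto simp: deg_var_eq_0_iff polys_in_def)
  qed
  ultimately obtain u' where u': "u = p * u'" by blast
  have "p * (prod_list ps * y) = p * (f * u')"
    using Cons.prems(1) u' by (simp add: mult_ac)
  then have eq: "prod_list ps * y = f * u'" using p by simp
  show ?case
  \<comment> \<open>The cofactor \<open>u'\<close> is known to avoid the other variables only when
    the product \<open>u\<close> is nonzero.\<close>
  proof (cases "u = 0")
    case True
    have "0 \<notin> set (p # ps)" using Cons.prems(2) by (metis not_irreducible_zero)
    then have "prod_list (p # ps) \<noteq> 0" by (simp only: prod_list_zero_iff not_False_eq_True)
    then have "y = 0" using Cons.prems(1) True by simp
    then show ?thesis by simp
  next
    case False
    then have "u' \<in> polys_in (insert v W)" using Cons.prems(3) u' polys_in_factor(2) by blast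
    then show ?thesis using Cons.IH[OF eq] Cons.prems(2) by simp
  qed
qed simp

lemma cancel_constants:
  assumes "deg_var v f \<noteq> 0" "c * y = f * u" "c \<noteq> 0" "c \<in> polys_in W" "u \<in> polys_in (insert v W)"
  shows "f dvd y"
proof -
  obtain d ps where d: "d \<noteq> 0" "c = Const d * prod_list ps"
    "\<forall>p\<in>set ps. irreducible p \<and> p \<in> polys_in W"
    using irreducible_factorization_in assms by blast
  then have "prod_list ps * (Const d * y) = f * u" using assms by (simp add: mult_ac)
  then have "f dvd Const d * y" using cancel_constants_list assms d by blast
  then have "f dvd Const (inverse d) * (Const d * y)" by simp
  moreover have "Const (inverse d) * (Const d * y) = y"
    using Const_inverse[OF d(1)] by (metis mult.assoc mult_1)
  ultimately show ?thesis by simp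
qed

text \<open>Every \<open>p\<close> in the list divides \<open>q\<close> or \<open>r\<close> and is
  cancelled there. What is removed from \<open>r\<close> is collected in \<open>c\<close>; what is
  removed from \<open>q\<close> can be forgotten.\<close>

lemma split_constants_list:
  fixes g :: "('v, 'k) mpoly"
  assumes "prod_list ps * g = q * r" "\<forall>p\<in>set ps. irreducible p \<and> p \<in> polys_in W" "g \<noteq> 0"
    "q \<in> polys_in (insert v W)" "r \<in> polys_in (insert v W)"
  shows "\<exists>q' r' c. g = q' * r' \<and> r = c * r' \<and> c \<noteq> 0 \<and> c \<in> polys_in W"
  using assms
proof (induction ps arbitrary: q r)
  case Nil
  then show ?case by (intro exI[of _ q] exI[of _ r] exI[of _ 1]) (simp add: polys_in_1)
next
  case (Cons p ps)
  then have p: "irreducible p" "p \<in> polys_in W" "p \<noteq> 0" by (auto simp: irreducible_def)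
  have "0 \<notin> set (p # ps)" using Cons.prems(2) by (metis not_irreducible_zero)
  then have "prod_list (p # ps) \<noteq> 0" by (simp only: prod_list_zero_iff not_False_eq_True)
  then have nz: "q \<noteq> 0" "r \<noteq> 0" using Cons.prems by auto
  have "p dvd q * r" using Cons.prems(1) by (metis dvd_triv_left mult.assoc prod_list.Cons)
  then consider "p dvd q" | "p dvd r" using prime_factor_cases p Cons.prems by blast
  then show ?case
  proof cases
    case 1
    then obtain q1 where q1: "q = p * q1" by blast
    then have "p * (prod_list ps * g) = p * (q1 * r)" using Cons.prems(1) by (simp add: mult_ac)
    then have "prod_list ps * g = q1 * r" using p by simp
    moreover have "q1 \<in> polys_in (insert v W)" using q1 nz Cons.prems polys_in_factor(2) by blast
    ultimately show ?thesis using Cons.IH[of q1 r] Cons.prems by simp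
  next
    case 2
    then obtain r1 where r1: "r = p * r1" by blast
    then have "p * (prod_list ps * g) = p * (q * r1)" using Cons.prems(1) by (simp add: mult_ac)
    then have "prod_list ps * g = q * r1" using p by simp
    moreover have "r1 \<in> polys_in (insert v W)" using r1 nz Cons.prems polys_in_factor(2) by blast
    ultimately obtain q' r' c where *: "g = q' * r'" "r1 = c * r'" "c \<noteq> 0" "c \<in> polys_in W"
      using Cons.IH[of q r1] Cons.prems by auto
    then have "r = (p * c) * r'" "p * c \<noteq> 0" "p * c \<in> polys_in W"
      using r1 p * by (auto simp: mult.assoc intro: polys_in_mult)
    then show ?thesis using *(1) by (intro exI[of _ q'] exI[of _ r'] exI[of _ "p * c"]) blast
  qed
qed

lemma split_constants:
  fixes g :: "('v, 'k) mpoly"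
  assumes "c * g = q * r" "c \<noteq> 0" "c \<in> polys_in W" "g \<noteq> 0"
    "q \<in> polys_in (insert v W)" "r \<in> polys_in (insert v W)"
  shows "\<exists>q' r' c. g = q' * r' \<and> r = c * r' \<and> c \<noteq> 0 \<and> c \<in> polys_in W"
proof -
  obtain d ps where d: "d \<noteq> 0" "c = Const d * prod_list ps"
    "\<forall>p\<in>set ps. irreducible p \<and> p \<in> polys_in W"
    using irreducible_factorization_in assms by blast
  have "prod_list ps * g = (Const (inverse d) * Const d) * (prod_list ps * g)"
    by (simp add: Const_inverse[OF d(1)])
  also have "\<dots> = Const (inverse d) * (c * g)"
    unfolding d(2) by (simp only: mult_ac)
  also have "\<dots> = (Const (inverse d) * q) * r" using assms by (simp add: mult.assoc)
  finally show ?thesis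
    using split_constants_list[of ps g "Const (inverse d) * q" r] d assms
    by (auto intro: polys_in_mult polys_in_Const)
qed

text \<open>An element of least degree in \<open>v\<close> of the ideal generated by \<open>f\<close> and \<open>g\<close> divides both up to
  factors without \<open>v\<close>.\<close>

lemma bezout_without_var:
  assumes deg: "deg_var v f \<noteq> 0" and g: "g \<in> polys_in (insert v W)" "\<not> f dvd g"
  obtains a b r where "a \<in> polys_in (insert v W)" "b \<in> polys_in (insert v W)" "r \<noteq> 0"
    "r \<in> polys_in W" "r = a * f + b * g"
proof -
  let ?V = "polys_in (insert v W) :: ('v, 'k) mpoly set"
  define I where "I = {a * f + b * g |a b. a \<in> ?V \<and> b \<in> ?V}"
  have IV: "s \<in> ?V" if "s \<in> I" for s
    using that f g by (auto simp: I_def intro: polys_in_add polys_in_mult)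
  have fI: "f \<in> I"
    unfolding I_def by (intro CollectI exI[of _ 1] exI[of _ 0]) (simp add: polys_in_0 polys_in_1)
  have gI: "g \<in> I"
    unfolding I_def by (intro CollectI exI[of _ 0] exI[of _ 1]) (simp add: polys_in_0 polys_in_1)
  have I_comb: "x * s - y * t \<in> I" if st: "s \<in> I" "t \<in> I" and "x \<in> ?V" "y \<in> ?V" for x y s t
  proof -
    obtain a b a' b' where *: "s = a * f + b * g" "t = a' * f + b' * g"
      "a \<in> ?V" "b \<in> ?V" "a' \<in> ?V" "b' \<in> ?V" using st unfolding I_def by blast
    then have "x * s - y * t = (x * a - y * a') * f + (x * b - y * b') * g"
      by (simp add: algebra_simps)
    then show ?thesis using * that(3,4) unfolding I_def
      by (intro CollectI exI[of _ "x * a - y * a'"] exI[of _ "x * b - y * b'"])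
        (auto intro!: polys_in_diff polys_in_mult)
  qed
  have "f \<noteq> 0" using f by (auto simp: irreducible_def)
  then obtain r where r: "r \<in> I" "r \<noteq> 0" and min: "\<And>s. s \<in> I \<Longrightarrow> s \<noteq> 0 \<Longrightarrow> deg_var v r \<le> deg_var v s"
    using exists_least_iff[of "\<lambda>n. \<exists>s. s \<in> I \<and> s \<noteq> 0 \<and> deg_var v s = n"] fI
    by (metis linorder_not_less)
  have coeff_in: "coeff (to_poly v s) i \<in> polys_in W" if "s \<in> I" for s i
    using IV[OF that] coeff_to_poly_in[of v s i] by (auto simp: polys_in_def)
  have WV: "x \<in> ?V" if "x \<in> polys_in W" for x
    using that by (auto simp: polys_in_def)
  \<comment> \<open>Pseudo-division by \<open>r\<close> leaves no remainder: a nonzero element of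
    \<open>I\<close> has at least the degree of \<open>r\<close> in \<open>v\<close>, so it can
    always be reduced further, until 0 is reached.\<close>
  have div: "\<exists>c q. c \<noteq> 0 \<and> c \<in> polys_in W \<and> q \<in> ?V \<and> c * s = q * r" if "s \<in> I" for s
    using that
  \<comment> \<open>The number of coefficients, unlike the degree, still decreases in the passage
    from a polynomial constant in \<open>v\<close> to 0.\<close>
  proof (induction "length (coeffs (to_poly v s))" arbitrary: s rule: less_induct)
    case less
    show ?case
    proof (cases "s = 0")
      case True
      then show ?thesis by (intro exI[of _ 1] exI[of _ 0]) (simp add: polys_in_0 polys_in_1)
    next
      case False
      define k where "k = deg_var v s - deg_var v r"
      define lr where "lr = lead_coeff (to_poly v r)"
      define ls where "ls = lead_coeff (to_poly v s)"
      have le: "deg_var v r \<le> deg_var v s" using min less.prems False by blast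
      have lW: "lr \<in> polys_in W" "ls \<in> polys_in W"
        unfolding lr_def ls_def using coeff_in r less.prems by blast+
      have lr0: "lr \<noteq> 0" using r by (simp add: lr_def to_poly_eq_0_iff)
      \<comment> \<open>The leading terms in \<open>v\<close> cancel. Multiplying \<open>s\<close>
        by \<open>lr\<close> takes the place of dividing by it.\<close>
      define s' where "s' = lr * s - (ls * Var v ^ k) * r"
      have s'I: "s' \<in> I"
        unfolding s'_def using lW
        by (intro I_comb r less.prems WV polys_in_mult polys_in_power polys_in_Var) auto
      have novars: "v \<notin> vars lr" "v \<notin> vars ls" using lW v by (auto simp: polys_in_def)
      have s': "to_poly v s' = smult lr (to_poly v s) - smult ls (monom 1 k * to_poly v r)"
        unfolding s'_def
        by (simp add: to_poly_simps to_poly_const[OF novars(1)] to_poly_const[OF novars(2)]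
            to_poly_Var monom_altdef)
      have "coeff (to_poly v s') i = 0" if "i \<ge> deg_var v s" for i
      proof (cases "i = deg_var v s")
        case True
        then show ?thesis unfolding s' using le
          by (simp add: coeff_monom_mult k_def lr_def ls_def)
      next
        case False
        then have "i > deg_var v s" "i - k > deg_var v r" using that le unfolding k_def by auto
        then show ?thesis unfolding s' by (simp add: coeff_monom_mult coeff_eq_0)
      qed
      then have "to_poly v s' = 0 \<or> deg_var v s' < deg_var v s"
        by (metis leading_coeff_0_iff linorder_not_less)
      then have "length (coeffs (to_poly v s')) < length (coeffs (to_poly v s))"
        using False by (cases "to_poly v s' = 0") (auto simp: length_coeffs_degree to_poly_eq_0_iff to_poly_simps(1))
      from less.hyps[OF this s'I] obtain c q where cq: "c \<noteq> 0" "c \<in> polys_in W" "q \<in> ?V" "c * s' = q * r"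
        by blast
      have "(c * lr) * s = (q + c * (ls * Var v ^ k)) * r"
        using cq(4) unfolding s'_def by (simp add: algebra_simps)
      moreover have "c * lr \<noteq> 0" "c * lr \<in> polys_in W" "q + c * (ls * Var v ^ k) \<in> ?V"
        using cq lr0 lW WV by (auto intro!: polys_in_mult polys_in_add polys_in_power polys_in_Var)
      ultimately show ?thesis by blast
    qed
  qed
  \<comment> \<open>Division of \<open>f\<close> itself: up to factors without \<open>v\<close>,
    \<open>f\<close> is a product in which \<open>r\<close> occurs. By irreducibility either
    \<open>r\<close> is a multiple of \<open>f\<close>, and then \<open>f\<close> divides
    \<open>g\<close>, or \<open>r\<close> is free of \<open>v\<close>.\<close>
  obtain c q where cq: "c \<noteq> 0" "c \<in> polys_in W" "q \<in> ?V" "c * f = q * r"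
    using div[OF fI] by blast
  obtain q' r' c' where *: "f = q' * r'" "r = c' * r'" "c' \<noteq> 0" "c' \<in> polys_in W"
    using split_constants[OF cq(4,1,2) \<open>f \<noteq> 0\<close> cq(3) IV[OF r(1)]] by blast
  have "\<not> q' dvd 1"
  proof
    assume "q' dvd 1"
    then obtain w where w: "1 = q' * w" by blast
    have "f * w = (q' * w) * r'" unfolding *(1) by (simp only: mult_ac)
    then have "r' = f * w" by (simp flip: w)
    then have "f dvd r" unfolding *(2) by simp
    then obtain z where z: "r = f * z" by blast
    obtain d t where dt: "d \<noteq> 0" "d \<in> polys_in W" "t \<in> ?V" "d * g = t * r"
      using div[OF gI] by blast
    have "z \<in> ?V" using IV[OF r(1)] r(2) polys_in_factor(2)[of f z] unfolding z by blast
    then have "t * z \<in> ?V" using dt(3) by (intro polys_in_mult)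
    moreover have "d * g = f * (t * z)" unfolding dt(4) z by (simp only: mult_ac)
    ultimately have "f dvd g" using cancel_constants[OF deg _ dt(1,2)] by blast
    then show False using g by blast
  qed
  then have "r' dvd 1" using irreducibleD[OF f(1) *(1)] by blast
  then have "r' \<in> polys_in W" by (auto simp: mpoly_unit_iff polys_in_Const)
  then have "r \<in> polys_in W" unfolding *(2) using *(4) by (intro polys_in_mult)
  moreover obtain a b where "r = a * f + b * g" "a \<in> ?V" "b \<in> ?V"
    using r(1) unfolding I_def by blast
  ultimately show ?thesis using r(2) by (intro that[of a b r])
qed

text \<open>If \<open>v\<close> does not occur in \<open>f\<close>, Gauss's lemma suffices.
  Otherwise, when \<open>f\<close> does not divide \<open>g\<close>, some nonzero
  \<open>r = a * f + b * g\<close> is free of \<open>v\<close>; then \<open>f\<close> divides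
  \<open>r * h\<close>, and \<open>r\<close> can be cancelled.\<close>

lemma irreducible_prime_step: "prime_on (polys_in (insert v W)) f"
proof (cases "deg_var v f = 0")
  case True
  then have "v \<notin> vars f" by (simp add: deg_var_eq_0_iff)
  then have fW: "f \<in> polys_in W" using f(2) unfolding polys_in_def by blast
  then have "prime_on (polys_in W) f" using W f(1) unfolding irreducibles_prime_on_def by blast
  then show ?thesis using fW v by (rule prime_on_insert)
next
  case False
  show ?thesis
    unfolding prime_on_def
  proof (intro ballI impI)
    fix g h
    assume g: "g \<in> polys_in (insert v W)" and h: "h \<in> polys_in (insert v W)" and dvd: "f dvd g * h"
    show "f dvd g \<or> f dvd h"
    proof (cases "f dvd g \<or> h = 0")
      case nd: False
      then obtain a b r where *: "a \<in> polys_in (insert v W)" "b \<in> polys_in (insert v W)" "r \<noteq> 0"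
        "r \<in> polys_in W" "r = a * f + b * g"
        using bezout_without_var[OF False g] nd by metis
      obtain u where u: "g * h = f * u" using dvd by blast
      have eq: "r * h = f * (a * h + b * u)"
      proof -
        have "r * h = a * f * h + b * (g * h)" using * by (simp add: algebra_simps)
        then show ?thesis unfolding u by (simp add: algebra_simps)
      qed
      have "r \<in> polys_in (insert v W)" using *(4) by (auto simp: polys_in_def)
      then have "r * h \<in> polys_in (insert v W)" using h by (rule polys_in_mult)
      moreover have "r * h \<noteq> 0" using * nd by simp
      ultimately have "a * h + b * u \<in> polys_in (insert v W)"
        using eq polys_in_factor(2) by metis
      then show ?thesis using cancel_constants[OF False eq] * by blast
    qed auto
  qed
qed

end

text \<open>Induction on the variables; without variables every nonzero polynomial is a unit and
  there are no irreducibles.\<close>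

lemma irreducibles_prime_on_finite:
  fixes V :: "'v::linorder set"
  assumes "finite V"
  shows "irreducibles_prime_on (polys_in V :: ('v, 'k::field) mpoly set)"
  using assms
proof (induction V rule: finite_induct)
  case empty
  have "P dvd 1" if "P \<in> polys_in {}" "P \<noteq> 0" for P :: "('v, 'k) mpoly"
  proof -
    have "mdeg m = 0" if "m \<in> Poly_Mapping.keys P" for m
      using \<open>P \<in> polys_in {}\<close> that by (auto simp: polys_in_def vars_def mdeg_def)
    then have "tdeg P = 0" using tdeg_attained[OF \<open>P \<noteq> 0\<close>] by auto
    then show ?thesis using tdeg_eq_0_iff \<open>P \<noteq> 0\<close> by blast
  qed
  then show ?case by (auto simp: irreducibles_prime_on_def irreducible_def)
next
  case (insert v W)
  then show ?case unfolding irreducibles_prime_on_def[of "polys_in (insert v W)"]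
    using irreducible_prime_step[OF insert.IH insert.hyps(2)] by (intro ballI impI)
qed

lemma irreducible_imp_prime_elem_mpoly:
  fixes f :: "('v::{finite,linorder}, 'k::field) mpoly"
  assumes "irreducible f"
  shows "prime_elem f"
proof -
  have "prime_on (polys_in UNIV) f"
    using irreducibles_prime_on_finite[of "UNIV :: 'v set", where ?'k = 'k] assms
    by (simp add: irreducibles_prime_on_def polys_in_def)
  then show ?thesis using assms
    by (simp add: prime_on_def polys_in_def prime_elem_def irreducible_def)
qed

section \<open>Hypersurfaces\<close>

lemma is_hom_eval: "is_hom (eval a)"
  by (rule is_hom_mp_eval[OF is_hom_id])

lemmas eval_simps =
  hom_zero[OF is_hom_eval] hom_one[OF is_hom_eval] hom_add[OF is_hom_eval]
  hom_mult[OF is_hom_eval] hom_uminus[OF is_hom_eval] hom_diff[OF is_hom_eval]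
  mp_eval_Const[OF is_hom_id] mp_eval_Var[OF is_hom_id]

lemma poly_map_poly_hom:
  assumes "is_hom h"
  shows "poly (map_poly h p) (h x) = h (poly p x)"
  by (induction p) (simp_all add: hom_zero[OF assms] map_poly_pCons hom_add[OF assms] hom_mult[OF assms])

text \<open>Restriction to a line parallel to the axis \<open>v\<close>, where roots of univariate
  polynomials can be counted or found.\<close>

lemma eval_update:
  "eval (a(v := t)) P = poly (map_poly (eval a) (to_poly v P)) t"
proof -
  have coeff: "eval (a(v := t)) (coeff (to_poly v P) i) = eval a (coeff (to_poly v P) i)" for i
    by (rule mp_eval_cong) (use coeff_to_poly_in[of v P i] in \<open>auto simp: polys_in_def\<close>)
  have "eval (a(v := t)) P = eval (a(v := t)) (poly (to_poly v P) (Var v))"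
    by simp
  also have "\<dots> = poly (map_poly (eval (a(v := t))) (to_poly v P)) t"
    using poly_map_poly_hom[OF is_hom_eval, of "a(v := t)" "to_poly v P" "Var v"]
    by (simp add: eval_simps)
  also have "map_poly (eval (a(v := t))) (to_poly v P) = map_poly (eval a) (to_poly v P)"
    by (intro poly_eqI) (simp add: coeff_map_poly coeff)
  finally show ?thesis .
qed

text \<open>Values of the other variables that keep the leading coefficient in \<open>v\<close>
  nonzero leave a nonzero univariate polynomial, which has finitely many roots in an infinite
  field.\<close>

lemma exists_eval_nonzero_in:
  fixes P :: "('v::linorder, 'k::{field_char_0}) mpoly"
  assumes "finite V" "P \<in> polys_in V" "P \<noteq> 0"
  shows "\<exists>a. eval a P \<noteq> 0"
  using assms
proof (induction V arbitrary: P rule: finite_induct)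
  case empty
  have "mdeg m = 0" if "m \<in> Poly_Mapping.keys P" for m
    using empty that by (auto simp: polys_in_def vars_def mdeg_def)
  then have "tdeg P = 0" using tdeg_attained[OF \<open>P \<noteq> 0\<close>] by auto
  then obtain c where "P = Const c" using tdeg_0_imp_Const by blast
  then show ?case using empty by (auto simp: eval_simps)
next
  case (insert v W)
  define l where "l = lead_coeff (to_poly v P)"
  have "l \<noteq> 0" using insert.prems by (simp add: l_def to_poly_eq_0_iff)
  moreover have "l \<in> polys_in W"
    using coeff_to_poly_in[of v P] insert.prems(1) unfolding l_def by (auto simp: polys_in_def)
  ultimately obtain a where "eval a l \<noteq> 0" using insert.IH by blast
  then have "coeff (map_poly (eval a) (to_poly v P)) (deg_var v P) \<noteq> 0"
    by (simp add: coeff_map_poly l_def)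
  then have "map_poly (eval a) (to_poly v P) \<noteq> 0" by (metis coeff_0)
  then have "finite {t. poly (map_poly (eval a) (to_poly v P)) t = 0}"
    by (rule poly_roots_finite)
  then obtain t where "poly (map_poly (eval a) (to_poly v P)) t \<noteq> 0"
    using infinite_UNIV_char_0[where 'a = 'k] by (metis (mono_tags, lifting) finite_subset mem_Collect_eq subsetI)
  then show ?case unfolding eval_update[symmetric] by blast
qed

lemma exists_eval_nonzero:
  fixes P :: "('v::{finite,linorder}, 'k::field_char_0) mpoly"
  assumes "P \<noteq> 0"
  obtains a where "eval a P \<noteq> 0"
  using exists_eval_nonzero_in[of UNIV P] assms by (auto simp: polys_in_def)

text \<open>If \<open>f\<close> did not divide \<open>g\<close>, some nonzero
  \<open>r = a * f + b * g\<close> would be free of a variable \<open>v\<close> of \<open>f\<close>.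
  Moving only the coordinate \<open>v\<close> to a root of \<open>f\<close> makes \<open>f\<close>
  and \<open>g\<close> vanish, but keeps a nonzero value of \<open>r\<close>.\<close>

lemma hypersurface_nullstellensatz:
  fixes f g :: "('v::{finite,linorder}, 'k::{alg_closed_field,field_char_0}) mpoly"
  assumes f: "irreducible f" and vanish: "\<And>a. eval a f = 0 \<Longrightarrow> eval a g = 0"
  shows "f dvd g"
proof (rule ccontr)
  assume nd: "\<not> f dvd g"
  have f0: "f \<noteq> 0" "\<not> f dvd 1" using f by (auto simp: irreducible_def)
  obtain v where v: "v \<in> vars f"
  proof -
    have "tdeg f \<noteq> 0" using tdeg_eq_0_iff f0 by blast
    then obtain m where "m \<in> Poly_Mapping.keys f" "mdeg m \<noteq> 0" using tdeg_attained f0 by metis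
    then obtain u where "u \<in> Poly_Mapping.keys m" unfolding mdeg_def by (metis sum.empty all_not_in_conv)
    then show ?thesis using that \<open>m \<in> _\<close> by (auto simp: vars_def)
  qed
  let ?W = "UNIV - {v}"
  have V: "insert v ?W = UNIV" by blast
  have in_UNIV: "P \<in> polys_in (insert v ?W)" for P :: "('v, 'k) mpoly"
    unfolding V by (simp add: polys_in_def)
  have W: "irreducibles_prime_on (polys_in ?W :: ('v, 'k) mpoly set)"
    by (rule irreducibles_prime_on_finite) simp
  have deg: "deg_var v f \<noteq> 0" using v by (simp add: deg_var_eq_0_iff)
  obtain a b r where r: "r \<noteq> 0" "r \<in> polys_in ?W" "r = a * f + b * g"
    using bezout_without_var[OF W _ f in_UNIV deg in_UNIV nd] by blast
  \<comment> \<open>The leading coefficient must stay nonzero at the point, so that the univariate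
    polynomial in \<open>v\<close> keeps positive degree and has a root.\<close>
  define l where "l = lead_coeff (to_poly v f)"
  have l: "l \<noteq> 0" using f0 by (simp add: l_def to_poly_eq_0_iff)
  then obtain x where x: "eval x (l * r) \<noteq> 0"
    using exists_eval_nonzero[of "l * r"] r by auto
  let ?p = "map_poly (eval x) (to_poly v f)"
  have "coeff ?p (deg_var v f) \<noteq> 0" using x by (simp add: coeff_map_poly l_def eval_simps)
  then have "degree ?p > 0" using deg le_degree by fastforce
  then obtain t where "poly ?p t = 0" using alg_closed_imp_poly_has_root by blast
  then have "eval (x(v := t)) f = 0" unfolding eval_update .
  then have "eval (x(v := t)) r = 0"
    using vanish r(3) by (simp add: eval_simps)
  moreover have "eval (x(v := t)) r = eval x r"
    by (rule mp_eval_cong) (use r(2) in \<open>auto simp: polys_in_def\<close>)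
  ultimately show False using x by (simp add: eval_simps)
qed

lemma irreducible_dvd_mult_iff:
  fixes f :: "('v::{finite,linorder}, 'k::field) mpoly"
  assumes "irreducible f"
  shows "f dvd g * h \<longleftrightarrow> f dvd g \<or> f dvd h"
  using irreducible_imp_prime_elem_mpoly[OF assms] by (auto simp: prime_elem_dvd_mult_iff)

abbreviation hypersurface :: "('n, 'k::comm_ring_1) mpoly \<Rightarrow> ('n \<Rightarrow> 'k) set" where
  "hypersurface f \<equiv> zeros {f}"

lemma hypersurface_subset_iff:
  fixes f g :: "('v::{finite,linorder}, 'k::{alg_closed_field,field_char_0}) mpoly"
  assumes "irreducible f"
  shows "hypersurface f \<subseteq> zeros P \<longleftrightarrow> (\<forall>g\<in>P. f dvd g)"
proof
  assume "hypersurface f \<subseteq> zeros P"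
  then show "\<forall>g\<in>P. f dvd g"
    by (intro ballI hypersurface_nullstellensatz[OF assms]) (auto simp: zeros_def)
next
  assume "\<forall>g\<in>P. f dvd g"
  then show "hypersurface f \<subseteq> zeros P"
    by (fastforce simp: zeros_def eval_simps)
qed

lemma irreducible_closed_hypersurface:
  fixes f :: "('v::{finite,linorder}, 'k::{alg_closed_field,field_char_0}) mpoly"
  assumes f: "irreducible f"
  shows "irreducible_closed zariski (hypersurface f)"
  unfolding irreducible_closed_def
proof (intro conjI allI impI)
  show "closedin zariski (hypersurface f)" unfolding closedin_zariski by blast
  show "hypersurface f \<noteq> {}"
    using hypersurface_subset_iff[OF f, of "{1}"] f by (auto simp: irreducible_def zeros_def eval_simps)
next
  fix A B :: "('v \<Rightarrow> 'k) set"
  assume "closedin zariski A" "closedin zariski B" and sub: "hypersurface f \<subseteq> A \<union> B"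
  then obtain P Q where PQ: "A = zeros P" "B = zeros Q" unfolding closedin_zariski by blast
  show "hypersurface f \<subseteq> A \<or> hypersurface f \<subseteq> B"
  proof (rule ccontr)
    assume "\<not> ?thesis"
    then have "\<not> hypersurface f \<subseteq> zeros P" "\<not> hypersurface f \<subseteq> zeros Q"
      unfolding PQ by blast+
    then obtain p q where pq: "p \<in> P" "\<not> f dvd p" "q \<in> Q" "\<not> f dvd q"
      unfolding hypersurface_subset_iff[OF f] by blast
    have "hypersurface f \<subseteq> zeros {p * q}"
      using sub pq unfolding PQ by (auto simp: zeros_def eval_simps)
    then have "f dvd p * q" unfolding hypersurface_subset_iff[OF f] by blast
    then show False using pq irreducible_dvd_mult_iff[OF f] by blast
  qed
qed

lemma zeros_empty: "zeros {} = UNIV"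
  by (simp add: zeros_def)

lemma irreducible_closed_UNIV:
  "irreducible_closed zariski (UNIV :: ('v::{finite,linorder} \<Rightarrow> 'k::field_char_0) set)"
  unfolding irreducible_closed_def
proof (intro conjI allI impI)
  show "closedin zariski (UNIV :: ('v \<Rightarrow> 'k) set)" unfolding closedin_zariski using zeros_empty by blast
next
  fix A B :: "('v \<Rightarrow> 'k) set"
  assume "closedin zariski A" "closedin zariski B" and sub: "UNIV \<subseteq> A \<union> B"
  then obtain P Q where PQ: "A = zeros P" "B = zeros Q" unfolding closedin_zariski by blast
  show "UNIV \<subseteq> A \<or> UNIV \<subseteq> B"
  proof (rule ccontr)
    assume "\<not> ?thesis"
    then obtain p q where pq: "p \<in> P" "p \<noteq> 0" "q \<in> Q" "q \<noteq> 0"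
      unfolding PQ zeros_def by fastforce
    then obtain a where "eval a (p * q) \<noteq> 0" using exists_eval_nonzero[of "p * q"] by auto
    then show False using sub pq unfolding PQ by (auto simp: zeros_def eval_simps)
  qed
qed simp

lemma irreducible_closed_subset_hypersurface:
  fixes g :: "('v::{finite,linorder}, 'k::field_char_0) mpoly"
  assumes Y: "irreducible_closed zariski Y" and g: "g \<noteq> 0" "Y \<subseteq> hypersurface g"
  shows "\<exists>f. irreducible f \<and> f dvd g \<and> Y \<subseteq> hypersurface f"
proof -
  obtain c fs where *: "c \<noteq> 0" "g = Const c * prod_list fs" "\<forall>f\<in>set fs. irreducible f"
    using irreducible_factorization g by blast
  have "Y \<subseteq> hypersurface (prod_list fs) \<Longrightarrow> \<exists>f\<in>set fs. Y \<subseteq> hypersurface f"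
  proof (induction fs)
    case Nil
    then show ?case using Y by (auto simp: irreducible_closed_def zeros_def eval_simps)
  next
    case (Cons f fs)
    have "Y \<subseteq> hypersurface f \<union> hypersurface (prod_list fs)"
      using Cons.prems by (auto simp: zeros_def eval_simps)
    moreover have "closedin zariski (hypersurface f)" "closedin zariski (hypersurface (prod_list fs))"
      unfolding closedin_zariski by blast+
    ultimately have "Y \<subseteq> hypersurface f \<or> Y \<subseteq> hypersurface (prod_list fs)"
      using Y unfolding irreducible_closed_def by blast
    then show ?case using Cons.IH by auto
  qed
  moreover have "Y \<subseteq> hypersurface (prod_list fs)"
    using g(2) * by (auto simp: zeros_def eval_simps)
  ultimately obtain f where "f \<in> set fs" "Y \<subseteq> hypersurface f" by blast
  moreover have "f dvd g" using \<open>f \<in> set fs\<close> *(2) by (simp add: prod_list_dvd)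
  ultimately show ?thesis using *(3) by blast
qed

text \<open>A hypersurface of an irreducible \<open>f\<close> has only the whole space strictly
  above it: a proper irreducible closed set above it lies in the hypersurface of some irreducible
  \<open>h\<close>, and then \<open>f\<close> divides \<open>h\<close>, hence is associated to it.
  Conversely, if \<open>P\<close> has no common factor, any irreducible subset of its zero set lies
  strictly inside such a hypersurface.\<close>

lemma codimension_ge_2_iff:
  fixes P :: "('v::{finite,linorder}, 'k::{alg_closed_field,field_char_0}) mpoly set"
  assumes nz: "\<exists>g\<in>P. g \<noteq> 0"
  shows "codimension zariski (zeros P) \<ge> 2 \<longleftrightarrow> \<not> (\<exists>f. irreducible f \<and> (\<forall>g\<in>P. f dvd g))"
proof -
  define chain where "chain Y k \<longleftrightarrow> (\<exists>C. C 0 = Y \<and> (\<forall>i\<le>k. irreducible_closed zariski (C i)) \<and>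
    (\<forall>i<k. C i \<subset> C (Suc i)))" for Y :: "('v \<Rightarrow> 'k) set" and k :: nat
  have codim: "codimension zariski (zeros P) =
      (INF Y\<in>{Y. irreducible_closed zariski Y \<and> Y \<subseteq> zeros P}. SUP k\<in>{k. chain Y k}. enat k)"
    unfolding codimension_def chain_def ..
  show ?thesis
  proof (intro iffI notI)
    assume "codimension zariski (zeros P) \<ge> 2" and "\<exists>f. irreducible f \<and> (\<forall>g\<in>P. f dvd g)"
    then obtain f where f: "irreducible f" "\<forall>g\<in>P. f dvd g" by blast
    have "hypersurface f \<subseteq> zeros P" using f hypersurface_subset_iff by blast
    then have "2 \<le> (SUP k\<in>{k. chain (hypersurface f) k}. enat k)"
      using \<open>codimension zariski (zeros P) \<ge> 2\<close> irreducible_closed_hypersurface[OF f(1)]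
      unfolding codim le_INF_iff by blast
    then have "\<not> (SUP k\<in>{k. chain (hypersurface f) k}. enat k) \<le> enat 1"
      unfolding numeral_eq_enat using order_trans[of "enat 2" _ "enat 1"] by auto
    then obtain k where k: "chain (hypersurface f) k" "\<not> k \<le> 1"
      by (auto simp: SUP_le_iff)
    then obtain C where C: "C 0 = hypersurface f" "\<forall>i\<le>k. irreducible_closed zariski (C i)"
      "\<forall>i<k. C i \<subset> C (Suc i)" unfolding chain_def by blast
    have lt: "hypersurface f \<subset> C 1" "C 1 \<subset> C 2" and irr: "irreducible_closed zariski (C 1)"
      using C k(2) by (force simp: numeral_2_eq_2)+
    obtain R where R: "C 1 = zeros R" using irr unfolding irreducible_closed_def closedin_zariski by blast
    obtain g where g: "g \<in> R" "g \<noteq> 0"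
    proof -
      obtain a p where "p \<in> R" "eval a p \<noteq> 0" using lt(2) unfolding R zeros_def by blast
      then show ?thesis using that[of p] by (metis eval_zero)
    qed
    have "C 1 \<subseteq> hypersurface g" using g R by (auto simp: zeros_def)
    then obtain h where h: "irreducible h" "C 1 \<subseteq> hypersurface h"
      using irreducible_closed_subset_hypersurface[OF irr g(2)] by blast
    have "f dvd h" using lt(1) h(2) hypersurface_subset_iff[OF f(1), of "{h}"] by blast
    then have "h dvd f" by (rule irreducible_dvd_irreducible[OF f(1) h(1)])
    then have "hypersurface h \<subseteq> hypersurface f" using hypersurface_subset_iff[OF h(1)] by blast
    then show False using lt(1) h(2) by blast
  next
    assume coprime: "\<not> (\<exists>f. irreducible f \<and> (\<forall>g\<in>P. f dvd g))"
    show "codimension zariski (zeros P) \<ge> 2"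
      unfolding codim
    proof (rule INF_greatest)
      fix Y
      assume "Y \<in> {Y. irreducible_closed zariski Y \<and> Y \<subseteq> zeros P}"
      then have Y: "irreducible_closed zariski Y" "Y \<subseteq> zeros P" by auto
      obtain g where g: "g \<in> P" "g \<noteq> 0" using nz by blast
      have "Y \<subseteq> hypersurface g" using Y(2) g by (auto simp: zeros_def)
      then obtain f where f: "irreducible f" "Y \<subseteq> hypersurface f"
        using irreducible_closed_subset_hypersurface[OF Y(1) g(2)] by blast
      have "Y \<noteq> hypersurface f"
        using Y(2) coprime f(1) hypersurface_subset_iff[OF f(1)] by blast
      have "f \<noteq> 0" using f(1) by auto
      then have "hypersurface f \<noteq> UNIV" using exists_eval_nonzero[of f] by (auto simp: zeros_def)
      \<comment> \<open>The chain \<open>Y\<close>, hypersurface of \<open>f\<close>, whole space;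
        entries beyond index 2 do not matter.\<close>
      have "chain Y 2"
        unfolding chain_def
        by (rule exI[of _ "\<lambda>i. if i = 0 then Y else if i = 1 then hypersurface f else UNIV"])
          (use Y f \<open>Y \<noteq> hypersurface f\<close> \<open>hypersurface f \<noteq> UNIV\<close> irreducible_closed_hypersurface
            irreducible_closed_UNIV in \<open>auto simp: less_Suc_eq numeral_2_eq_2\<close>)
      then have "enat 2 \<le> (SUP k\<in>{k. chain Y k}. enat k)" by (intro SUP_upper) simp
      then show "2 \<le> (SUP k\<in>{k. chain Y k}. enat k)" by (simp add: numeral_eq_enat)
    qed
  qed
qed

section \<open>Derivations and polynomial vector fields\<close>

definition is_derivation :: "('a::comm_ring_1 \<Rightarrow> 'a) \<Rightarrow> bool" where
  "is_derivation D \<longleftrightarrow> (\<forall>a b. D (a + b) = D a + D b) \<and> (\<forall>a b. D (a * b) = D a * b + a * D b)"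

lemma
  assumes "is_derivation D"
  shows derivation_add: "D (a + b) = D a + D b" and derivation_mult: "D (a * b) = D a * b + a * D b"
  using assms unfolding is_derivation_def by auto

lemma derivation_0:
  assumes "is_derivation D"
  shows "D 0 = 0"
  using derivation_add[OF assms, of 0 0] by simp

lemma derivation_uminus:
  assumes "is_derivation D"
  shows "D (- a) = - D a"
  using derivation_add[OF assms, of a "- a"] by (simp add: derivation_0[OF assms] eq_neg_iff_add_eq_0 add.commute)

lemma derivation_sum:
  assumes "is_derivation D"
  shows "D (\<Sum>i\<in>A. f i) = (\<Sum>i\<in>A. D (f i))"
  by (induction A rule: infinite_finite_induct) (simp_all add: derivation_0[OF assms] derivation_add[OF assms])

lemma derivation_power:
  assumes "is_derivation D"
  shows "D (a ^ Suc n) = of_nat (Suc n) * a ^ n * D a"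
  by (induction n) (simp_all add: derivation_mult[OF assms] algebra_simps)

lemma lookup_pderiv_var:
  "Poly_Mapping.lookup (pderiv_var i P) m =
     of_nat (Poly_Mapping.lookup m i + 1) * Poly_Mapping.lookup P (m + Poly_Mapping.single i 1)"
proof -
  let ?e = "Poly_Mapping.single i (1::nat)"
  have "n = m + ?e" if "n - ?e = m" "Poly_Mapping.lookup n i \<noteq> 0" for n
  proof (rule poly_mapping_eqI)
    fix j
    show "Poly_Mapping.lookup n j = Poly_Mapping.lookup (m + ?e) j"
      using that by (auto simp: lookup_add lookup_minus lookup_single when_def)
  qed
  then have "Poly_Mapping.lookup (Poly_Mapping.single (n - ?e)
      (of_nat (Poly_Mapping.lookup n i) * Poly_Mapping.lookup P n)) m =
      (if n = m + ?e then of_nat (Poly_Mapping.lookup m i + 1) * Poly_Mapping.lookup P (m + ?e) else 0)" for n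
    by (cases "Poly_Mapping.lookup n i = 0") (auto simp: lookup_single when_def lookup_add)
  then show ?thesis
    unfolding pderiv_var_def lookup_sum by (simp add: in_keys_iff)
qed

lemma pderiv_var_add: "pderiv_var i (P + Q) = pderiv_var i P + pderiv_var i Q"
  by (rule poly_mapping_eqI) (simp add: lookup_pderiv_var lookup_add algebra_simps)

lemma pderiv_var_0: "pderiv_var i 0 = 0"
  by (simp add: pderiv_var_def)

lemma pderiv_var_sum: "pderiv_var i (\<Sum>x\<in>A. f x) = (\<Sum>x\<in>A. pderiv_var i (f x))"
  by (induction A rule: infinite_finite_induct) (simp_all add: pderiv_var_0 pderiv_var_add)

lemma pderiv_var_single:
  "pderiv_var i (Poly_Mapping.single m c) =
     Poly_Mapping.single (m - Poly_Mapping.single i 1) (of_nat (Poly_Mapping.lookup m i) * c)"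
  by (cases "c = 0") (simp_all add: pderiv_var_def)

lemma pderiv_var_mult_single:
  "pderiv_var i (Poly_Mapping.single m c * Poly_Mapping.single n d) =
     pderiv_var i (Poly_Mapping.single m c) * Poly_Mapping.single n d +
     Poly_Mapping.single m c * pderiv_var i (Poly_Mapping.single n d)"
proof -
  let ?e = "Poly_Mapping.single i (1::nat)"
  have *: "m + n - ?e = m - ?e + n" if "Poly_Mapping.lookup m i \<noteq> 0" for m n :: "'a \<Rightarrow>\<^sub>0 nat"
    using that by (intro poly_mapping_eqI) (auto simp: lookup_add lookup_minus lookup_single when_def)
  have "Poly_Mapping.single (m + n - ?e) (of_nat (Poly_Mapping.lookup m i) * (c * d)) =
      Poly_Mapping.single (m - ?e + n) (of_nat (Poly_Mapping.lookup m i) * (c * d))"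
    using * by (cases "Poly_Mapping.lookup m i = 0") auto
  moreover have "Poly_Mapping.single (m + n - ?e) (of_nat (Poly_Mapping.lookup n i) * (c * d)) =
      Poly_Mapping.single (m + (n - ?e)) (of_nat (Poly_Mapping.lookup n i) * (c * d))"
    using *[of n m] by (cases "Poly_Mapping.lookup n i = 0") (auto simp: add.commute)
  ultimately show ?thesis
    by (simp add: pderiv_var_single mult_single lookup_add distrib_right distrib_left single_add mult_ac add_ac)
qed

lemma is_derivation_pderiv_var: "is_derivation (pderiv_var i)"
  unfolding is_derivation_def
proof (intro conjI allI)
  fix P Q :: "('a, 'b) mpoly"
  let ?s = "\<lambda>P m. Poly_Mapping.single m (Poly_Mapping.lookup P m) :: ('a, 'b) mpoly"
  have PQ: "P = sum (?s P) (Poly_Mapping.keys P)" "Q = sum (?s Q) (Poly_Mapping.keys Q)"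
    by (rule mpoly_sum_monomials)+
  have "pderiv_var i (sum (?s P) A * sum (?s Q) B) =
      pderiv_var i (sum (?s P) A) * sum (?s Q) B + sum (?s P) A * pderiv_var i (sum (?s Q) B)" for A B
    by (simp add: sum_product pderiv_var_sum pderiv_var_mult_single sum.distrib)
  from this[of "Poly_Mapping.keys P" "Poly_Mapping.keys Q"]
  show "pderiv_var i (P * Q) = pderiv_var i P * Q + P * pderiv_var i Q"
    unfolding PQ[symmetric] .
qed (rule pderiv_var_add)

lemma pderiv_var_Const: "pderiv_var i (Const c) = 0"
  by (simp add: Const_def pderiv_var_single)

lemma pderiv_var_Var: "pderiv_var i (Var j) = (if i = j then 1 else 0)"
  by (auto simp: Var_def pderiv_var_single lookup_single when_def)

lemma keys_pderiv_var:
  assumes "m \<in> Poly_Mapping.keys (pderiv_var i P)"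
  shows "m + Poly_Mapping.single i 1 \<in> Poly_Mapping.keys P"
  using assms by (auto simp: in_keys_iff lookup_pderiv_var)

lemma dvd_pderiv_var_imp_0:
  fixes f :: "('v::linorder, 'k::idom) mpoly"
  assumes "f dvd pderiv_var i f"
  shows "pderiv_var i f = 0"
proof (rule ccontr)
  assume nz: "pderiv_var i f \<noteq> 0"
  then have "f \<noteq> 0" by (auto simp: pderiv_var_0)
  obtain m where m: "m \<in> Poly_Mapping.keys (pderiv_var i f)" "mdeg m = tdeg (pderiv_var i f)"
    using tdeg_attained[OF nz] by blast
  have "mdeg m + 1 \<le> tdeg f"
    using mdeg_le_tdeg[OF keys_pderiv_var[OF m(1)]] by (simp add: mdeg_add)
  moreover obtain g where "pderiv_var i f = f * g" using assms by blast
  then have "tdeg (pderiv_var i f) \<ge> tdeg f" using nz tdeg_mult[of f g] by auto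
  ultimately show False using m by simp
qed

lemma pderiv_var_all_0_imp_Const:
  fixes f :: "('v::linorder, 'k::field_char_0) mpoly"
  assumes "\<And>i. pderiv_var i f = 0"
  shows "tdeg f = 0"
proof (cases "f = 0")
  case False
  then obtain m where m: "m \<in> Poly_Mapping.keys f" "mdeg m = tdeg f" using tdeg_attained by blast
  have "Poly_Mapping.lookup m i = 0" for i
  proof (rule ccontr)
    let ?e = "Poly_Mapping.single i (1::nat)"
    assume *: "Poly_Mapping.lookup m i \<noteq> 0"
    have "m - ?e + ?e = m"
      using * by (intro poly_mapping_eqI) (auto simp: lookup_add lookup_minus lookup_single when_def)
    then have "Poly_Mapping.lookup (pderiv_var i f) (m - ?e) \<noteq> 0"
      using m(1) unfolding lookup_pderiv_var by (simp add: in_keys_iff del: of_nat_add of_nat_Suc)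
    then show False using assms by simp
  qed
  then have "m = 0" by (intro poly_mapping_eqI) simp
  then show ?thesis using m by simp
qed (simp add: grading_simps)

text \<open>In characteristic zero some partial derivative of a nonconstant polynomial is nonzero,
  and its total degree is too small for \<open>f\<close> to divide it.\<close>

lemma irreducible_exists_pderiv_var:
  fixes f :: "('v::linorder, 'k::field_char_0) mpoly"
  assumes "irreducible f"
  obtains i where "\<not> f dvd pderiv_var i f"
proof -
  have "f \<noteq> 0" "tdeg f \<noteq> 0" using assms tdeg_eq_0_iff by (auto simp: irreducible_def)
  then show ?thesis using that dvd_pderiv_var_imp_0 pderiv_var_all_0_imp_Const by metis
qed

text \<open>One notion covers both kinds of fields in use: \<open>c = Var\<close> gives the Euler
  field, and \<open>c = act_field \<xi>\<close> the action of a Lie algebra element.\<close>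

definition vfield :: "('n::finite \<Rightarrow> ('n, 'k::comm_ring_1) mpoly) \<Rightarrow> ('n, 'k) mpoly \<Rightarrow> ('n, 'k) mpoly" where
  "vfield c F = (\<Sum>i\<in>UNIV. c i * pderiv_var i F)"

lemma is_derivation_vfield: "is_derivation (vfield c)"
  unfolding is_derivation_def vfield_def
  by (simp add: pderiv_var_add derivation_mult[OF is_derivation_pderiv_var] algebra_simps
      sum.distrib sum_distrib_left sum_distrib_right)

lemma vfield_Const: "vfield c (Const k) = 0"
  by (simp add: vfield_def pderiv_var_Const)

lemma vfield_Var: "vfield c (Var i) = c i"
  by (simp add: vfield_def pderiv_var_Var if_distrib cong: if_cong)

lemma vfield_Const_mult: "vfield c (Const k * P) = Const k * vfield c P"
  by (simp add: derivation_mult[OF is_derivation_vfield] vfield_Const)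

lemma mdeg_keys_vfield:
  assumes c: "\<And>i. hom_of_degree 1 (c i)" and m: "m \<in> Poly_Mapping.keys (vfield c F)"
  shows "\<exists>n\<in>Poly_Mapping.keys F. mdeg m = mdeg n"
proof -
  have "\<exists>i. m \<in> Poly_Mapping.keys (c i * pderiv_var i F)"
    using m unfolding vfield_def in_keys_iff lookup_sum by (meson sum.neutral)
  then obtain i a b where ab: "m = a + b" "a \<in> Poly_Mapping.keys (c i)" "b \<in> Poly_Mapping.keys (pderiv_var i F)"
    using keys_mult by blast
  have "mdeg a = 1" using c ab by (auto simp: hom_of_degree_def)
  then have "mdeg m = mdeg (b + Poly_Mapping.single i 1)" by (simp add: ab mdeg_add)
  then show ?thesis using keys_pderiv_var[OF ab(3)] by blast
qed

lemma hom_of_degree_vfield: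
  assumes "\<And>i. hom_of_degree 1 (c i)" "hom_of_degree d F"
  shows "hom_of_degree d (vfield c F)"
  unfolding hom_of_degree_def
proof
  fix m
  assume "m \<in> Poly_Mapping.keys (vfield c F)"
  then obtain n where "n \<in> Poly_Mapping.keys F" "mdeg m = mdeg n"
    using mdeg_keys_vfield[of c, OF assms(1)] by blast
  then show "mdeg m = d" using assms(2) by (simp add: hom_of_degree_def)
qed

lemma hcomp_vfield:
  assumes "\<And>i. hom_of_degree 1 (c i)"
  shows "hcomp d (vfield c F) = vfield c (hcomp d F)"
proof -
  have *: "hcomp d (vfield c (hcomp e F)) = (if e = d then vfield c (hcomp d F) else 0)" for e
    using hom_of_degree_vfield[OF assms hom_of_degree_hcomp[of e F]]
    by (auto simp: hom_of_degree_iff)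
  have "hcomp d (vfield c F) = hcomp d (vfield c (\<Sum>e\<le>tdeg F. hcomp e F))"
    using sum_hcomp[of F] by simp
  also have "\<dots> = (\<Sum>e\<le>tdeg F. if e = d then vfield c (hcomp d F) else 0)"
    by (simp add: derivation_sum[OF is_derivation_vfield] hom_sum[OF is_hom_grading] coeff_sum *)
  also have "\<dots> = vfield c (hcomp d F)"
    by (auto simp: coeff_eq_0 derivation_0[OF is_derivation_vfield])
  finally show ?thesis .
qed

text \<open>A field with linear coefficients does not raise the total degree, so the quotient can
  only be a constant.\<close>

lemma dvd_vfield_imp_eigenvector:
  fixes F :: "('n::{finite,linorder}, 'k::field) mpoly"
  assumes "\<And>i. hom_of_degree 1 (c i)" "F dvd vfield c F"
  shows "\<exists>k. vfield c F = Const k * F"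
proof (cases "vfield c F = 0")
  case True
  then show ?thesis by (intro exI[of _ 0]) (simp add: Const_hom_simps)
next
  case False
  obtain G where G: "vfield c F = F * G" using assms(2) by blast
  obtain m where m: "m \<in> Poly_Mapping.keys (vfield c F)" "mdeg m = tdeg (vfield c F)"
    using tdeg_attained[OF False] by blast
  obtain n where "n \<in> Poly_Mapping.keys F" "mdeg m = mdeg n"
    using mdeg_keys_vfield[OF assms(1) m(1)] by blast
  then have "tdeg (vfield c F) \<le> tdeg F"
    using mdeg_le_tdeg[of n F] m(2) by simp
  moreover have "tdeg (vfield c F) = tdeg F + tdeg G"
    using False unfolding G by (intro tdeg_mult) auto
  ultimately have "tdeg G = 0" by simp
  then obtain k where "G = Const k" by (rule tdeg_0_imp_Const)
  then show ?thesis using G by (intro exI[of _ k]) (simp add: mult.commute)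
qed

lemma euler_single:
  "Var i * pderiv_var i (Poly_Mapping.single m c) =
     Poly_Mapping.single m (of_nat (Poly_Mapping.lookup m i) * c)"
proof (cases "Poly_Mapping.lookup m i = 0")
  case False
  let ?e = "Poly_Mapping.single i (1::nat)"
  have "?e + (m - ?e) = m"
    using False by (intro poly_mapping_eqI) (auto simp: lookup_add lookup_minus lookup_single when_def)
  then show ?thesis by (simp add: pderiv_var_single Var_def mult_single)
qed (simp add: pderiv_var_single)

lemma euler:
  fixes F :: "('n::finite, 'k::comm_ring_1) mpoly"
  assumes "hom_of_degree d F"
  shows "vfield Var F = Const (of_nat d) * F"
proof -
  have "vfield Var F = (\<Sum>m\<in>Poly_Mapping.keys F. vfield Var (Poly_Mapping.single m (Poly_Mapping.lookup F m)))"
    by (subst mpoly_sum_monomials) (rule derivation_sum[OF is_derivation_vfield])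
  also have "\<dots> = (\<Sum>m\<in>Poly_Mapping.keys F. Const (of_nat d) * Poly_Mapping.single m (Poly_Mapping.lookup F m))"
  proof (rule sum.cong[OF refl])
    fix m
    assume "m \<in> Poly_Mapping.keys F"
    then have "mdeg m = d" using assms by (simp add: hom_of_degree_def)
    then have "(\<Sum>i\<in>UNIV. Poly_Mapping.lookup m i) = d" using mdeg_superset[of UNIV m] by simp
    moreover have "(\<Sum>i\<in>A. Poly_Mapping.single m (f i)) = Poly_Mapping.single m (\<Sum>i\<in>A. f i)"
      for A :: "'n set" and f :: "'n \<Rightarrow> 'k"
      by (induction A rule: infinite_finite_induct) (simp_all add: single_add)
    ultimately have "vfield Var (Poly_Mapping.single m (Poly_Mapping.lookup F m)) =
        Poly_Mapping.single m (of_nat d * Poly_Mapping.lookup F m)"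
      by (simp add: vfield_def euler_single flip: sum_distrib_right of_nat_sum)
    then show "vfield Var (Poly_Mapping.single m (Poly_Mapping.lookup F m)) =
        Const (of_nat d) * Poly_Mapping.single m (Poly_Mapping.lookup F m)"
      by (simp only: Const_def mult_single add_0_left)
  qed
  also have "\<dots> = Const (of_nat d) * F"
    using mpoly_sum_monomials[of F] by (simp flip: sum_distrib_left)
  finally show ?thesis .
qed

section \<open>Multiplicities and common divisors\<close>

lemma irreducible_power_split:
  fixes f :: "('v::linorder, 'k::field) mpoly"
  assumes "irreducible f" "F \<noteq> 0"
  obtains k w where "F = f ^ k * w" "\<not> f dvd w"
proof -
  have f: "f \<noteq> 0" "tdeg f > 0" using assms tdeg_eq_0_iff by (auto simp: irreducible_def)
  have "\<exists>k w. F = f ^ k * w \<and> \<not> f dvd w"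
    using assms(2)
  proof (induction "tdeg F" arbitrary: F rule: less_induct)
    case less
    show ?case
    proof (cases "f dvd F")
      case False
      then show ?thesis by (intro exI[of _ 0] exI[of _ F]) simp
    next
      case True
      then obtain G where G: "F = f * G" by blast
      then have "G \<noteq> 0" "tdeg G < tdeg F" using less.prems f tdeg_mult[of f G] by auto
      then obtain k w where kw: "G = f ^ k * w" "\<not> f dvd w" using less.hyps by blast
      then show ?thesis by (intro exI[of _ "Suc k"] exI[of _ w]) (simp add: G mult.assoc)
    qed
  qed
  then show ?thesis using that by blast
qed

lemma irreducible_power_dvd_le:
  fixes f :: "'a::idom"
  assumes "f ^ j dvd f ^ k * w" "\<not> f dvd w" "f \<noteq> 0"
  shows "j \<le> k"
proof (rule ccontr)
  assume "\<not> j \<le> k"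
  then have "f ^ j = f ^ k * (f * f ^ (j - Suc k))" by (simp flip: power_Suc power_add)
  then have "f * f ^ (j - Suc k) dvd w" using assms by simp
  then show False using assms(2) dvd_mult_left by blast
qed

text \<open>The product rule modulo \<open>f ^ k\<close> leaves \<open>k * f ^ (k - 1) * w\<close>
  times the derivative of \<open>f\<close>; here \<open>k\<close> is a unit and \<open>f\<close> is
  prime. Only divisibility by \<open>f ^ k\<close> is assumed, so the lemma serves both for
  eigenvectors and for coefficients of a stable ideal.\<close>

lemma vfield_irreducible_factor:
  fixes f w :: "('n::{finite,linorder}, 'k::field_char_0) mpoly"
  assumes f: "irreducible f" and w: "\<not> f dvd w" and k: "k > 0" and dvd: "f ^ k dvd vfield c (f ^ k * w)"
  shows "f dvd vfield c f"
proof -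
  obtain j where j: "k = Suc j" using k gr0_conv_Suc by blast
  have f0: "f \<noteq> 0" using f by auto
  have "vfield c (f ^ k * w) = f ^ j * (of_nat k * vfield c f * w) + f ^ k * vfield c w"
    unfolding j derivation_mult[OF is_derivation_vfield] derivation_power[OF is_derivation_vfield]
    by (simp only: mult_ac)
  then have "f ^ k dvd f ^ j * (of_nat k * vfield c f * w)"
    using dvd by (simp add: dvd_add_left_iff)
  then have "f dvd of_nat k * vfield c f * w" using f0 by (simp add: j mult.commute[of f])
  then have "f dvd of_nat k \<or> f dvd vfield c f" using irreducible_dvd_mult_iff[OF f] w by metis
  moreover have "\<not> f dvd of_nat k"
  proof
    assume "f dvd of_nat k"
    moreover have "(of_nat k :: ('n, 'k) mpoly) = Const (of_nat k)"
      by (induction k) (simp_all add: Const_hom_simps)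
    moreover have "Const (of_nat k) dvd (1 :: ('n, 'k) mpoly)"
      unfolding mpoly_unit_iff using k by auto
    ultimately have "f dvd 1" using dvd_trans by metis
    then show False using f by (simp add: irreducible_def)
  qed
  ultimately show ?thesis by blast
qed

text \<open>A common divisor of largest total degree works, since a common irreducible factor of the
  quotients would enlarge it. The nonzero member \<open>u i0\<close> bounds these degrees.\<close>

lemma exists_greatest_common_divisor:
  fixes u :: "'i \<Rightarrow> ('v::linorder, 'k::field) mpoly"
  assumes "u i0 \<noteq> 0"
  obtains p R where "\<And>i. u i = p * R i" "\<not> (\<exists>f. irreducible f \<and> (\<forall>i. f dvd R i))"
proof -
  have "\<exists>p. (\<forall>i. p dvd u i) \<and> (\<forall>q. (\<forall>i. q dvd u i) \<longrightarrow> tdeg q \<le> tdeg p)"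
  proof (rule ex_has_greatest_nat)
    show "\<forall>i. 1 dvd u i" by simp
    show "\<forall>q. (\<forall>i. q dvd u i) \<longrightarrow> tdeg q < Suc (tdeg (u i0))"
    proof (intro allI impI)
      fix q
      assume "\<forall>i. q dvd u i"
      then obtain r where "u i0 = q * r" by blast
      then show "tdeg q < Suc (tdeg (u i0))" using assms tdeg_mult[of q r] by auto
    qed
  qed
  then obtain p where p: "\<forall>i. p dvd u i" "\<And>q. (\<forall>i. q dvd u i) \<Longrightarrow> tdeg q \<le> tdeg p" by blast
  then have "\<forall>i. \<exists>r. u i = p * r" by (auto simp: dvd_def)
  then obtain R where R: "\<And>i. u i = p * R i" using choice[of "\<lambda>i r. u i = p * r"] by blast
  have "p \<noteq> 0" using R assms by auto
  have "\<not> (\<exists>f. irreducible f \<and> (\<forall>i. f dvd R i))"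
  proof
    assume "\<exists>f. irreducible f \<and> (\<forall>i. f dvd R i)"
    then obtain f where f: "irreducible f" "\<forall>i. f dvd R i" by blast
    then have "f \<noteq> 0" "tdeg f > 0" using tdeg_eq_0_iff by (auto simp: irreducible_def)
    moreover have "\<forall>i. p * f dvd u i" using R f by simp
    ultimately show False using p(2)[of "p * f"] tdeg_mult[of p f] \<open>p \<noteq> 0\<close> by simp
  qed
  then show ?thesis using that R by blast
qed

section \<open>Cramer's rule over a commutative ring\<close>

text \<open>Expanding the replaced row by multilinearity, every summand but the one with
  \<open>l = k\<close> has two equal rows.\<close>

lemma cramer_comm_ring:
  fixes A :: "'a::comm_ring_1^'n^'n"
  shows "det (\<chi> i. if i = k then (\<Sum>l\<in>UNIV. x l *s A $ l) else A $ i) = x k * det A"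
proof -
  have "det (\<chi> i. if i = k then (\<Sum>l\<in>UNIV. x l *s A $ l) else A $ i) =
      (\<Sum>l\<in>UNIV. det (\<chi> i. if i = k then x l *s A $ l else A $ i))"
    by (rule det_linear_row_sum) simp
  also have "\<dots> = (\<Sum>l\<in>UNIV. if l = k then x k * det A else 0)"
  proof (rule sum.cong[OF refl])
    fix l
    have "det (\<chi> i. if i = k then x l *s A $ l else A $ i) =
        x l * det (\<chi> i. if i = k then A $ l else A $ i)"
      using det_row_mul[of k "x l" "\<lambda>_. A $ l" "\<lambda>i. A $ i"] by simp
    moreover have "det (\<chi> i. if i = k then A $ l else A $ i) = (if l = k then det A else 0)"
    proof (cases "l = k")
      case True
      then have "(\<chi> i. if i = k then A $ l else A $ i) = A" by (simp add: vec_eq_iff)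
      then show ?thesis using True by simp
    next
      case False
      then show ?thesis
        by (simp add: det_identical_rows[of k l] row_def)
    qed
    ultimately show "det (\<chi> i. if i = k then x l *s A $ l else A $ i) =
        (if l = k then x k * det A else 0)" by simp
  qed
  finally show ?thesis by simp
qed

text \<open>The replaced row in Cramer's rule is a multiple of \<open>f\<close>, which can be pulled
  out. For \<open>f = 0\<close> this says that a relation among the rows has coefficients
  annihilated by the determinant.\<close>

lemma dvd_mult_det:
  fixes A :: "'a::comm_ring_1^'n^'n"
  assumes "\<And>i. f dvd (\<Sum>l\<in>UNIV. x l * A $ l $ i)"
  shows "f dvd x k * det A"
proof -
  obtain v where v: "\<And>i. (\<Sum>l\<in>UNIV. x l * A $ l $ i) = f * v i" using assms unfolding dvd_def by metis
  have eq: "(\<Sum>l\<in>UNIV. x l *s A $ l) = f *s (\<chi> i. v i)"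
    using v by (simp add: vec_eq_iff)
  have "x k * det A = det (\<chi> i. if i = k then f *s (\<chi> i. v i) else A $ i)"
    using cramer_comm_ring[of k x A, symmetric] unfolding eq .
  also have "\<dots> = f * det (\<chi> i. if i = k then (\<chi> i. v i) else A $ i)"
    using det_row_mul[of k f "\<lambda>_. \<chi> i. v i" "\<lambda>i. A $ i"] by simp
  finally show ?thesis by simp
qed

lemma hom_det:
  fixes A :: "'a::comm_ring_1^'n^'n"
  assumes "is_hom h"
  shows "h (det A) = det (\<chi> i j. h (A $ i $ j))"
proof -
  have "h (of_int (sign p)) = of_int (sign p)" for p :: "'n \<Rightarrow> 'n"
    by (cases p rule: sign_cases) (simp_all add: hom_one[OF assms] hom_uminus[OF assms])
  then show ?thesis
    unfolding det_def by (simp add: hom_sum[OF assms] hom_mult[OF assms] hom_prod[OF assms])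
qed

section \<open>Creation and annihilation operators on the exterior algebra\<close>

definition below :: "'n::linorder \<Rightarrow> 'n set \<Rightarrow> nat" where
  "below i K = card {j \<in> K. j < i}"

text \<open>Left multiplication by the generator with index \<open>i\<close>, as
  \<open>wedge_gen\<close> confirms.\<close>

definition creation :: "'n::{finite,linorder} \<Rightarrow> ('n, 'r::comm_ring_1) ext \<Rightarrow> ('n, 'r) ext" where
  "creation i u = (\<lambda>K. if i \<in> K then (- 1) ^ below i K * u (K - {i}) else 0)"

text \<open>Contraction with the \<open>i\<close>-th vector of the dual basis, with the sign for
  which the relation \<open>annihilation_creation\<close> holds.\<close>

definition annihilation :: "'n::{finite,linorder} \<Rightarrow> ('n, 'r::comm_ring_1) ext \<Rightarrow> ('n, 'r) ext" where
  "annihilation i u = (\<lambda>K. if i \<in> K then 0 else (- 1) ^ below i K * u (insert i K))"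

lemma below_remove:
  fixes i j :: "'n::{finite,linorder}"
  shows "below i (K - {j}) = (if j \<in> K \<and> j < i then below i K - 1 else below i K)"
proof -
  have "{l \<in> K - {j}. l < i} = {l \<in> K. l < i} - {j}" by blast
  then show ?thesis by (auto simp: below_def card_Diff_singleton_if)
qed

lemma below_insert:
  fixes i j :: "'n::{finite,linorder}"
  shows "below i (insert j K) = (if j \<notin> K \<and> j < i then Suc (below i K) else below i K)"
proof (cases "j \<in> K")
  case False
  have "{l \<in> insert j K. l < i} = (if j < i then insert j {l \<in> K. l < i} else {l \<in> K. l < i})" by auto
  then show ?thesis using False by (simp add: below_def)
qed (simp add: insert_absorb)

lemma below_pos:
  fixes i j :: "'n::{finite,linorder}"
  assumes "j \<in> K" "j < i"
  shows "\<exists>m. below i K = Suc m"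
proof -
  have "{l \<in> K. l < i} \<noteq> {}" using assms by blast
  then show ?thesis unfolding below_def by (metis card_gt_0_iff finite gr0_conv_Suc)
qed

lemma creation_creation_same: "creation i (creation i u) = (\<lambda>K. 0)"
  by (rule ext) (simp add: creation_def)

lemma creation_anticommute_less:
  assumes "i < j"
  shows "creation i (creation j u) K = - creation j (creation i u) K"
proof (cases "i \<in> K \<and> j \<in> K")
  case True
  then obtain m where m: "below j K = Suc m" using below_pos assms by blast
  have "K - {i} - {j} = K - {j} - {i}" by blast
  moreover have "below j (K - {i}) = m" "below i (K - {j}) = below i K"
    using True assms m by (simp_all add: below_remove)
  ultimately show ?thesis using True assms m by (simp add: creation_def mult.left_commute)
qed (auto simp: creation_def)

lemma creation_anticommute: "creation i (creation j u) K = - creation j (creation i u) K"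
  using creation_anticommute_less[of i j u K] creation_anticommute_less[of j i u K]
  by (cases i j rule: linorder_cases) (simp_all add: creation_creation_same)

text \<open>The canonical anticommutation relation. For distinct indices, adding or removing the
  smaller one shifts the position of the larger one by one, which produces the sign.\<close>

lemma annihilation_creation:
  "annihilation i (creation j u) K = (if i = j then u K else 0) - creation j (annihilation i u) K"
proof (cases "i = j")
  case True
  then show ?thesis
    by (auto simp: creation_def annihilation_def below_insert below_remove insert_absorb
        simp flip: mult.assoc power_add mult_2 power_mult)
next
  case False
  show ?thesis
  proof (cases "i \<notin> K \<and> j \<in> K")
    case True
    have ins: "insert i K - {j} = insert i (K - {j})" using False by blast
    have "i < j \<or> j < i" using False by auto
    then show ?thesis
    proof
      assume "i < j"
      then have "below j (insert i K) = Suc (below j K)" "below i (K - {j}) = below i K"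
        using True by (simp_all add: below_insert below_remove)
      then show ?thesis using True False ins by (simp add: creation_def annihilation_def mult.left_commute)
    next
      assume "j < i"
      then obtain m where m: "below i K = Suc m" using below_pos True by blast
      have "below j (insert i K) = below j K" "below i (K - {j}) = m"
        using True \<open>j < i\<close> m by (simp_all add: below_insert below_remove)
      then show ?thesis using True False ins m by (simp add: creation_def annihilation_def mult.left_commute)
    qed
  qed (use False in \<open>auto simp: creation_def annihilation_def\<close>)
qed

section \<open>Bivectors and linear maps as operators\<close>

lemma creation_sum: "creation i (\<lambda>K. \<Sum>x\<in>A. f x K) K = (\<Sum>x\<in>A. creation i (f x) K)"
  by (simp add: creation_def sum_distrib_left)

lemma creation_mult: "creation i (\<lambda>K. c * u K) K = c * creation i u K"
  by (simp add: creation_def mult_ac)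

lemma creation_diff: "creation i (\<lambda>K. u K - w K) K = creation i u K - creation i w K"
  by (simp add: creation_def algebra_simps)

lemma creation_uminus: "creation i (\<lambda>K. - u K) K = - creation i u K"
  by (simp add: creation_def)

lemma annihilation_sum: "annihilation i (\<lambda>K. \<Sum>x\<in>A. f x K) K = (\<Sum>x\<in>A. annihilation i (f x) K)"
  by (simp add: annihilation_def sum_distrib_left)

lemma annihilation_mult: "annihilation i (\<lambda>K. c * u K) K = c * annihilation i u K"
  by (simp add: annihilation_def mult_ac)

text \<open>For skew-symmetric \<open>b\<close> this is multiplication by twice the bivector of
  \<open>b\<close>.\<close>

definition bivector_op :: "('n::{finite,linorder} \<Rightarrow> 'n \<Rightarrow> 'r::comm_ring_1) \<Rightarrow> ('n, 'r) ext \<Rightarrow> ('n, 'r) ext" where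
  "bivector_op b u = (\<lambda>K. \<Sum>i\<in>UNIV. \<Sum>j\<in>UNIV. b i j * creation i (creation j u) K)"

text \<open>The derivation of the exterior algebra, linear over the coefficients, that sends the
  generator \<open>k\<close> to the combination of the generators \<open>i\<close> with coefficients
  \<open>a i k\<close>.\<close>

definition linear_op :: "('n::{finite,linorder} \<Rightarrow> 'n \<Rightarrow> 'r::comm_ring_1) \<Rightarrow> ('n, 'r) ext \<Rightarrow> ('n, 'r) ext" where
  "linear_op a u = (\<lambda>K. \<Sum>i\<in>UNIV. \<Sum>k\<in>UNIV. a i k * creation i (annihilation k u) K)"

lemma sum_fun_apply: "(\<Sum>x\<in>A. f x) K = (\<Sum>x\<in>A. f x K)"
  by (induction A rule: infinite_finite_induct) auto

lemma creation_0: "creation i (\<lambda>K. 0) = (\<lambda>K. 0)"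
  by (rule ext) (simp add: creation_def)

lemma annihilation_unit: "annihilation i (\<lambda>K. if K = {} then c else 0) = (\<lambda>K. 0)"
  by (rule ext) (simp add: annihilation_def)

lemma wedge_sum_left: "wedge (\<Sum>x\<in>A. f x) u K = (\<Sum>x\<in>A. wedge (f x) u K)"
  unfolding wedge_def sum_fun_apply sum_distrib_left sum_distrib_right by (rule sum.swap)

lemma wedge_scale_left: "wedge (ext_scale c w) u K = c * wedge w u K"
  by (simp add: wedge_def ext_scale_def sum_distrib_left mult_ac)

lemma wedge_indicator:
  "wedge (\<lambda>I. if I = A then 1 else 0) u K =
     (if A \<subseteq> K then (- 1) ^ card {(i, j). i \<in> A \<and> j \<in> K - A \<and> j < i} * u (K - A) else 0)"
proof -
  have "wedge (\<lambda>I. if I = A then 1 else 0) u K = (\<Sum>I\<in>Pow K. if I = A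
      then (- 1) ^ card {(i, j). i \<in> A \<and> j \<in> K - A \<and> j < i} * u (K - A) else 0)"
    unfolding wedge_def by (rule sum.cong) auto
  then show ?thesis by simp
qed

lemma wedge_gen: "wedge (ext_gen i) u = creation i u"
proof
  fix K
  have "card {(i', j). i' \<in> {i} \<and> j \<in> K - {i} \<and> j < i'} = card (Pair i ` {j \<in> K. j < i})"
    by (rule arg_cong[where f = card]) auto
  also have "\<dots> = below i K" unfolding below_def by (rule card_image) (simp add: inj_on_def)
  finally show "wedge (ext_gen i) u K = creation i u K"
    unfolding ext_gen_def wedge_indicator creation_def by simp
qed

lemma wedge_gen_gen:
  assumes "i < j"
  shows "wedge (ext_gen i) (ext_gen j) = (\<lambda>I. if I = {i, j} then 1 else 0)"
proof
  fix I
  show "wedge (ext_gen i) (ext_gen j) I = (if I = {i, j} then 1 else 0)"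
  proof (cases "I = {i, j}")
    case True
    have "{i, j} - {i} = {j}" "below i {i, j} = 0" using assms by (auto simp: below_def)
    then show ?thesis unfolding wedge_gen unfolding creation_def ext_gen_def True by simp
  next
    case False
    then have "\<not> (i \<in> I \<and> I - {i} = {j})" by blast
    then show ?thesis unfolding wedge_gen unfolding creation_def ext_gen_def using False by auto
  qed
qed

lemma wedge_gen_gen_left:
  assumes "i < j"
  shows "wedge (wedge (ext_gen i) (ext_gen j)) u K = creation i (creation j u) K"
proof (cases "i \<in> K \<and> j \<in> K")
  case True
  let ?L = "K - {i, j}"
  have "{(i', j'). i' \<in> {i, j} \<and> j' \<in> ?L \<and> j' < i'} =
      Pair i ` {l \<in> ?L. l < i} \<union> Pair j ` {l \<in> ?L. l < j}" by auto
  moreover have "card (Pair i ` {l \<in> ?L. l < i} \<union> Pair j ` {l \<in> ?L. l < j}) =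
      card (Pair i ` {l \<in> ?L. l < i}) + card (Pair j ` {l \<in> ?L. l < j})"
    using assms by (intro card_Un_disjoint) auto
  ultimately have "card {(i', j'). i' \<in> {i, j} \<and> j' \<in> ?L \<and> j' < i'} = below i ?L + below j ?L"
    by (simp add: below_def card_image inj_on_def)
  moreover have "{l \<in> ?L. l < i} = {l \<in> K. l < i}" "{l \<in> ?L. l < j} = {l \<in> K - {i}. l < j}"
    using assms by auto
  then have "below i ?L = below i K" "below j ?L = below j (K - {i})"
    by (simp_all add: below_def)
  moreover have "K - {i} - {j} = ?L" by blast
  ultimately show ?thesis
    using True assms by (simp add: wedge_gen_gen[OF assms] wedge_indicator creation_def power_add mult_ac)
next
  case False
  then show ?thesis by (auto simp: wedge_gen_gen[OF assms] wedge_indicator creation_def)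
qed

text \<open>Doubling trades the sum over \<open>i < j\<close> for a sum over all pairs, whose shape is preserved by
  commutators.\<close>

lemma two_wedge_bivector:
  fixes b :: "'n::{finite,linorder} \<Rightarrow> 'n \<Rightarrow> 'r::comm_ring_1"
  assumes "\<And>i j. b i j = - b j i"
  shows "2 * wedge (ext_bivector b) u K = bivector_op b u K"
proof -
  let ?t = "\<lambda>(i, j). b i j * creation i (creation j u) K"
  let ?lt = "{(i, j). i < j} :: ('n \<times> 'n) set"
  let ?gt = "{(i, j). j < i} :: ('n \<times> 'n) set"
  let ?eq = "{(i, j). i = j} :: ('n \<times> 'n) set"
  have lt: "wedge (ext_bivector b) u K = sum ?t ?lt"
    unfolding ext_bivector_def wedge_sum_left
    by (rule sum.cong) (auto simp: wedge_scale_left wedge_gen_gen_left)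
  have full: "bivector_op b u K = sum ?t UNIV"
    by (simp add: bivector_op_def sum.cartesian_product)
  have "(UNIV :: ('n \<times> 'n) set) = ?lt \<union> (?gt \<union> ?eq)" by auto
  then have "sum ?t UNIV = sum ?t (?lt \<union> (?gt \<union> ?eq))" by simp
  also have "\<dots> = sum ?t ?lt + (sum ?t ?gt + sum ?t ?eq)"
    by (subst sum.union_disjoint; auto)+
  also have "sum ?t ?eq = 0"
    by (rule sum.neutral) (auto simp: creation_creation_same)
  also have "sum ?t ?gt = sum ?t ?lt"
  proof (rule sum.reindex_bij_witness[of _ "\<lambda>(i, j). (j, i)" "\<lambda>(i, j). (j, i)"])
    fix ij
    assume "ij \<in> ?gt"
    then obtain i j where ij: "ij = (i, j)" by force
    show "?t (case ij of (i, j) \<Rightarrow> (j, i)) = ?t ij"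
      using assms[of i j] creation_anticommute[of i j u K] by (simp add: ij)
  qed auto
  finally show ?thesis using lt full by simp
qed

lemma derivation_creation:
  assumes "is_derivation D"
  shows "D (creation i u K) = creation i (\<lambda>K. D (u K)) K"
proof -
  have "D ((- 1) ^ n * x) = (- 1) ^ n * D x" for n x
    by (induction n) (simp_all add: derivation_uminus[OF assms])
  then show ?thesis by (simp add: creation_def derivation_0[OF assms])
qed

text \<open>This is the derivation property of \<open>linear_op\<close>: its commutator with
  multiplication by a bivector is multiplication by the image of that bivector. Moving an
  annihilation past two creations leaves two contraction terms, one for each index of
  \<open>b\<close>.\<close>

lemma commute_linear_op_bivector_op:
  fixes u :: "('a::{finite,linorder}, 'b::comm_ring_1) ext"
  shows "linear_op a (bivector_op b u) K = bivector_op b (linear_op a u) K +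
     bivector_op (\<lambda>i q. \<Sum>k\<in>UNIV. a i k * b k q + a q k * b i k) u K"
proof -
  have comm: "creation i (annihilation k (creation p (creation q u))) K =
      creation p (creation q (creation i (annihilation k u))) K +
      (if k = p then creation i (creation q u) K else 0) +
      (if k = q then creation p (creation i u) K else 0)" for i k p q
  proof -
    have 1: "annihilation k (creation p (creation q u)) =
        (\<lambda>K. (if k = p then creation q u K else 0) - creation p (annihilation k (creation q u)) K)"
      by (rule ext) (rule annihilation_creation)
    have 2: "annihilation k (creation q u) =
        (\<lambda>K. (if k = q then u K else 0) - creation q (annihilation k u) K)"
      by (rule ext) (rule annihilation_creation)
    have 3: "creation p (annihilation k (creation q u)) =
        (\<lambda>K. (if k = q then creation p u K else 0) - creation p (creation q (annihilation k u)) K)"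
      unfolding 2 creation_diff[abs_def] by (auto simp: creation_def)
    have "creation i (annihilation k (creation p (creation q u))) K =
        (if k = p then creation i (creation q u) K else 0) -
        ((if k = q then creation i (creation p u) K else 0) -
          creation i (creation p (creation q (annihilation k u))) K)"
      unfolding 1 3 creation_diff by (auto simp: creation_def)
    moreover have "creation i (creation p u) K = - creation p (creation i u) K"
      by (rule creation_anticommute)
    \<comment> \<open>Passing two creations costs two signs, which cancel.\<close>
    moreover have "creation i (creation p (creation q w)) K = creation p (creation q (creation i w)) K"
      for w :: "('a, 'b) ext"
    proof -
      have "creation i (creation q w) = (\<lambda>K. - creation q (creation i w) K)"
        by (rule ext) (rule creation_anticommute)
      then show ?thesis
        unfolding creation_anticommute[of i p] by (simp add: creation_uminus)
    qed
    ultimately show ?thesis by simp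
  qed
  have "linear_op a (bivector_op b u) K =
      (\<Sum>i\<in>UNIV. \<Sum>k\<in>UNIV. \<Sum>p\<in>UNIV. \<Sum>q\<in>UNIV.
         a i k * b p q * creation i (annihilation k (creation p (creation q u))) K)"
    unfolding linear_op_def bivector_op_def annihilation_sum[abs_def] annihilation_mult[abs_def]
      creation_sum creation_mult sum_distrib_left mult.assoc ..
  also have "\<dots> = (\<Sum>i\<in>UNIV. \<Sum>k\<in>UNIV. \<Sum>p\<in>UNIV. \<Sum>q\<in>UNIV.
         a i k * b p q * creation p (creation q (creation i (annihilation k u))) K) +
      (\<Sum>i\<in>UNIV. \<Sum>k\<in>UNIV. \<Sum>p\<in>UNIV. \<Sum>q\<in>UNIV.
         if k = p then a i k * b p q * creation i (creation q u) K else 0) +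
      (\<Sum>i\<in>UNIV. \<Sum>k\<in>UNIV. \<Sum>p\<in>UNIV. \<Sum>q\<in>UNIV.
         if k = q then a i k * b p q * creation p (creation i u) K else 0)"
    unfolding sum.distrib[symmetric] by (intro sum.cong refl) (simp add: comm distrib_left)
  also have "(\<Sum>i\<in>UNIV. \<Sum>k\<in>UNIV. \<Sum>p\<in>UNIV. \<Sum>q\<in>UNIV.
         a i k * b p q * creation p (creation q (creation i (annihilation k u))) K) =
      (\<Sum>p\<in>UNIV. \<Sum>q\<in>UNIV. \<Sum>i\<in>UNIV. \<Sum>k\<in>UNIV.
         a i k * b p q * creation p (creation q (creation i (annihilation k u))) K)"
    by (simp only: sum.cartesian_product) (rule sum.reindex_bij_witness[of _ "\<lambda>(i, k, p, q). (p, q, i, k)" "\<lambda>(i, k, p, q). (p, q, i, k)"]; auto)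
  also have "\<dots> = bivector_op b (linear_op a u) K"
    unfolding linear_op_def bivector_op_def creation_sum[abs_def] creation_mult[abs_def]
      sum_distrib_left by (simp only: mult_ac)
  also have "(\<Sum>i\<in>UNIV. \<Sum>k\<in>UNIV. \<Sum>p\<in>UNIV. \<Sum>q\<in>UNIV.
         if k = p then a i k * b p q * creation i (creation q u) K else 0) =
      (\<Sum>i\<in>UNIV. \<Sum>q\<in>UNIV. (\<Sum>k\<in>UNIV. a i k * b k q) * creation i (creation q u) K)"
    (is "?l = ?r")
  proof -
    have "?l = (\<Sum>i\<in>UNIV. \<Sum>k\<in>UNIV. \<Sum>q\<in>UNIV. \<Sum>p\<in>UNIV.
         if k = p then a i k * b p q * creation i (creation q u) K else 0)"
      by (rule sum.cong[OF refl], rule sum.cong[OF refl], rule sum.swap)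
    also have "\<dots> = ?r"
      unfolding sum_distrib_right by (rule sum.cong[OF refl], subst sum.swap, simp)
    finally show ?thesis .
  qed
  also have "(\<Sum>i\<in>UNIV. \<Sum>k\<in>UNIV. \<Sum>p\<in>UNIV. \<Sum>q\<in>UNIV.
         if k = q then a i k * b p q * creation p (creation i u) K else 0) =
      (\<Sum>i\<in>UNIV. \<Sum>q\<in>UNIV. (\<Sum>k\<in>UNIV. a q k * b i k) * creation i (creation q u) K)"
    (is "?l = ?r")
  proof -
    have "?l = (\<Sum>i\<in>UNIV. \<Sum>k\<in>UNIV. \<Sum>p\<in>UNIV. a i k * b p k * creation p (creation i u) K)"
      by simp
    also have "\<dots> = (\<Sum>i\<in>UNIV. \<Sum>p\<in>UNIV. \<Sum>k\<in>UNIV. a i k * b p k * creation p (creation i u) K)"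
      by (rule sum.cong[OF refl], rule sum.swap)
    also have "\<dots> = ?r"
      unfolding sum_distrib_right by (rule sum.swap)
    finally show ?thesis .
  qed
  finally show ?thesis
    by (simp add: bivector_op_def sum.distrib distrib_right add.assoc)
qed

lemma derivation_bivector_op:
  assumes D: "is_derivation D"
  shows "D (bivector_op b u K) = bivector_op (\<lambda>i j. D (b i j)) u K + bivector_op b (\<lambda>K. D (u K)) K"
  unfolding bivector_op_def
  by (simp add: derivation_sum[OF D] derivation_mult[OF D] derivation_creation[OF D] sum.distrib)

text \<open>The assumption on \<open>D (b i q)\<close> says that \<open>D\<close> and
  \<open>linear_op a\<close> agree on the bivector, that is, its Lie derivative vanishes. Both
  operators obey the product rule, so they agree on all powers. The factor 2 from
  \<open>bivector_op\<close> is cancelled at the end.\<close>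

lemma derivation_wedge_power:
  fixes b :: "'n::{finite,linorder} \<Rightarrow> 'n \<Rightarrow> 'r::{idom,ring_char_0}"
  assumes D: "is_derivation D" and anti: "\<And>i j. b i j = - b j i"
    and Db: "\<And>i q. D (b i q) = (\<Sum>k\<in>UNIV. a i k * b k q + a q k * b i k)"
  shows "D (wedge_power (ext_bivector b) n K) = linear_op a (wedge_power (ext_bivector b) n) K"
proof (induction n arbitrary: K)
  case 0
  have "D 1 = 0" using derivation_mult[OF D, of 1 1] by simp
  then show ?case
    by (simp add: linear_op_def annihilation_unit creation_0 derivation_0[OF D])
next
  case (Suc n)
  let ?w = "wedge_power (ext_bivector b) n"
  have two: "2 * wedge_power (ext_bivector b) (Suc n) K = bivector_op b ?w K" for K
    using two_wedge_bivector[of b, OF anti] by simp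
  have "D 2 = 0"
    using derivation_mult[OF D, of 1 1] derivation_add[OF D, of 1 1] by simp
  then have "2 * D (wedge_power (ext_bivector b) (Suc n) K) = D (bivector_op b ?w K)"
    unfolding two[symmetric] derivation_mult[OF D] by simp
  also have "\<dots> = bivector_op (\<lambda>i q. \<Sum>k\<in>UNIV. a i k * b k q + a q k * b i k) ?w K +
      bivector_op b (linear_op a ?w) K"
    unfolding derivation_bivector_op[OF D] Db Suc.IH ..
  also have "\<dots> = linear_op a (bivector_op b ?w) K"
    unfolding commute_linear_op_bivector_op by (rule add.commute)
  also have "bivector_op b ?w = (\<lambda>K. 2 * wedge_power (ext_bivector b) (Suc n) K)"
    using two by presburger
  also have "linear_op a \<dots> K = 2 * linear_op a (wedge_power (ext_bivector b) (Suc n)) K"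
    unfolding linear_op_def annihilation_mult[abs_def] creation_mult
    by (simp only: sum_distrib_left mult_ac)
  finally show ?case by simp
qed

lemma dvd_linear_op:
  assumes "\<And>K. p dvd u K"
  shows "p dvd linear_op a u K"
proof -
  have "p dvd annihilation k u K" for k K using assms by (simp add: annihilation_def)
  then have "p dvd creation i (annihilation k u) K" for i k K by (simp add: creation_def)
  then show ?thesis unfolding linear_op_def by (intro dvd_sum dvd_mult)
qed

lemma wedge_power_support:
  fixes b :: "'n::{finite,linorder} \<Rightarrow> 'n \<Rightarrow> 'r::{idom,ring_char_0}"
  assumes anti: "\<And>i j. b i j = - b j i" and "wedge_power (ext_bivector b) n K \<noteq> 0"
  shows "card K = 2 * n"
  using assms(2)
proof (induction n arbitrary: K)
  case (Suc n)
  have "bivector_op b (wedge_power (ext_bivector b) n) K \<noteq> 0"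
    using Suc.prems two_wedge_bivector[of b, OF anti, of "wedge_power (ext_bivector b) n" K] by auto
  then obtain i j where "creation i (creation j (wedge_power (ext_bivector b) n)) K \<noteq> 0"
    unfolding bivector_op_def by (metis (no_types, lifting) mult_zero_right sum.neutral)
  then have "i \<in> K" "j \<in> K - {i}" "wedge_power (ext_bivector b) n (K - {i} - {j}) \<noteq> 0"
    by (auto simp: creation_def split: if_splits)
  moreover from this have "card K = Suc (Suc (card (K - {i} - {j})))"
    by (metis card_Suc_Diff1 finite)
  ultimately show ?case using Suc.IH[of "K - {i} - {j}"] by simp
qed (simp split: if_splits)

text \<open>Used for evaluation at a point, to compare the polynomial tensor with the differential
  of the contact form.\<close>

lemma hom_wedge_power:
  fixes b :: "'n::{finite,linorder} \<Rightarrow> 'n \<Rightarrow> 'r::comm_ring_1"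
    and h :: "'r \<Rightarrow> 's::{idom,ring_char_0}"
  assumes h: "is_hom h" and anti: "\<And>i j. b i j = - b j i"
  shows "h (wedge_power (ext_bivector b) n K) = wedge_power (ext_bivector (\<lambda>i j. h (b i j))) n K"
proof (induction n arbitrary: K)
  case 0
  show ?case by (simp add: hom_one[OF h] hom_zero[OF h])
next
  case (Suc n)
  let ?w = "wedge_power (ext_bivector b) n"
  have anti': "h (b i j) = - h (b j i)" for i j
    using anti[of i j] by (simp add: hom_uminus[OF h])
  have hc: "h (creation i u K) = creation i (\<lambda>K. h (u K)) K" for i :: 'n and u K
    by (simp add: creation_def hom_zero[OF h] hom_mult[OF h] hom_power[OF h] hom_uminus[OF h] hom_one[OF h])
  have "h 2 = 2" using hom_add[OF h, of 1 1] by (simp add: hom_one[OF h])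
  then have "2 * h (wedge_power (ext_bivector b) (Suc n) K) = h (2 * wedge (ext_bivector b) ?w K)"
    by (simp add: hom_mult[OF h])
  also have "\<dots> = bivector_op (\<lambda>i j. h (b i j)) (\<lambda>K. h (?w K)) K"
    unfolding two_wedge_bivector[of b, OF anti] bivector_op_def
    by (simp add: hom_sum[OF h] hom_mult[OF h] hc)
  also have "\<dots> = 2 * wedge_power (ext_bivector (\<lambda>i j. h (b i j))) (Suc n) K"
    using two_wedge_bivector[of "\<lambda>i j. h (b i j)", OF anti'] Suc.IH by simp
  finally show ?case by simp
qed

lemma ext_vector_apply: "ext_vector c J = (\<Sum>i\<in>UNIV. if J = {i} then c i else 0)"
  unfolding ext_vector_def sum_fun_apply ext_scale_def ext_gen_def by (simp add: if_distrib cong: if_cong)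

text \<open>In odd dimension the generator \<open>i\<close> passes an even number of others on its
  way from the back to the front, so no sign appears.\<close>

lemma wedge_vector_top:
  fixes u :: "('n::{finite,linorder}, 'r::comm_ring_1) ext"
  assumes "odd CARD('n)"
  shows "wedge u (ext_vector c) UNIV = (\<Sum>i\<in>UNIV. c i * creation i u UNIV)"
proof -
  let ?s = "\<lambda>I. (- 1) ^ card {(i, j). i \<in> I \<and> j \<in> UNIV - I \<and> j < i} * u I"
  have "wedge u (ext_vector c) UNIV = (\<Sum>I\<in>UNIV. \<Sum>i\<in>UNIV. if UNIV - I = {i} then ?s I * c i else 0)"
    unfolding wedge_def ext_vector_apply sum_distrib_left Pow_UNIV
    by (intro sum.cong refl, simp only: mult_zero_right simp_thms split: if_split, blast)
  also have "\<dots> = (\<Sum>i\<in>UNIV. \<Sum>I\<in>UNIV. if UNIV - I = {i} then ?s I * c i else 0)"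
    by (rule sum.swap)
  also have "\<dots> = (\<Sum>i\<in>UNIV. c i * creation i u UNIV)"
  proof (rule sum.cong[OF refl])
    fix i :: 'n
    have "UNIV - I = {i} \<longleftrightarrow> I = UNIV - {i}" for I :: "'n set" by blast
    then have "(\<Sum>I\<in>UNIV. if UNIV - I = {i} then ?s I * c i else 0) = ?s (UNIV - {i}) * c i"
      by simp
    moreover have "{(i', j). i' \<in> UNIV - {i} \<and> j \<in> UNIV - (UNIV - {i}) \<and> j < i'} =
        (\<lambda>l. (l, i)) ` {l. i < l}" by auto
    then have "card {(i', j). i' \<in> UNIV - {i} \<and> j \<in> UNIV - (UNIV - {i}) \<and> j < i'} = card {l. i < l}"
      by (simp add: card_image inj_on_def)
    moreover have "even (card {l. i < l}) \<longleftrightarrow> even (below i UNIV)"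
    proof -
      have "(UNIV :: 'n set) = {l. l < i} \<union> ({l. i < l} \<union> {i})" by auto
      then have "CARD('n) = card ({l. l < i} \<union> ({l. i < l} \<union> {i}))" by simp
      also have "\<dots> = card {l. l < i} + (card {l. i < l} + card {i})"
        by (subst card_Un_disjoint; auto)+
      finally show ?thesis using assms by (simp add: below_def)
    qed
    then have "(- 1) ^ card {l. i < l} = ((- 1) ^ below i UNIV :: 'r)"
      by (simp add: minus_one_power_iff)
    ultimately show "(\<Sum>I\<in>UNIV. if UNIV - I = {i} then ?s I * c i else 0) = c i * creation i u UNIV"
      by (simp add: creation_def mult_ac)
  qed
  finally show ?thesis .
qed

text \<open>Contraction with a vector in the kernel of \<open>b\<close> and \<open>c\<close> annihilates the top form
  \<open>b\<^sup>n \<and> c\<close>.\<close>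

lemma nondegenerate_kernel:
  fixes b :: "'n::{finite,linorder} \<Rightarrow> 'n \<Rightarrow> 'r::{idom,ring_char_0}"
  assumes anti: "\<And>i j. b i j = - b j i" and card: "CARD('n) = 2 * n + 1"
    and nz: "wedge (wedge_power (ext_bivector b) n) (ext_vector c) \<noteq> 0"
    and ker: "\<And>i. (\<Sum>j\<in>UNIV. b i j * v j) = 0" "(\<Sum>j\<in>UNIV. c j * v j) = 0"
  shows "v i = 0"
proof -
  let ?w = "wedge_power (ext_bivector b)"
  \<comment> \<open>Contraction with the vector \<open>v\<close>.\<close>
  define con where "con u K = (\<Sum>i\<in>UNIV. v i * annihilation i u K)" for u :: "('n, 'r) ext" and K
  have ann2: "annihilation l (creation i (creation j u)) K =
      (if l = i then creation j u K else 0) - (if l = j then creation i u K else 0)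
      + creation i (creation j (annihilation l u)) K" for l i j and u :: "('n, 'r) ext" and K
  proof -
    have "annihilation l (creation j u) = (\<lambda>K. (if l = j then u K else 0) - creation j (annihilation l u) K)"
      by (rule ext) (rule annihilation_creation)
    then show ?thesis unfolding annihilation_creation[of l i]
      by (auto simp: creation_diff) (auto simp: creation_def)
  qed
  \<comment> \<open>Contraction of the bivector with \<open>v\<close> is the vector
    \<open>b v\<close> up to a factor, which is 0; moving past each bivector therefore leaves
    nothing.\<close>
  have con0: "con (?w m) K = 0" for m K
  proof (induction m arbitrary: K)
    case 0
    show ?case by (simp add: con_def annihilation_unit)
  next
    case (Suc m)
    let ?u = "?w m"
    have "2 * con (?w (Suc m)) K = con (bivector_op b ?u) K"
      unfolding con_def annihilation_def sum_distrib_left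
      by (rule sum.cong) (simp_all add: two_wedge_bivector[of b, OF anti, symmetric] mult_ac)
    also have "\<dots> = (\<Sum>l\<in>UNIV. \<Sum>i\<in>UNIV. \<Sum>j\<in>UNIV.
        v l * b i j * annihilation l (creation i (creation j ?u)) K)"
      unfolding con_def bivector_op_def annihilation_sum[abs_def] annihilation_mult[abs_def]
      by (simp only: sum_distrib_left mult.assoc annihilation_sum annihilation_mult)
    also have "\<dots> = (\<Sum>l\<in>UNIV. \<Sum>i\<in>UNIV. \<Sum>j\<in>UNIV. if l = i then v l * b i j * creation j ?u K else 0) -
       (\<Sum>l\<in>UNIV. \<Sum>i\<in>UNIV. \<Sum>j\<in>UNIV. if l = j then v l * b i j * creation i ?u K else 0) +
       (\<Sum>l\<in>UNIV. \<Sum>i\<in>UNIV. \<Sum>j\<in>UNIV. v l * b i j * creation i (creation j (annihilation l ?u)) K)"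
      unfolding sum_subtractf[symmetric] sum.distrib[symmetric]
      by (intro sum.cong refl) (simp add: ann2 algebra_simps)
    also have "(\<Sum>l\<in>UNIV. \<Sum>i\<in>UNIV. \<Sum>j\<in>UNIV. if l = j then v l * b i j * creation i ?u K else 0) = 0"
    proof -
      have "(\<Sum>l\<in>UNIV. \<Sum>i\<in>UNIV. \<Sum>j\<in>UNIV. if l = j then v l * b i j * creation i ?u K else 0) =
          (\<Sum>i\<in>UNIV. \<Sum>l\<in>UNIV. v l * b i l * creation i ?u K)"
        by (subst sum.swap) simp
      also have "\<dots> = (\<Sum>i\<in>UNIV. (\<Sum>l\<in>UNIV. b i l * v l) * creation i ?u K)"
        by (rule sum.cong[OF refl], subst sum_distrib_right, rule sum.cong[OF refl], simp add: mult_ac)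
      finally show ?thesis by (simp add: ker)
    qed
    also have "(\<Sum>l\<in>UNIV. \<Sum>i\<in>UNIV. \<Sum>j\<in>UNIV. if l = i then v l * b i j * creation j ?u K else 0) = 0"
    proof -
      have "(\<Sum>l\<in>UNIV. \<Sum>i\<in>UNIV. \<Sum>j\<in>UNIV. if l = i then v l * b i j * creation j ?u K else 0) =
          (\<Sum>l\<in>UNIV. \<Sum>j\<in>UNIV. \<Sum>i\<in>UNIV. if l = i then v l * b i j * creation j ?u K else 0)"
        by (rule sum.cong[OF refl], rule sum.swap)
      also have "\<dots> = (\<Sum>l\<in>UNIV. \<Sum>j\<in>UNIV. v l * b l j * creation j ?u K)"
        by simp
      also have "\<dots> = (\<Sum>j\<in>UNIV. \<Sum>l\<in>UNIV. v l * b l j * creation j ?u K)"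
        by (rule sum.swap)
      also have "\<dots> = (\<Sum>j\<in>UNIV. - (\<Sum>l\<in>UNIV. b j l * v l) * creation j ?u K)"
        by (rule sum.cong[OF refl], subst sum_negf[symmetric], subst sum_distrib_right,
            rule sum.cong[OF refl], subst anti, simp add: mult_ac)
      finally show ?thesis by (simp add: ker)
    qed
    also have "(\<Sum>l\<in>UNIV. \<Sum>i\<in>UNIV. \<Sum>j\<in>UNIV. v l * b i j * creation i (creation j (annihilation l ?u)) K) =
        bivector_op b (con ?u) K"
    proof -
      have "(\<Sum>l\<in>UNIV. \<Sum>i\<in>UNIV. \<Sum>j\<in>UNIV. v l * b i j * creation i (creation j (annihilation l ?u)) K) =
          (\<Sum>i\<in>UNIV. \<Sum>j\<in>UNIV. \<Sum>l\<in>UNIV. v l * b i j * creation i (creation j (annihilation l ?u)) K)"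
        by (subst sum.swap) (intro sum.cong refl sum.swap)
      also have "\<dots> = bivector_op b (con ?u) K"
        unfolding con_def[abs_def] bivector_op_def creation_sum[abs_def] creation_mult[abs_def]
          sum_distrib_left creation_sum creation_mult by (simp only: mult_ac)
      finally show ?thesis .
    qed
    also have "con ?u = (\<lambda>K. 0)" using Suc.IH by blast
    also have "bivector_op b (\<lambda>K. 0) K = 0" by (simp add: bivector_op_def creation_0)
    finally show ?case by simp
  qed
  obtain K where K: "wedge (?w n) (ext_vector c) K \<noteq> 0" using nz by (auto simp: fun_eq_iff)
  then obtain I where I: "I \<subseteq> K" "?w n I \<noteq> 0" "ext_vector c (K - I) \<noteq> 0"
    unfolding wedge_def by (metis (no_types, lifting) PowD mult_eq_0_iff sum.neutral)
  have "card (K - I) = 1"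
  proof -
    have "\<exists>i. K - I = {i}"
    proof (rule ccontr)
      assume "\<nexists>i. K - I = {i}"
      then have "ext_vector c (K - I) = 0" unfolding ext_vector_apply by simp
      then show False using I(3) by simp
    qed
    then show ?thesis by auto
  qed
  \<comment> \<open>Degree count: the product can be nonzero only in the top component.\<close>
  then have "card K = 2 * n + 1"
    using wedge_power_support[of b, OF anti I(2)] I(1) card_mono[OF finite I(1)] by (simp add: card_Diff_subset)
  then have "K = UNIV" using card by (metis card_subset_eq finite subset_UNIV)
  then have top: "(\<Sum>i\<in>UNIV. c i * creation i (?w n) UNIV) \<noteq> 0"
    using K card by (simp add: wedge_vector_top)
  \<comment> \<open>The top form with the vector \<open>c\<close> moved to the front; its
    contraction vanishes because both \<open>c\<close> and the power are killed by
    \<open>v\<close>.\<close>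
  let ?c = "\<lambda>K. \<Sum>j\<in>UNIV. c j * creation j (?w n) K"
  have "con ?c K = (\<Sum>j\<in>UNIV. c j * v j) * ?w n K - (\<Sum>j\<in>UNIV. c j * creation j (con (?w n)) K)" for K
  proof -
    have "con ?c K = (\<Sum>l\<in>UNIV. \<Sum>j\<in>UNIV. v l * (c j * annihilation l (creation j (?w n)) K))"
      unfolding con_def annihilation_sum annihilation_mult sum_distrib_left ..
    also have "\<dots> = (\<Sum>l\<in>UNIV. \<Sum>j\<in>UNIV. if l = j then c j * v l * ?w n K else 0) -
        (\<Sum>l\<in>UNIV. \<Sum>j\<in>UNIV. c j * (v l * creation j (annihilation l (?w n)) K))"
      unfolding sum_subtractf[symmetric]
      by (intro sum.cong refl) (simp add: annihilation_creation algebra_simps)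
    also have "(\<Sum>l\<in>UNIV. \<Sum>j\<in>UNIV. c j * (v l * creation j (annihilation l (?w n)) K)) =
        (\<Sum>j\<in>UNIV. c j * creation j (con (?w n)) K)"
      unfolding con_def[abs_def] creation_sum creation_mult sum_distrib_left by (rule sum.swap)
    finally show ?thesis by (simp add: sum_distrib_right)
  qed
  moreover have "con (?w n) = (\<lambda>K. 0)" using con0 by blast
  ultimately have "con ?c K = 0" for K
    using ker(2) by (simp add: creation_0)
  \<comment> \<open>At the complement of \<open>i\<close> only the contraction with index
    \<open>i\<close> reaches the top component, so \<open>v i\<close> times a nonzero number is
    0.\<close>
  then have "con ?c (UNIV - {i}) = 0" .
  moreover have "annihilation l ?c (UNIV - {i}) = 0" if "l \<noteq> i" for l
    using that by (simp add: annihilation_def)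
  then have "con ?c (UNIV - {i}) = (\<Sum>l\<in>UNIV. if l = i then v i * annihilation i ?c (UNIV - {i}) else 0)"
    unfolding con_def by (intro sum.cong) auto
  ultimately have "v i * annihilation i ?c (UNIV - {i}) = 0" by simp
  moreover have "insert i (UNIV - {i}) = UNIV" by blast
  then have "annihilation i ?c (UNIV - {i}) \<noteq> 0"
    using top by (simp add: annihilation_def)
  ultimately show ?thesis by simp
qed

lemma hom_of_degree_wedge_power:
  fixes b :: "'n::{finite,linorder} \<Rightarrow> 'n \<Rightarrow> ('v::linorder, 'k::field_char_0) mpoly"
  assumes anti: "\<And>i j. b i j = - b j i" and b: "\<And>i j. hom_of_degree 1 (b i j)"
  shows "hom_of_degree n (wedge_power (ext_bivector b) n K)"
proof (induction n arbitrary: K)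
  case 0
  have "hom_of_degree 0 (1 :: ('v, 'k) mpoly)" by (metis hom_of_degree_Const Const_hom_simps(2))
  then show ?case by (simp add: hom_of_degree_0)
next
  case (Suc n)
  have "hom_of_degree d (creation i u K)" if "\<And>K. hom_of_degree d (u K)"
    for d i and u :: "('n, ('v, 'k) mpoly) ext" and K
  proof -
    have "hom_of_degree d (Const ((- 1) ^ m) * u K)" for m K
      using hom_of_degree_mult[OF hom_of_degree_Const that] by simp
    then show ?thesis
      by (auto simp: creation_def hom_of_degree_0 hom_power[OF is_hom_Const] Const_hom_simps)
  qed
  then have "hom_of_degree (1 + n) (bivector_op b (wedge_power (ext_bivector b) n) K)"
    unfolding bivector_op_def using b Suc.IH
    by (intro hom_of_degree_sum hom_of_degree_mult) blast+
  \<comment> \<open>Homogeneity of the doubled power is known; multiplying by the constant 1/2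
    returns to the power itself.\<close>
  then have "hom_of_degree (0 + (1 + n)) (Const (1/2) * bivector_op b (wedge_power (ext_bivector b) n) K)"
    by (intro hom_of_degree_mult hom_of_degree_Const)
  moreover have "Const (1/2) * bivector_op b (wedge_power (ext_bivector b) n) K =
      wedge_power (ext_bivector b) (Suc n) K"
  proof -
    have "(2 :: ('v, 'k) mpoly) = Const 2"
      by (metis Const_hom_simps(2,3) one_add_one)
    moreover have "Const (inverse 2) * Const 2 = (1 :: ('v, 'k) mpoly)"
      by (rule Const_inverse) simp
    ultimately have "Const (1/2) * 2 = (1 :: ('v, 'k) mpoly)"
      by (simp add: inverse_eq_divide)
    then have "Const (1/2) * (2 * wedge (ext_bivector b) (wedge_power (ext_bivector b) n) K) =
        wedge (ext_bivector b) (wedge_power (ext_bivector b) n) K"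
      by (simp flip: mult.assoc)
    then show ?thesis by (simp add: two_wedge_bivector[of b, OF anti])
  qed
  ultimately show ?case by simp
qed

section \<open>Common eigenvectors of linear vector fields\<close>

lemma irreducible_associated:
  fixes f g :: "'a::idom"
  assumes "irreducible f" "f dvd g" "g dvd f"
  shows "irreducible g"
proof -
  obtain z where z: "f = g * z" using assms by blast
  show ?thesis
    unfolding irreducible_def
  proof (intro conjI allI impI notI)
    show False if "g = 0" using assms that by (auto simp: irreducible_def)
    show False if "g dvd 1" using assms that by (auto simp: irreducible_def dest: dvd_trans)
    show "a dvd 1 \<or> b dvd 1" if "g = a * b" for a b
    proof -
      have "f = a * (b * z)" using z that by (simp add: mult.assoc)
      then have "a dvd 1 \<or> b * z dvd 1" using irreducibleD[OF assms(1)] by blast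
      then show ?thesis using dvd_mult_left by blast
    qed
  qed
qed

lemma irreducible_dvd_imp_Const_mult:
  fixes f g :: "('v::linorder, 'k::field) mpoly"
  assumes "irreducible f" "irreducible g" "f dvd g"
  obtains c where "c \<noteq> 0" "g = Const c * f"
proof -
  obtain z where z: "g = f * z" using assms by blast
  then have "z dvd 1" using irreducibleD[OF assms(2) z] assms(1) by (auto simp: irreducible_def)
  then obtain c where "c \<noteq> 0" "z = Const c" by (auto simp: mpoly_unit_iff)
  then show ?thesis using that[of c] z by (simp add: mult.commute)
qed

lemma irreducible_dvd_prod:
  fixes h :: "('v::{finite,linorder}, 'k::field) mpoly"
  assumes h: "irreducible h" and fin: "finite A" and dvd: "h dvd (\<Prod>i\<in>A. g i ^ e i)"
  shows "\<exists>i\<in>A. h dvd g i"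
  using fin dvd
proof (induction A rule: finite_induct)
  case empty
  then show ?case using h by (simp add: irreducible_def)
next
  case (insert j A)
  have "h dvd g j" if "h dvd g j ^ n" for n
    using that
  proof (induction n)
    case 0
    then show ?case using h by (simp add: irreducible_def)
  next
    case (Suc n)
    then show ?case using irreducible_dvd_mult_iff[OF h] by auto
  qed
  then show ?case using insert irreducible_dvd_mult_iff[OF h] by auto
qed

lemma irreducible_dvd_prod_list:
  fixes h :: "('v::{finite,linorder}, 'k::field) mpoly"
  assumes h: "irreducible h" and dvd: "h dvd Const c * prod_list fs" "c \<noteq> 0"
  shows "\<exists>f\<in>set fs. h dvd f"
proof -
  have "\<not> h dvd Const c"
  proof
    assume "h dvd Const c"
    moreover have "Const c dvd (1 :: ('v, 'k) mpoly)" using dvd(2) by (auto simp: mpoly_unit_iff)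
    ultimately have "h dvd 1" by (rule dvd_trans)
    then show False using h by (simp add: irreducible_def)
  qed
  then have "h dvd prod_list fs" using dvd irreducible_dvd_mult_iff[OF h] by blast
  then show ?thesis
  proof (induction fs)
    case Nil
    then show ?case using h by (simp add: irreducible_def)
  next
    case (Cons f fs)
    then show ?case using irreducible_dvd_mult_iff[OF h] by auto
  qed
qed

text \<open>The extra factor \<open>h\<close> avoids the exponent \<open>e - 1\<close>, so that
  \<open>e = 0\<close> fits the same formula.\<close>

lemma pderiv_var_power_mult:
  "h * pderiv_var k (h ^ e * F) = h ^ e * (of_nat e * pderiv_var k h * F + h * pderiv_var k F)"
proof (cases e)
  case 0
  then show ?thesis by simp
next
  case (Suc j)
  show ?thesis
    unfolding Suc derivation_mult[OF is_derivation_pderiv_var] derivation_power[OF is_derivation_pderiv_var]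
    by (simp only: power_Suc distrib_left mult_ac)
qed

text \<open>The multiplicity \<open>e\<close> is the residue of the logarithmic derivative along
  \<open>h\<close>. Clearing denominators and reducing modulo \<open>h\<close> leaves
  \<open>(e' - e)\<close> times \<open>F * G\<close> and a derivative of \<open>h\<close> that
  \<open>h\<close> does not divide.\<close>

lemma log_derivative_multiplicity:
  fixes h :: "('v::{finite,linorder}, 'k::field_char_0) mpoly"
  assumes h: "irreducible h" and F: "\<not> h dvd F" and G: "\<not> h dvd G"
    and eq: "\<And>k. (h ^ e * F) * pderiv_var k (h ^ e' * G) = (h ^ e' * G) * pderiv_var k (h ^ e * F)"
  shows "e = e'"
proof (rule ccontr)
  assume ne: "e \<noteq> e'"
  obtain k where k: "\<not> h dvd pderiv_var k h" using irreducible_exists_pderiv_var[OF h] by blast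
  let ?d = "pderiv_var k h"
  have h0: "h \<noteq> 0" using h by auto
  have "h ^ e * h ^ e' * (F * (of_nat e' * ?d * G + h * pderiv_var k G)) =
      (h ^ e * F) * (h * pderiv_var k (h ^ e' * G))"
    unfolding pderiv_var_power_mult by (simp only: mult_ac)
  also have "\<dots> = (h ^ e' * G) * (h * pderiv_var k (h ^ e * F))"
    using eq[of k] by (simp only: mult.left_commute[of _ h])
  also have "\<dots> = h ^ e * h ^ e' * (G * (of_nat e * ?d * F + h * pderiv_var k F))"
    unfolding pderiv_var_power_mult by (simp only: mult_ac)
  finally have "F * (of_nat e' * ?d * G + h * pderiv_var k G) = G * (of_nat e * ?d * F + h * pderiv_var k F)"
    using h0 by simp
  then have "(of_nat e' - of_nat e) * (?d * (F * G)) = h * (G * pderiv_var k F - F * pderiv_var k G)"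
    by (simp add: algebra_simps)
  moreover have "(of_nat e' - of_nat e :: ('v, 'k) mpoly) = Const (of_nat e' - of_nat e)"
  proof -
    have "(of_nat j :: ('v, 'k) mpoly) = Const (of_nat j)" for j
      by (induction j) (simp_all add: Const_hom_simps)
    then show ?thesis by (simp add: Const_hom_simps)
  qed
  ultimately have "h dvd Const (of_nat e' - of_nat e) * prod_list [?d, F, G]"
    by simp
  moreover have "of_nat e' - of_nat e \<noteq> (0 :: 'k)" using ne by simp
  ultimately have "\<exists>f\<in>set [?d, F, G]. h dvd f" by (rule irreducible_dvd_prod_list[OF h])
  then show False using k F G by simp
qed

text \<open>Subtracting the eigenvalue at \<open>a\<close> from a field removes \<open>a\<close>
  from the relation. Each pair may need its own field, so \<open>r\<close> is chosen after the index
  \<open>b\<close> whose coefficient is to vanish.\<close>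

lemma eigenvectors_independent:
  fixes E :: "'i \<Rightarrow> ('n::{finite,linorder}, 'k::field) mpoly"
  assumes fin: "finite A" and nz: "\<And>i. i \<in> A \<Longrightarrow> E i \<noteq> 0"
    and eig: "\<And>r i. i \<in> A \<Longrightarrow> vfield (B r) (E i) = Const (ev r i) * E i"
    and sep: "\<And>i j. i \<in> A \<Longrightarrow> j \<in> A \<Longrightarrow> i \<noteq> j \<Longrightarrow> \<exists>r. ev r i \<noteq> ev r j"
    and zero: "(\<Sum>i\<in>A. Const (c i) * E i) = 0" and "i \<in> A"
  shows "c i = 0"
  using assms
proof (induction A arbitrary: c i rule: finite_induct)
  case empty
  then show ?case by simp
next
  case (insert a A)
  have "c b = 0" if b: "b \<in> A" for b
  proof -
    have "a \<noteq> b" using insert.hyps(2) b by blast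
    then obtain r where r: "ev r a \<noteq> ev r b" using insert.prems(3)[of a b] b by auto
    have "0 = vfield (B r) (\<Sum>i\<in>insert a A. Const (c i) * E i)
        - Const (ev r a) * (\<Sum>i\<in>insert a A. Const (c i) * E i)"
      unfolding insert.prems(4) by (simp add: derivation_0[OF is_derivation_vfield])
    also have "\<dots> = (\<Sum>i\<in>insert a A. Const (c i) * (vfield (B r) (E i) - Const (ev r a) * E i))"
      unfolding derivation_sum[OF is_derivation_vfield] vfield_Const_mult sum_distrib_left
        sum_subtractf[symmetric] by (intro sum.cong refl) (simp add: algebra_simps)
    also have "\<dots> = (\<Sum>i\<in>insert a A. Const (c i * (ev r i - ev r a)) * E i)"
      by (intro sum.cong refl) (simp add: insert.prems(2) Const_hom_simps algebra_simps)
    also have "\<dots> = (\<Sum>i\<in>A. Const (c i * (ev r i - ev r a)) * E i)"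
      using insert.hyps by (simp add: Const_hom_simps)
    finally have "c b * (ev r b - ev r a) = 0"
      using insert.IH[of "\<lambda>i. c i * (ev r i - ev r a)" b] insert.prems(1-3) b by simp
    then show ?thesis using r by simp
  qed
  moreover from this have "Const (c a) * E a = 0"
    using insert.prems(4) insert.hyps by (simp add: Const_hom_simps)
  then have "c a = 0" using insert.prems(1) by simp
  ultimately show ?case using insert.prems(5) by blast
qed

text \<open>The determinant \<open>\<Delta>\<close> of suitable combinations of the vector fields in \<open>\<C>\<close> and the Euler
  field: its nonvanishing says that these fields generically span the tangent space.\<close>

locale prehomogeneous =
  fixes \<C> :: "('n::{finite,linorder} \<Rightarrow> ('n, 'k::{field_char_0}) mpoly) set"
    and \<Delta> :: "('n, 'k) mpoly"
  assumes linear: "c \<in> \<C> \<Longrightarrow> hom_of_degree 1 (c i)"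
    and nonzero: "\<Delta> \<noteq> 0"
    and cramer: "\<And>f y k. (\<And>c. c \<in> \<C> \<Longrightarrow> f dvd (\<Sum>l\<in>UNIV. c l * y l)) \<Longrightarrow>
      f dvd (\<Sum>l\<in>UNIV. Var l * y l) \<Longrightarrow> f dvd \<Delta> * y k"
begin

definition eigen :: "('n, 'k) mpoly \<Rightarrow> bool" where
  "eigen F \<longleftrightarrow> (\<forall>c\<in>\<C>. \<exists>k. vfield c F = Const k * F)"

definition prime_eigen :: "('n, 'k) mpoly set" where
  "prime_eigen = {f. irreducible f \<and> homogeneous f \<and> eigen f}"

lemma eigen_mult:
  assumes "eigen F" "eigen G"
  shows "eigen (F * G)"
  unfolding eigen_def
proof
  fix c
  assume "c \<in> \<C>"
  then obtain k l where "vfield c F = Const k * F" "vfield c G = Const l * G"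
    using assms unfolding eigen_def by blast
  then have "vfield c (F * G) = Const (k + l) * (F * G)"
    by (simp add: derivation_mult[OF is_derivation_vfield] Const_hom_simps algebra_simps)
  then show "\<exists>k. vfield c (F * G) = Const k * (F * G)" by blast
qed

lemma eigen_Const: "eigen (Const k)"
  unfolding eigen_def by (auto simp: vfield_Const intro: exI[of _ 0])

lemma eigen_power: "eigen F \<Longrightarrow> eigen (F ^ n)"
  by (induction n) (auto intro: eigen_mult eigen_Const[of 1, unfolded Const_hom_simps])

lemma eigen_prod: "(\<And>i. i \<in> A \<Longrightarrow> eigen (f i)) \<Longrightarrow> eigen (\<Prod>i\<in>A. f i)"
  by (induction A rule: infinite_finite_induct)
    (auto intro: eigen_mult eigen_Const[of 1, unfolded Const_hom_simps])

lemma eigen_hcomp: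
  assumes "eigen F"
  shows "eigen (hcomp d F)"
  unfolding eigen_def
proof
  fix c
  assume c: "c \<in> \<C>"
  then obtain k where k: "vfield c F = Const k * F" using assms by (auto simp: eigen_def)
  have "vfield c (hcomp d F) = hcomp d (vfield c F)"
    using hcomp_vfield[of c] linear[OF c] by simp
  also have "\<dots> = Const k * hcomp d F" by (simp add: k grading_simps grading_Const)
  finally show "\<exists>k. vfield c (hcomp d F) = Const k * hcomp d F" by blast
qed

lemma eigen_irreducible_factor:
  assumes "eigen F" "F \<noteq> 0" "irreducible f" "f dvd F"
  shows "eigen f"
  unfolding eigen_def
proof
  fix c
  assume c: "c \<in> \<C>"
  obtain e w where F: "F = f ^ e * w" and w: "\<not> f dvd w"
    using irreducible_power_split assms by blast
  have "e > 0" using assms(4) w F by (cases e) auto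
  obtain l where "vfield c F = Const l * F" using assms(1) c by (auto simp: eigen_def)
  then have "f ^ e dvd vfield c (f ^ e * w)" by (simp add: F)
  then have "f dvd vfield c f" by (rule vfield_irreducible_factor[OF assms(3) w \<open>e > 0\<close>])
  then show "\<exists>k. vfield c f = Const k * f"
    using linear[OF c] by (intro dvd_vfield_imp_eigenvector)
qed

lemma prime_eigen_factor:
  assumes "eigen F" "hom_of_degree d F" "F \<noteq> 0" "irreducible f" "f dvd F"
  shows "f \<in> prime_eigen"
proof -
  obtain z where "F = f * z" using assms(5) by blast
  then have "homogeneous f" using hom_of_degree_factor[of d f z] assms by (auto simp: homogeneous_iff)
  then show ?thesis using eigen_irreducible_factor assms by (simp add: prime_eigen_def)
qed

lemma prime_eigen_dvd_determinant:
  assumes "f \<in> prime_eigen"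
  shows "f dvd \<Delta>"
proof -
  have f: "irreducible f" "homogeneous f" "eigen f" using assms by (auto simp: prime_eigen_def)
  obtain k where k: "\<not> f dvd pderiv_var k f" using irreducible_exists_pderiv_var[OF f(1)] by blast
  have "f dvd \<Delta> * pderiv_var k f"
  proof (rule cramer)
    fix c
    assume "c \<in> \<C>"
    then show "f dvd (\<Sum>l\<in>UNIV. c l * pderiv_var l f)"
      using f(3) by (auto simp: eigen_def vfield_def)
  next
    obtain d where "hom_of_degree d f" using f(2) by (auto simp: homogeneous_iff)
    then have "vfield Var f = Const (of_nat d) * f" by (rule euler)
    then show "f dvd (\<Sum>l\<in>UNIV. Var l * pderiv_var l f)" by (simp add: vfield_def)
  qed
  then show ?thesis using k irreducible_dvd_mult_iff[OF f(1)] by blast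
qed

lemma prime_eigen_associated:
  assumes "f \<in> prime_eigen" "f dvd g" "g dvd f"
  shows "g \<in> prime_eigen"
proof -
  have f: "irreducible f" "homogeneous f" "eigen f" using assms by (auto simp: prime_eigen_def)
  have g: "irreducible g" using irreducible_associated f(1) assms by blast
  obtain c where c: "c \<noteq> 0" "g = Const c * f" using irreducible_dvd_imp_Const_mult f(1) g assms(2) by blast
  have "homogeneous g"
    using f(2) hom_of_degree_mult[OF hom_of_degree_Const] c(2) by (auto simp: homogeneous_iff)
  moreover have "eigen g" using c(2) eigen_mult[OF eigen_Const f(3)] by simp
  ultimately show ?thesis using g by (simp add: prime_eigen_def)
qed

text \<open>Every member divides \<Delta>, so it is associated to one of the finitely many
  irreducible factors of \<Delta>.\<close>

lemma prime_eigen_representatives: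
  obtains m :: nat and H where "\<And>i. i \<in> {1..m} \<Longrightarrow> H i \<in> prime_eigen"
    "\<And>i j. i \<in> {1..m} \<Longrightarrow> j \<in> {1..m} \<Longrightarrow> H i dvd H j \<Longrightarrow> i = j"
    "\<And>f. f \<in> prime_eigen \<Longrightarrow> \<exists>i\<in>{1..m}. H i dvd f"
proof -
  obtain c fs where fs: "c \<noteq> 0" "\<Delta> = Const c * prod_list fs" "\<forall>f\<in>set fs. irreducible f"
    using irreducible_factorization[OF nonzero] by blast
  \<comment> \<open>The choice depends only on the class of associates, so associated elements have
    equal representatives and divisibility between members of \<open>T\<close> becomes
    equality.\<close>
  define rep where "rep f = (SOME g. g dvd f \<and> f dvd g)" for f :: "('n, 'k) mpoly"
  have rep: "rep f dvd f" "f dvd rep f" for f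
    using someI[of "\<lambda>g. g dvd f \<and> f dvd g" f] unfolding rep_def by auto
  have rep_eq: "rep f = rep g" if "f dvd g" "g dvd f" for f g
  proof -
    have "h dvd f \<and> f dvd h \<longleftrightarrow> h dvd g \<and> g dvd h" for h
      using that dvd_trans[of h f g] dvd_trans[of h g f] dvd_trans[of f g h] dvd_trans[of g f h] by blast
    then show ?thesis unfolding rep_def by simp
  qed
  define T where "T = rep ` (set fs \<inter> prime_eigen)"
  have T: "T \<subseteq> prime_eigen"
    unfolding T_def using prime_eigen_associated rep by blast
  have "finite T" by (simp add: T_def)
  then obtain H where H: "bij_betw H {1..card T} T" using ex_bij_betw_nat_finite_1 by blast
  have rep_T: "t = rep f" if "t \<in> T" "f dvd t" "t dvd f" for t f
  proof -
    obtain g where "t = rep g" using \<open>t \<in> T\<close> by (auto simp: T_def)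
    then show ?thesis using rep_eq[of f g] rep[of g] that by (metis dvd_trans)
  qed
  show ?thesis
  proof (rule that[of "card T" H])
    show mem: "H i \<in> prime_eigen" if "i \<in> {1..card T}" for i
      using H T that by (auto simp: bij_betw_def)
    show "i = j" if ij: "i \<in> {1..card T}" "j \<in> {1..card T}" "H i dvd H j" for i j
    proof -
      have "H j dvd H i"
        using irreducible_dvd_irreducible mem ij by (auto simp: prime_eigen_def)
      moreover have T: "H i \<in> T" "H j \<in> T" using H ij by (auto simp: bij_betw_def)
      ultimately have "H j = rep (H i)" using ij(3) by (intro rep_T)
      moreover have "H i = rep (H i)" using T by (intro rep_T) auto
      ultimately have "H i = H j" by metis
      then show ?thesis using inj_onD[OF bij_betw_imp_inj_on[OF H] _ ij(1,2)] by blast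
    qed
    show "\<exists>i\<in>{1..card T}. H i dvd f" if f: "f \<in> prime_eigen" for f
    proof -
      have irr: "irreducible f" using f by (simp add: prime_eigen_def)
      have "f dvd Const c * prod_list fs" using prime_eigen_dvd_determinant[OF f] fs by simp
      then obtain g where g: "g \<in> set fs" "f dvd g"
        using irreducible_dvd_prod_list[OF irr _ fs(1)] by blast
      then have "g dvd f" using irreducible_dvd_irreducible irr fs(3) by blast
      then have "rep g \<in> T" using prime_eigen_associated[OF f g(2)] g(1) by (simp add: T_def)
      then obtain i where "i \<in> {1..card T}" "H i = rep g"
        using H by (metis bij_betw_imp_surj_on imageE)
      then show ?thesis using rep(1)[of g] \<open>g dvd f\<close> dvd_trans by metis
    qed
  qed
qed

end

section \<open>Factorization, independence and generation by representatives\<close>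

locale prehomogeneous_reps = prehomogeneous \<C> \<Delta>
  for \<C> :: "('n::{finite,linorder} \<Rightarrow> ('n, 'k::{field_char_0}) mpoly) set" and \<Delta> +
  fixes m :: nat and H :: "nat \<Rightarrow> ('n, 'k) mpoly"
  assumes H: "\<And>i. i \<in> {1..m} \<Longrightarrow> H i \<in> prime_eigen"
    and H_dvd: "\<And>i j. i \<in> {1..m} \<Longrightarrow> j \<in> {1..m} \<Longrightarrow> H i dvd H j \<Longrightarrow> i = j"
    and H_rep: "\<And>f. f \<in> prime_eigen \<Longrightarrow> \<exists>i\<in>{1..m}. H i dvd f"
begin

abbreviation Hprod :: "(nat \<Rightarrow> nat) \<Rightarrow> ('n, 'k) mpoly" where
  "Hprod e \<equiv> \<Prod>i\<in>{1..m}. H i ^ e i"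

lemma H_irreducible: "i \<in> {1..m} \<Longrightarrow> irreducible (H i)"
  using H by (simp add: prime_eigen_def)

lemma Hprod_nonzero: "Hprod e \<noteq> 0"
proof
  assume "Hprod e = 0"
  then obtain i where "i \<in> {1..m}" "H i ^ e i = 0"
    unfolding prod_zero_iff[OF finite_atLeastAtMost] by blast
  then show False using H_irreducible[of i] by auto
qed

lemma eigen_Hprod: "eigen (Hprod e)"
  using H by (intro eigen_prod eigen_power) (simp add: prime_eigen_def)

lemma hom_of_degree_Hprod: "\<exists>d. hom_of_degree d (Hprod e)"
proof -
  have one: "hom_of_degree 0 (1 :: ('n, 'k) mpoly)" by (metis hom_of_degree_Const Const_hom_simps(2))
  have pow: "\<exists>d. hom_of_degree d (F ^ n)" if "\<exists>d. hom_of_degree d F" for F :: "('n, 'k) mpoly" and n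
    using that by (induction n) (auto intro: one hom_of_degree_mult)
  have "\<exists>d. hom_of_degree d (\<Prod>i\<in>A. H i ^ e i)" if "A \<subseteq> {1..m}" for A
    using that
  proof (induction A rule: infinite_finite_induct)
    case (insert i A)
    have "\<exists>d. hom_of_degree d (H i ^ e i)"
      using H[of i] insert.prems pow by (simp add: prime_eigen_def homogeneous_iff)
    moreover have "\<exists>d. hom_of_degree d (\<Prod>j\<in>A. H j ^ e j)"
      using insert.IH insert.prems by blast
    ultimately obtain d d' where "hom_of_degree d (H i ^ e i)" "hom_of_degree d' (\<Prod>j\<in>A. H j ^ e j)"
      by blast
    then have "hom_of_degree (d + d') (\<Prod>j\<in>insert i A. H j ^ e j)"
      using insert.hyps hom_of_degree_mult by simp
    then show ?case by (rule exI)
  qed (auto intro: one)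
  then show ?thesis by blast
qed

lemma Hprod_split:
  assumes "i \<in> {1..m}"
  obtains w where "Hprod e = H i ^ e i * w" "\<not> H i dvd w"
proof -
  have "Hprod e = H i ^ e i * (\<Prod>j\<in>{1..m} - {i}. H j ^ e j)"
    using assms by (intro prod.remove) auto
  moreover have "\<not> H i dvd (\<Prod>j\<in>{1..m} - {i}. H j ^ e j)"
  proof
    assume "H i dvd (\<Prod>j\<in>{1..m} - {i}. H j ^ e j)"
    then obtain j where "j \<in> {1..m} - {i}" "H i dvd H j"
      using irreducible_dvd_prod[OF H_irreducible[OF assms], of "{1..m} - {i}" H e] by blast
    then show False using H_dvd[OF assms, of j] by blast
  qed
  ultimately show ?thesis using that by blast
qed

lemma factorization_Hprod:
  assumes "p \<noteq> 0" "\<And>f. irreducible f \<Longrightarrow> f dvd p \<Longrightarrow> f \<in> prime_eigen"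
  shows "\<exists>c e. c \<noteq> 0 \<and> p = Const c * Hprod e"
proof -
  obtain c fs where fs: "c \<noteq> 0" "p = Const c * prod_list fs" "\<forall>f\<in>set fs. irreducible f"
    using irreducible_factorization[OF assms(1)] by blast
  have "\<exists>c e. c \<noteq> 0 \<and> prod_list gs = Const c * Hprod e" if "set gs \<subseteq> set fs" for gs
    using that
  proof (induction gs)
    case Nil
    have "prod_list [] = Const 1 * Hprod (\<lambda>_. 0)" by (simp add: Const_hom_simps)
    then show ?case by (intro exI[of _ 1] exI[of _ "\<lambda>_. 0"]) simp
  next
    case (Cons g gs)
    then obtain c e where ce: "c \<noteq> 0" "prod_list gs = Const c * Hprod e" by auto
    have g: "irreducible g" "g dvd p" using Cons.prems fs by (auto simp: prod_list_dvd)
    then obtain i where i: "i \<in> {1..m}" "H i dvd g" using assms(2) H_rep by blast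
    obtain b where b: "b \<noteq> 0" "g = Const b * H i"
      using irreducible_dvd_imp_Const_mult[OF H_irreducible[OF i(1)] g(1) i(2)] by blast
    have "Hprod (e(i := Suc (e i))) = H i ^ Suc (e i) * (\<Prod>j\<in>{1..m} - {i}. H j ^ e j)"
      using i(1) by (subst prod.remove[of _ i]) (auto intro!: prod.cong)
    moreover have "Hprod e = H i ^ e i * (\<Prod>j\<in>{1..m} - {i}. H j ^ e j)"
      using i(1) by (intro prod.remove) auto
    ultimately have "prod_list (g # gs) = Const (b * c) * Hprod (e(i := Suc (e i)))"
      by (simp only: prod_list.Cons ce b Const_hom_simps power_Suc mult_ac)
    moreover have "b * c \<noteq> 0" using b ce by simp
    ultimately show ?case by blast
  qed
  then obtain b e where "b \<noteq> 0" "prod_list fs = Const b * Hprod e" by blast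
  then have "p = Const (c * b) * Hprod e" "c * b \<noteq> 0"
    using fs by (simp_all add: Const_hom_simps mult.assoc)
  then show ?thesis by blast
qed

text \<open>By Cramer's rule, two products with equal eigenvalues have the same logarithmic derivative.\<close>

lemma Hprod_eigenvalues_separate:
  assumes eq: "\<And>c. c \<in> insert Var \<C> \<Longrightarrow>
      \<exists>k. vfield c (Hprod e) = Const k * Hprod e \<and> vfield c (Hprod e') = Const k * Hprod e'"
    and i: "i \<in> {1..m}"
  shows "e i = e' i"
proof -
  let ?F = "Hprod e" and ?G = "Hprod e'"
  \<comment> \<open>The numerators of the differences of the logarithmic derivatives.\<close>
  let ?y = "\<lambda>l. ?F * pderiv_var l ?G - ?G * pderiv_var l ?F"
  have zero: "(\<Sum>l\<in>UNIV. c l * ?y l) = 0" if c: "c \<in> insert Var \<C>" for c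
  proof -
    obtain k where k: "vfield c ?F = Const k * ?F" "vfield c ?G = Const k * ?G" using eq[OF c] by blast
    have "(\<Sum>l\<in>UNIV. c l * ?y l) = ?F * vfield c ?G - ?G * vfield c ?F"
      unfolding vfield_def sum_distrib_left sum_subtractf[symmetric]
      by (intro sum.cong refl) (simp add: algebra_simps)
    also have "\<dots> = 0" unfolding k by (simp only: mult_ac diff_self)
    finally show ?thesis .
  qed
  have "?y k = 0" for k
  proof -
    \<comment> \<open>Divisibility by 0 turns the Cramer property into an equation.\<close>
    have "0 dvd \<Delta> * ?y k"
    proof (rule cramer)
      show "0 dvd (\<Sum>l\<in>UNIV. c l * ?y l)" if "c \<in> \<C>" for c
        using zero[of c] that by simp
      show "0 dvd (\<Sum>l\<in>UNIV. Var l * ?y l)" using zero[of Var] by simp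
    qed
    then show ?thesis using nonzero by simp
  qed
  then have eq: "?F * pderiv_var k ?G = ?G * pderiv_var k ?F" for k by simp
  obtain w where w: "?F = H i ^ e i * w" "\<not> H i dvd w" using Hprod_split[OF i] by blast
  obtain w' where w': "?G = H i ^ e' i * w'" "\<not> H i dvd w'" using Hprod_split[OF i] by blast
  show ?thesis
    using log_derivative_multiplicity[OF H_irreducible[OF i] w(2) w'(2)] eq unfolding w(1) w'(1) by blast
qed

lemma alg_independent_H: "alg_independent {1..m} H"
  unfolding alg_independent_def
proof (intro allI impI)
  fix P :: "(nat, 'k) mpoly"
  assume vars: "vars P \<subseteq> {1..m}" and zero: "subst_poly H P = 0"
  let ?E = "\<lambda>n. Hprod (Poly_Mapping.lookup n)"
  let ?A = "Poly_Mapping.keys P"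
  have keys: "Poly_Mapping.keys n \<subseteq> {1..m}" if "n \<in> ?A" for n
    using vars that by (auto simp: vars_def)
  have E: "(\<Prod>v\<in>Poly_Mapping.keys n. H v ^ Poly_Mapping.lookup n v) = ?E n" if "n \<in> ?A" for n
    using keys[OF that] by (intro prod.mono_neutral_left) (auto simp: in_keys_iff)
  have sum0: "(\<Sum>n\<in>?A. Const (Poly_Mapping.lookup P n) * ?E n) = 0"
    using zero unfolding mp_eval_def by (simp add: E)
  have ex: "\<exists>k. vfield c (Hprod e) = Const k * Hprod e" if "c \<in> insert Var \<C>" for c e
    using that eigen_Hprod[of e] hom_of_degree_Hprod[of e] euler by (auto simp: eigen_def)
  define ev where "ev c n = (SOME k. vfield c (?E n) = Const k * ?E n)" for c n
  have ev: "vfield c (?E n) = Const (ev c n) * ?E n" if "c \<in> insert Var \<C>" for c n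
    unfolding ev_def by (rule someI_ex) (rule ex[OF that])
  \<comment> \<open>\<open>eigenvectors_independent\<close> expects an eigenvalue for every index,
    so indices that name none of the fields are sent to the Euler field.\<close>
  define B where "B c = (if c \<in> insert Var \<C> then c else Var)" for c
  have B: "B c \<in> insert Var \<C>" for c by (simp add: B_def)
  have "Poly_Mapping.lookup P n = 0" if n: "n \<in> ?A" for n
  proof (rule eigenvectors_independent[of ?A ?E B "\<lambda>c. ev (B c)"])
    show "\<exists>c. ev (B c) i \<noteq> ev (B c) j" if "i \<in> ?A" "j \<in> ?A" "i \<noteq> j" for i j
    proof (rule ccontr)
      assume "\<nexists>c. ev (B c) i \<noteq> ev (B c) j"
      then have same: "ev c i = ev c j" if "c \<in> insert Var \<C>" for c
        using that unfolding B_def by (metis (full_types))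
      have on: "Poly_Mapping.lookup i v = Poly_Mapping.lookup j v" if "v \<in> {1..m}" for v
      proof (rule Hprod_eigenvalues_separate[OF _ that])
        fix c
        assume c: "c \<in> insert Var \<C>"
        show "\<exists>k. vfield c (?E i) = Const k * ?E i \<and> vfield c (?E j) = Const k * ?E j"
          using ev[OF c, of i] ev[OF c, of j] same[OF c] by (intro exI[of _ "ev c j"]) simp
      qed
      have "i = j"
      proof (rule poly_mapping_eqI)
        fix v
        show "Poly_Mapping.lookup i v = Poly_Mapping.lookup j v"
        proof (cases "v \<in> {1..m}")
          case False
          then show ?thesis using keys[OF \<open>i \<in> ?A\<close>] keys[OF \<open>j \<in> ?A\<close>] by (metis in_keys_iff subsetD)
        qed (rule on)
      qed
      then show False using \<open>i \<noteq> j\<close> by blast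
    qed
  qed (use Hprod_nonzero ev B sum0 n in auto)
  then have "Poly_Mapping.lookup P n = 0" for n by (cases "n \<in> ?A") (simp_all add: in_keys_iff)
  then show "P = 0" by (intro poly_mapping_eqI) simp
qed

text \<open>Constants are eigenvectors, so the subring on the right is an algebra. For the other
  inclusion an eigenvector is first split into its homogeneous components, whose irreducible factors
  are then homogeneous eigenvectors.\<close>

lemma subalgebra_H: "is_subalgebra hull (H ` {1..m}) = is_subring hull {F. eigen F}"
proof
  have sub: "is_subalgebra (is_subring hull {F. eigen F})"
    unfolding is_subalgebra_def
  proof
    show "is_subring (is_subring hull {F. eigen F})"
      by (rule hull_in) (auto simp: is_subring_def)
    show "\<forall>c. Const c \<in> is_subring hull {F. eigen F}"
      using eigen_Const by (auto intro: hull_inc)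
  qed
  show "is_subalgebra hull (H ` {1..m}) \<subseteq> is_subring hull {F. eigen F}"
    using H by (intro hull_minimal sub) (auto simp: prime_eigen_def intro: hull_inc)
next
  let ?R = "is_subalgebra hull (H ` {1..m})"
  have R: "is_subalgebra ?R"
    by (rule hull_in) (auto simp: is_subalgebra_def is_subring_def)
  then have R1: "1 \<in> ?R" and Rd: "\<And>a b. a \<in> ?R \<Longrightarrow> b \<in> ?R \<Longrightarrow> a - b \<in> ?R"
    and Rm: "\<And>a b. a \<in> ?R \<Longrightarrow> b \<in> ?R \<Longrightarrow> a * b \<in> ?R" and RC: "\<And>c. Const c \<in> ?R"
    by (auto simp: is_subalgebra_def is_subring_def)
  have R0: "0 \<in> ?R" using RC[of 0] by (simp add: Const_hom_simps)
  have Ra: "a + b \<in> ?R" if "a \<in> ?R" "b \<in> ?R" for a b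
    using Rd[OF that(1) Rd[OF R0 that(2)]] by simp
  have RH: "H i \<in> ?R" if "i \<in> {1..m}" for i using that by (auto intro: hull_inc)
  have RHprod: "Hprod e \<in> ?R" for e
  proof -
    have pow: "H i ^ n \<in> ?R" if "i \<in> {1..m}" for i n
      using RH[OF that] by (induction n) (simp_all add: R1 Rm del: One_nat_def)
    have "(\<Prod>i\<in>A. H i ^ e i) \<in> ?R" if "A \<subseteq> {1..m}" for A
      using that by (induction A rule: infinite_finite_induct) (auto intro!: R1 Rm pow simp del: One_nat_def)
    then show ?thesis by blast
  qed
  have "F \<in> ?R" if F: "eigen F" for F
  proof -
    have comp: "hcomp d F \<in> ?R" for d
    proof (cases "hcomp d F = 0")
      case False
      then obtain c e where "hcomp d F = Const c * Hprod e"
        using factorization_Hprod[OF False] prime_eigen_factor[OF eigen_hcomp[OF F] hom_of_degree_hcomp False]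
        by blast
      then show ?thesis using Rm RC RHprod by simp
    qed (simp add: R0 del: One_nat_def)
    have "(\<Sum>d\<in>A. hcomp d F) \<in> ?R" for A
      by (induction A rule: infinite_finite_induct) (simp_all add: R0 Ra comp del: One_nat_def)
    then show ?thesis using sum_hcomp[of F] by metis
  qed
  then show "is_subring hull {F. eigen F} \<subseteq> ?R"
    using R by (intro hull_minimal) (auto simp: is_subalgebra_def)
qed

end

section \<open>Contact Lie algebras\<close>

text \<open>The laws of the bracket are required on \<open>lspace L\<close> only: for the Lie
  algebra of a group, \<open>'v\<close> is a type of arbitrary operators, of which the derivations
  are a small part. Linearity in the first argument follows from antisymmetry.\<close>

locale contact_lie_algebra =
  fixes L :: "('k::{alg_closed_field,field_char_0}, 'v::ab_group_add) lie_alg"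
    and x :: "'n::{finite,linorder} \<Rightarrow> 'v"
  assumes vs: "vector_space (lscale L)"
    and basis: "lie_basis L x"
    and bracket_closed: "u \<in> lspace L \<Longrightarrow> v \<in> lspace L \<Longrightarrow> lbracket L u v \<in> lspace L"
    and bracket_add: "u \<in> lspace L \<Longrightarrow> v \<in> lspace L \<Longrightarrow> w \<in> lspace L \<Longrightarrow>
      lbracket L u (v + w) = lbracket L u v + lbracket L u w"
    and bracket_scale: "u \<in> lspace L \<Longrightarrow> v \<in> lspace L \<Longrightarrow>
      lbracket L u (lscale L c v) = lscale L c (lbracket L u v)"
    and bracket_anti: "u \<in> lspace L \<Longrightarrow> v \<in> lspace L \<Longrightarrow> lbracket L u v = - lbracket L v u"
    and jacobi: "u \<in> lspace L \<Longrightarrow> v \<in> lspace L \<Longrightarrow> w \<in> lspace L \<Longrightarrow>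
      lbracket L u (lbracket L v w) = lbracket L (lbracket L u v) w + lbracket L v (lbracket L u w)"
    and contact: "contact L x"
begin

sublocale V: vector_space "lscale L" by (rule vs)

abbreviation coord :: "'v \<Rightarrow> 'n \<Rightarrow> 'k" where
  "coord v i \<equiv> V.representation (range x) v (x i)"

abbreviation lf :: "'v \<Rightarrow> ('n, 'k) mpoly" where
  "lf \<equiv> lie_linear_form L x"

lemma inj_x: "inj x" and indep_x: "V.independent (range x)" and span_x: "V.span (range x) = lspace L"
  using basis by (auto simp: lie_basis_def)

lemma subspace_L: "V.subspace (lspace L)"
  unfolding span_x[symmetric] by (rule V.subspace_span)

lemmas L_zero = V.subspace_0[OF subspace_L]
  and L_add = V.subspace_add[OF subspace_L]
  and L_scale = V.subspace_scale[OF subspace_L]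
  and L_uminus = V.subspace_neg[OF subspace_L]
  and L_diff = V.subspace_diff[OF subspace_L]
  and L_sum = V.subspace_sum[OF subspace_L]

lemma x_in: "x i \<in> lspace L"
  unfolding span_x[symmetric] by (rule V.span_base) simp

lemma expand:
  assumes "v \<in> lspace L"
  shows "v = (\<Sum>i\<in>UNIV. lscale L (coord v i) (x i))"
proof -
  have "v = (\<Sum>b\<in>range x. lscale L (V.representation (range x) v b) b)"
    using V.sum_representation_eq[OF indep_x _ _ subset_refl, of v] assms span_x by simp
  also have "\<dots> = (\<Sum>i\<in>UNIV. lscale L (coord v i) (x i))"
    by (simp add: sum.reindex[OF inj_x])
  finally show ?thesis .
qed

lemma additive_on_combination:
  assumes zero: "T 0 = 0" and add: "\<And>u v. u \<in> lspace L \<Longrightarrow> v \<in> lspace L \<Longrightarrow> T (u + v) = T u + T v"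
    and "\<And>i. f i \<in> lspace L"
  shows "T (\<Sum>i\<in>A. f i) = (\<Sum>i\<in>A. T (f i))"
  by (induction A rule: infinite_finite_induct) (simp_all add: zero add assms(3) L_sum)

lemma lf_add: "u \<in> lspace L \<Longrightarrow> v \<in> lspace L \<Longrightarrow> lf (u + v) = lf u + lf v"
  unfolding lie_linear_form_def
  by (simp add: V.representation_add[OF indep_x] span_x Const_hom_simps distrib_right sum.distrib)

lemma lf_scale: "v \<in> lspace L \<Longrightarrow> lf (lscale L c v) = Const c * lf v"
  unfolding lie_linear_form_def
  by (simp add: V.representation_scale[OF indep_x] span_x Const_hom_simps sum_distrib_left mult.assoc)

lemma lf_0: "lf 0 = 0"
  unfolding lie_linear_form_def by (simp add: V.representation_zero Const_hom_simps)

lemma lf_uminus: "v \<in> lspace L \<Longrightarrow> lf (- v) = - lf v"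
  using lf_add[of v "- v"] L_uminus by (simp add: lf_0 eq_neg_iff_add_eq_0 add.commute)

lemma lf_combination: "(\<And>i. f i \<in> lspace L) \<Longrightarrow> lf (\<Sum>i\<in>A. lscale L (c i) (f i)) = (\<Sum>i\<in>A. Const (c i) * lf (f i))"
  by (subst additive_on_combination) (auto simp: lf_0 lf_add lf_scale intro: L_scale)

lemma hom_of_degree_lf: "hom_of_degree 1 (lf v)"
proof -
  have "hom_of_degree (0 + 1) (Const c * Var i)" for c :: 'k and i :: 'n
    by (intro hom_of_degree_mult hom_of_degree_Const hom_of_degree_Var)
  then show ?thesis unfolding lie_linear_form_def by (intro hom_of_degree_sum) simp
qed

lemma bracket_0: "u \<in> lspace L \<Longrightarrow> lbracket L u 0 = 0"
  using bracket_scale[of u 0 0] L_zero by simp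

lemma bracket_combination:
  "u \<in> lspace L \<Longrightarrow> (\<And>i. f i \<in> lspace L) \<Longrightarrow>
    lbracket L u (\<Sum>i\<in>A. lscale L (c i) (f i)) = (\<Sum>i\<in>A. lscale L (c i) (lbracket L u (f i)))"
  by (subst additive_on_combination) (auto simp: bracket_0 bracket_add bracket_scale intro: L_scale)

lemma lf_bracket_expand:
  assumes "u \<in> lspace L" "v \<in> lspace L"
  shows "lf (lbracket L u v) = (\<Sum>k\<in>UNIV. Const (coord v k) * lf (lbracket L u (x k)))"
proof -
  have "lbracket L u v = (\<Sum>k\<in>UNIV. lscale L (coord v k) (lbracket L u (x k)))"
    using expand[OF assms(2)] bracket_combination[OF assms(1), of x "coord v" UNIV] x_in by simp
  then show ?thesis using lf_combination[of "\<lambda>k. lbracket L u (x k)" "coord v" UNIV]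
    by (simp add: bracket_closed assms(1) x_in)
qed

definition bivec :: "'n \<Rightarrow> 'n \<Rightarrow> ('n, 'k) mpoly" where
  "bivec i j = lf (lbracket L (x i) (x j))"

lemma poisson_tensor_bivec: "poisson_tensor L x = ext_bivector bivec"
  by (simp add: poisson_tensor_def bivec_def[abs_def])

lemma bivec_anti: "bivec i j = - bivec j i"
  unfolding bivec_def using bracket_anti[OF x_in x_in, of i j] lf_uminus bracket_closed[OF x_in x_in] by metis

text \<open>The components of the Hamiltonian vector field of \<xi>.\<close>

definition act_field :: "'v \<Rightarrow> 'n \<Rightarrow> ('n, 'k) mpoly" where
  "act_field \<xi> i = lf (lbracket L \<xi> (x i))"

lemma lie_act_vfield: "lie_act L x \<xi> = vfield (act_field \<xi>)"
  by (rule ext) (simp add: lie_act_def vfield_def act_field_def)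

lemma vfield_act_lf:
  assumes "\<xi> \<in> lspace L" "v \<in> lspace L"
  shows "vfield (act_field \<xi>) (lf v) = lf (lbracket L \<xi> v)"
proof -
  have "vfield (act_field \<xi>) (lf v) = (\<Sum>k\<in>UNIV. Const (coord v k) * act_field \<xi> k)"
    unfolding lie_linear_form_def
    by (simp add: derivation_sum[OF is_derivation_vfield] vfield_Const_mult vfield_Var)
  then show ?thesis using lf_bracket_expand[OF assms] by (simp add: act_field_def)
qed

text \<open>The Jacobi identity, written in the form that \<open>derivation_wedge_power\<close>
  expects: the Poisson tensor is invariant under Hamiltonian fields.\<close>

lemma vfield_act_bivec:
  assumes "\<xi> \<in> lspace L"
  shows "vfield (act_field \<xi>) (bivec i q) =
    (\<Sum>k\<in>UNIV. Const (coord (lbracket L \<xi> (x i)) k) * bivec k q + Const (coord (lbracket L \<xi> (x q)) k) * bivec i k)"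
proof -
  have in_L: "lbracket L \<xi> (x j) \<in> lspace L" for j using bracket_closed assms x_in by blast
  have "vfield (act_field \<xi>) (bivec i q) = lf (lbracket L \<xi> (lbracket L (x i) (x q)))"
    unfolding bivec_def using vfield_act_lf assms bracket_closed x_in by blast
  also have "\<dots> = lf (lbracket L (lbracket L \<xi> (x i)) (x q)) + lf (lbracket L (x i) (lbracket L \<xi> (x q)))"
    using jacobi[OF assms x_in x_in, of i q] lf_add bracket_closed in_L x_in by simp
  also have "lf (lbracket L (lbracket L \<xi> (x i)) (x q)) = - lf (lbracket L (x q) (lbracket L \<xi> (x i)))"
    using bracket_anti[OF in_L x_in, of i q] lf_uminus bracket_closed[OF x_in in_L] by metis
  also have "\<dots> = (\<Sum>k\<in>UNIV. Const (coord (lbracket L \<xi> (x i)) k) * bivec k q)"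
    unfolding lf_bracket_expand[OF x_in in_L] bivec_def[symmetric] sum_negf[symmetric]
    by (intro sum.cong refl) (subst bivec_anti, simp)
  also have "lf (lbracket L (x i) (lbracket L \<xi> (x q))) =
      (\<Sum>k\<in>UNIV. Const (coord (lbracket L \<xi> (x q)) k) * bivec i k)"
    unfolding lf_bracket_expand[OF x_in in_L] bivec_def[symmetric] ..
  finally show ?thesis by (simp add: sum.distrib)
qed

section \<open>The contact form: kernel, index and nonvanishing of the top power\<close>

lemma card_n: "CARD('n) = V.dim (lspace L)"
proof -
  have "V.dim (lspace L) = card (range x)"
    by (rule V.dim_eq_card[OF _ indep_x]) (simp add: V.span_span flip: span_x)
  then show ?thesis using card_image[OF inj_x] by simp
qed

definition half :: nat where
  "half = (V.dim (lspace L) - 1) div 2"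

text \<open>A fixed choice of contact form, so that \<open>point\<close> and the lemmas about it can
  refer to the same one.\<close>

definition form :: "'v \<Rightarrow> 'k" where
  "form = (SOME \<alpha>. \<alpha> \<in> lie_dual L \<and>
     wedge (wedge_power (ext_bivector (\<lambda>i j. - \<alpha> (lbracket L (x i) (x j)))) half)
       (ext_vector (\<lambda>i. \<alpha> (x i))) \<noteq> 0)"

lemma card_half: "CARD('n) = 2 * half + 1"
  using contact unfolding contact_def half_def card_n by auto

lemma
  shows form_dual: "form \<in> lie_dual L"
    and form_contact: "wedge (wedge_power (ext_bivector (\<lambda>i j. - form (lbracket L (x i) (x j)))) half)
       (ext_vector (\<lambda>i. form (x i))) \<noteq> 0"
proof -
  obtain n \<alpha> where n: "V.dim (lspace L) = 2 * n + 1" "\<alpha> \<in> lie_dual L"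
    "wedge (wedge_power (ext_bivector (\<lambda>i j. - \<alpha> (lbracket L (x i) (x j)))) n)
       (ext_vector (\<lambda>i. \<alpha> (x i))) \<noteq> 0"
    using contact unfolding contact_def by blast
  have "half = n" using n(1) by (simp add: half_def)
  then have "\<exists>\<alpha>. \<alpha> \<in> lie_dual L \<and>
     wedge (wedge_power (ext_bivector (\<lambda>i j. - \<alpha> (lbracket L (x i) (x j)))) half)
       (ext_vector (\<lambda>i. \<alpha> (x i))) \<noteq> 0" using n(2,3) by blast
  from someI_ex[OF this] show "form \<in> lie_dual L"
    "wedge (wedge_power (ext_bivector (\<lambda>i j. - form (lbracket L (x i) (x j)))) half)
       (ext_vector (\<lambda>i. form (x i))) \<noteq> 0"
    unfolding form_def by blast+
qed

lemma form_add: "u \<in> lspace L \<Longrightarrow> v \<in> lspace L \<Longrightarrow> form (u + v) = form u + form v"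
  and form_scale: "u \<in> lspace L \<Longrightarrow> form (lscale L c u) = c * form u"
  using form_dual by (auto simp: lie_dual_def)

lemma form_0: "form 0 = 0"
  using form_scale[of 0 0] L_zero by simp

lemma form_combination:
  "(\<And>i. f i \<in> lspace L) \<Longrightarrow> form (\<Sum>i\<in>A. lscale L (c i) (f i)) = (\<Sum>i\<in>A. c i * form (f i))"
  by (subst additive_on_combination) (auto simp: form_0 form_add form_scale intro: L_scale)

text \<open>The sign makes the value of the Poisson tensor at \<open>point\<close> equal to the differential of the
  contact form in \<^const>\<open>contact\<close>.\<close>

definition point :: "'n \<Rightarrow> 'k" where
  "point i = - form (x i)"

lemma eval_point_lf:
  assumes "v \<in> lspace L"
  shows "eval point (lf v) = - form v"
proof -
  have "form v = (\<Sum>i\<in>UNIV. coord v i * form (x i))"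
    using expand[OF assms] form_combination[of x "coord v" UNIV] x_in by simp
  then show ?thesis
    unfolding lie_linear_form_def
    by (simp add: eval_sum eval_simps point_def sum_negf)
qed

lemma eval_point_bivec: "eval point (bivec i j) = - form (lbracket L (x i) (x j))"
  unfolding bivec_def using eval_point_lf bracket_closed x_in by blast

lemma contact_kernel:
  assumes "\<And>i. (\<Sum>j\<in>UNIV. eval point (bivec i j) * v j) = 0" "(\<Sum>j\<in>UNIV. point j * v j) = 0"
  shows "v i = 0"
proof (rule nondegenerate_kernel[where b = "\<lambda>i j. - form (lbracket L (x i) (x j))" and
      c = "\<lambda>i. form (x i)" and n = half])
  show "- form (lbracket L (x i) (x j)) = - (- form (lbracket L (x j) (x i)))" for i j
    unfolding eval_point_bivec[symmetric] by (subst bivec_anti) (simp add: eval_simps)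
  show "(\<Sum>j\<in>UNIV. form (x j) * v j) = 0" using assms(2) by (simp add: point_def sum_negf)
  show "(\<Sum>j\<in>UNIV. - form (lbracket L (x i) (x j)) * v j) = 0" for i
    using assms(1)[of i] unfolding eval_point_bivec .
qed (rule card_half form_contact)+

lemma contact_kernel_vector:
  assumes v: "v \<in> lspace L" "\<And>\<eta>. \<eta> \<in> lspace L \<Longrightarrow> form (lbracket L v \<eta>) = 0" "form v = 0"
  shows "v = 0"
proof -
  have "coord v i = 0" for i
  proof (rule contact_kernel)
    fix i
    have "form (lbracket L (x i) v) = - form (lbracket L v (x i))"
      using bracket_anti[OF x_in v(1), of i] form_scale[OF bracket_closed[OF v(1) x_in], of "- 1" i]
      by simp
    also have "\<dots> = 0" using v(2) x_in by simp
    finally have "form (lbracket L (x i) v) = 0" .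
    moreover have "lbracket L (x i) v = (\<Sum>j\<in>UNIV. lscale L (coord v j) (lbracket L (x i) (x j)))"
      using expand[OF v(1)] bracket_combination[OF x_in[of i], of x "coord v" UNIV] x_in by simp
    ultimately have "(\<Sum>j\<in>UNIV. coord v j * form (lbracket L (x i) (x j))) = 0"
      using form_combination[of "\<lambda>j. lbracket L (x i) (x j)" "coord v" UNIV] bracket_closed x_in by simp
    then show "(\<Sum>j\<in>UNIV. eval point (bivec i j) * coord v j) = 0"
      by (simp add: eval_point_bivec sum_negf mult.commute)
  next
    have "form v = (\<Sum>i\<in>UNIV. coord v i * form (x i))"
      using expand[OF v(1)] form_combination[of x "coord v" UNIV] x_in by simp
    then show "(\<Sum>j\<in>UNIV. point j * coord v j) = 0"
      using v(3) by (simp add: point_def sum_negf mult.commute)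
  qed
  then show ?thesis using expand[OF v(1)] by simp
qed

text \<open>On its own stabilizer the contact form is injective by
  \<open>contact_kernel_vector\<close>, so this stabilizer has dimension at most 1.\<close>

lemma lie_index_le_1: "lie_index L \<le> 1"
proof -
  let ?S = "lie_stabilizer L form"
  have "\<exists>w. ?S \<subseteq> V.span {w}"
  proof (cases "?S \<subseteq> {0}")
    case True
    then show ?thesis using V.span_zero by blast
  next
    case False
    then obtain w where w: "w \<in> ?S" "w \<noteq> 0" by blast
    have wL: "w \<in> lspace L" "\<And>\<eta>. \<eta> \<in> lspace L \<Longrightarrow> form (lbracket L w \<eta>) = 0"
      using w(1) by (auto simp: lie_stabilizer_def)
    have fw: "form w \<noteq> 0" using contact_kernel_vector wL w(2) by blast
    have "v \<in> V.span {w}" if "v \<in> ?S" for v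
    proof -
      have vL: "v \<in> lspace L" "\<And>\<eta>. \<eta> \<in> lspace L \<Longrightarrow> form (lbracket L v \<eta>) = 0"
        using that by (auto simp: lie_stabilizer_def)
      \<comment> \<open>Chosen so that the contact form vanishes on \<open>v + c w\<close>, which
        lies in the stabilizer and is therefore 0.\<close>
      define c where "c = - (form v / form w)"
      have "v + lscale L c w = 0"
      proof (rule contact_kernel_vector)
        show "v + lscale L c w \<in> lspace L" using vL wL by (intro L_add L_scale)
        have "form (v + lscale L c w) = form v + c * form w"
          using vL wL by (simp add: form_add form_scale L_scale)
        then show "form (v + lscale L c w) = 0" using fw by (simp add: c_def)
        fix \<eta>
        assume \<eta>: "\<eta> \<in> lspace L"
        have flip: "form (lbracket L \<eta> u) = - form (lbracket L u \<eta>)" if "u \<in> lspace L" for u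
          using bracket_anti[OF \<eta> that] form_scale[OF bracket_closed[OF that \<eta>], of "- 1"]
          by simp
        have "form (lbracket L \<eta> (v + lscale L c w)) = 0"
          using vL wL \<eta> bracket_closed
          by (simp add: bracket_add bracket_scale form_add form_scale L_scale flip)
        then show "form (lbracket L (v + lscale L c w) \<eta>) = 0"
          using flip[of "v + lscale L c w"] vL wL by (simp add: L_add L_scale)
      qed
      then have "v = lscale L (- c) w" by (simp add: eq_neg_iff_add_eq_0)
      then show ?thesis using V.span_scale[OF V.span_base[of w "{w}"]] by blast
    qed
    then show ?thesis by blast
  qed
  then obtain w where "?S \<subseteq> V.span {w}" by blast
  then have "V.dim ?S \<le> 1" using V.dim_le_card[of ?S "{w}"] by simp
  moreover have "lie_index L \<le> V.dim ?S"
    unfolding lie_index_def by (rule cINF_lower[OF _ form_dual]) simp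
  ultimately show ?thesis by simp
qed

text \<open>The dimension is odd, so the possible values 0 and 1 of the index give the same quotient
  after rounding down.\<close>

lemma half_eq: "(V.dim (lspace L) - lie_index L) div 2 = half"
  using lie_index_le_1 card_half unfolding card_n by (cases "lie_index L") auto

text \<open>Up to the factor \<open>half!\<close>, its coefficients are the Pfaffians of the
  principal submatrices of size \<open>2 * half\<close>.\<close>

abbreviation pfaff :: "('n, ('n, 'k) mpoly) ext" where
  "pfaff \<equiv> wedge_power (poisson_tensor L x) half"

lemma pfaff_nonzero: "\<exists>I. pfaff I \<noteq> 0"
proof (rule ccontr)
  assume "\<nexists>I. pfaff I \<noteq> 0"
  then have "wedge_power (ext_bivector (\<lambda>i j. eval point (bivec i j))) half I = 0" for I
    using hom_wedge_power[of "eval point" bivec half I, OF is_hom_eval bivec_anti]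
    by (simp add: poisson_tensor_bivec eval_simps)
  then have "wedge (wedge_power (ext_bivector (\<lambda>i j. - form (lbracket L (x i) (x j)))) half)
      (ext_vector (\<lambda>i. form (x i))) = 0"
    unfolding eval_point_bivec by (intro ext) (simp add: wedge_def)
  then show False using form_contact by blast
qed

lemma pfaff_support: "pfaff I \<noteq> 0 \<Longrightarrow> card I = 2 * half"
  unfolding poisson_tensor_bivec by (rule wedge_power_support[of bivec, OF bivec_anti])

lemma hom_of_degree_pfaff: "hom_of_degree half (pfaff I)"
  unfolding poisson_tensor_bivec
  by (rule hom_of_degree_wedge_power[of bivec, OF bivec_anti]) (unfold bivec_def, rule hom_of_degree_lf)

lemma vfield_act_pfaff:
  assumes "\<xi> \<in> lspace L"
  shows "vfield (act_field \<xi>) (pfaff I) =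
    linear_op (\<lambda>i k. Const (coord (lbracket L \<xi> (x i)) k)) pfaff I"
  unfolding poisson_tensor_bivec
  by (rule derivation_wedge_power[OF is_derivation_vfield bivec_anti]) (rule vfield_act_bivec[OF assms])

definition fields :: "('n \<Rightarrow> ('n, 'k) mpoly) set" where
  "fields = act_field ` lspace L"

text \<open>The row \<open>None\<close> is the Euler field and the row \<open>Some i\<close> the
  Hamiltonian field of \<open>x i\<close>, one row more than there are columns. At
  \<open>point\<close> this matrix has trivial kernel by \<open>contact_kernel\<close>.\<close>

lemma exists_determinant: "\<exists>\<Delta>. prehomogeneous fields \<Delta>"
proof -
  define B :: "'n option \<Rightarrow> 'n \<Rightarrow> ('n, 'k) mpoly" where
    "B r j = (case r of None \<Rightarrow> Var j | Some i \<Rightarrow> bivec i j)" for r j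
  define A :: "(('k, 'n) vec, 'n option) vec" where "A = (\<chi> r j. eval point (B r j))"
  have "v = 0" if "A *v v = 0" for v
  proof -
    have *: "(\<Sum>j\<in>UNIV. eval point (B r j) * v $ j) = 0" for r
      using that by (simp add: vec_eq_iff matrix_vector_mult_def A_def)
    have "v $ i = 0" for i
    proof (rule contact_kernel)
      show "(\<Sum>j\<in>UNIV. eval point (bivec i j) * v $ j) = 0" for i
        using *[of "Some i"] by (simp add: B_def)
      show "(\<Sum>j\<in>UNIV. point j * v $ j) = 0"
        using *[of None] by (simp add: B_def eval_simps)
    qed
    then show ?thesis by (simp add: vec_eq_iff)
  qed
  \<comment> \<open>A constant left inverse at \<open>point\<close> chooses the combinations of the
    fields, in place of the choice of a nonzero minor.\<close>
  then obtain C :: "(('k, 'n option) vec, 'n) vec" where C: "C ** A = mat 1"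
    using matrix_left_invertible_ker[of A] by blast
  \<comment> \<open>Column \<open>i\<close> holds the \<open>i\<close>-th combined field, because
    \<open>dvd_mult_det\<close> sums over the row index. At \<open>point\<close> the matrix is the
    identity, so its determinant is not the zero polynomial.\<close>
  define P :: "((('n, 'k) mpoly, 'n) vec, 'n) vec" where "P = (\<chi> l i. \<Sum>r\<in>UNIV. Const (C $ i $ r) * B r l)"
  have "eval point (P $ l $ i) = (C ** A) $ i $ l" for l i
    by (simp add: P_def A_def matrix_matrix_mult_def eval_sum eval_simps)
  then have "eval point (det P) = det (transpose (C ** A))"
    unfolding hom_det[OF is_hom_eval] transpose_def by simp
  then have nz: "det P \<noteq> 0" by (auto simp: C)
  have "prehomogeneous fields (det P)"
  proof
    show "hom_of_degree 1 (c i)" if "c \<in> fields" for c i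
      using that hom_of_degree_lf by (auto simp: fields_def act_field_def simp del: One_nat_def)
    show "det P \<noteq> 0" by (rule nz)
    fix f :: "('n, 'k) mpoly" and y k
    assume f: "\<And>c. c \<in> fields \<Longrightarrow> f dvd (\<Sum>l\<in>UNIV. c l * y l)" "f dvd (\<Sum>l\<in>UNIV. Var l * y l)"
    have "f dvd (\<Sum>l\<in>UNIV. B r l * y l)" for r
    proof (cases r)
      case None
      then show ?thesis using f(2) by (simp add: B_def)
    next
      case (Some i)
      have "act_field (x i) = bivec i" by (rule ext) (simp add: act_field_def bivec_def)
      then have "bivec i \<in> fields" using x_in[of i] unfolding fields_def by (metis imageI)
      then show ?thesis using f(1) Some by (simp add: B_def)
    qed
    moreover have "(\<Sum>l\<in>UNIV. y l * P $ l $ i) = (\<Sum>r\<in>UNIV. Const (C $ i $ r) * (\<Sum>l\<in>UNIV. B r l * y l))" for i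
      unfolding P_def by (simp add: sum_distrib_left, subst sum.swap) (simp add: mult_ac)
    ultimately have "f dvd (\<Sum>l\<in>UNIV. y l * P $ l $ i)" for i
      by (simp add: dvd_sum)
    then have "f dvd y k * det P" by (rule dvd_mult_det)
    then show "f dvd det P * y k" by (simp add: mult.commute)
  qed
  then show ?thesis by blast
qed

text \<open>The condition on degrees is inherited by \<open>R\<close> from \<open>pfaff\<close>,
  since \<open>p\<close> is nonzero; the codimension condition is coprimality of the coefficients by
  \<open>codimension_ge_2_iff\<close>.\<close>

lemma fundamental_semi_invariant_iff:
  "fundamental_semi_invariant L x p \<longleftrightarrow>
    (\<exists>R. (\<forall>I. pfaff I = p * R I) \<and> \<not> (\<exists>f. irreducible f \<and> (\<forall>I. f dvd R I)))"
proof -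
  have "(\<forall>I. R I \<noteq> 0 \<longrightarrow> card I = 2 * half) \<and> pfaff = ext_scale p R \<and> codimension zariski (zeros (range R)) \<ge> 2
      \<longleftrightarrow> (\<forall>I. pfaff I = p * R I) \<and> \<not> (\<exists>f. irreducible f \<and> (\<forall>I. f dvd R I))" for R
  proof (cases "\<forall>I. pfaff I = p * R I")
    case True
    obtain I0 where I0: "pfaff I0 \<noteq> 0" using pfaff_nonzero by blast
    have "p \<noteq> 0" "R I0 \<noteq> 0" using True I0 by auto
    have "card I = 2 * half" if "R I \<noteq> 0" for I
      using pfaff_support[of I] that \<open>p \<noteq> 0\<close> True by simp
    moreover have "codimension zariski (zeros (range R)) \<ge> 2 \<longleftrightarrow> \<not> (\<exists>f. irreducible f \<and> (\<forall>g\<in>range R. f dvd g))"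
      using \<open>R I0 \<noteq> 0\<close> by (intro codimension_ge_2_iff) blast
    moreover have "pfaff = ext_scale p R" using True by (intro ext) (simp add: ext_scale_def)
    ultimately show ?thesis using True by auto
  next
    case False
    then have "pfaff \<noteq> ext_scale p R" by (auto simp: ext_scale_def)
    then show ?thesis using False by blast
  qed
  then show ?thesis
    unfolding fundamental_semi_invariant_def Let_def half_eq by auto
qed

end

context contact_lie_algebra
begin

text \<open>By coprimality some \<open>R I\<close> is not divisible by \<open>f\<close>, so
  \<open>f\<close> has the same multiplicity \<open>e\<close> in \<open>pfaff I\<close> as in
  \<open>p\<close>. The derivative of \<open>pfaff I\<close> is a combination of coefficients of
  \<open>pfaff\<close>, all divisible by \<open>f ^ e\<close>, and
  \<open>vfield_irreducible_factor\<close> applies.\<close>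

lemma factor_of_pfaff_eigen:
  assumes P: "prehomogeneous fields \<Delta>"
    and R: "\<And>I. pfaff I = p * R I" "\<not> (\<exists>f. irreducible f \<and> (\<forall>I. f dvd R I))"
    and f: "irreducible f" "f dvd p"
  shows "f \<in> prehomogeneous.prime_eigen fields"
proof -
  interpret P: prehomogeneous fields \<Delta> by (rule P)
  obtain I0 where "pfaff I0 \<noteq> 0" using pfaff_nonzero by blast
  then have "p \<noteq> 0" using R by auto
  have "homogeneous f"
  proof -
    obtain z where z: "p = f * z" using f(2) by blast
    have "hom_of_degree (tdeg f) f"
    proof (rule hom_of_degree_factor)
      show "hom_of_degree half (f * (z * R I0))"
        using hom_of_degree_pfaff[of I0] by (simp add: R(1) z mult.assoc)
      show "f * (z * R I0) \<noteq> 0"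
        using \<open>pfaff I0 \<noteq> 0\<close> by (simp add: R(1) z mult.assoc)
    qed
    then show ?thesis by (auto simp: homogeneous_iff)
  qed
  moreover have "P.eigen f"
    unfolding P.eigen_def
  proof
    fix c
    assume c: "c \<in> fields"
    then obtain \<xi> where \<xi>: "\<xi> \<in> lspace L" "c = act_field \<xi>" by (auto simp: fields_def)
    obtain e w where p: "p = f ^ e * w" and w: "\<not> f dvd w"
      using irreducible_power_split[OF f(1) \<open>p \<noteq> 0\<close>] by blast
    have "e > 0" using f(2) w p by (cases e) auto
    obtain I where "\<not> f dvd R I" using R(2) f(1) by blast
    then have wR: "\<not> f dvd w * R I" using w irreducible_dvd_mult_iff[OF f(1)] by blast
    have "f ^ e dvd pfaff J" for J by (simp add: R(1) p mult.assoc)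
    then have "f ^ e dvd vfield c (pfaff I)"
      unfolding \<xi>(2) vfield_act_pfaff[OF \<xi>(1)] by (rule dvd_linear_op)
    then have "f ^ e dvd vfield c (f ^ e * (w * R I))" by (simp add: R(1) p mult.assoc)
    then have "f dvd vfield c f" by (rule vfield_irreducible_factor[OF f(1) wR \<open>e > 0\<close>])
    then show "\<exists>k. vfield c f = Const k * f"
      using P.linear[OF c] by (intro dvd_vfield_imp_eigenvector)
  qed
  ultimately show ?thesis using f(1) by (simp add: P.prime_eigen_def)
qed

theorem semi_invariants_contact:
  "\<exists>(m::nat) (H :: nat \<Rightarrow> ('n, 'k) mpoly).
    (\<forall>i\<in>{1..m}. irreducible (H i) \<and> homogeneous (H i) \<and> semi_invariant L x (H i)) \<and>
    alg_independent {1..m} H \<and>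
    is_subalgebra hull (H ` {1..m}) = semi_invariant_ring L x \<and>
    (\<exists>a :: nat \<Rightarrow> nat. \<forall>p :: ('n, 'k) mpoly.
       fundamental_semi_invariant L x p \<longleftrightarrow>
       (\<exists>c. c \<noteq> 0 \<and> p = Const c * (\<Prod>i\<in>{1..m}. H i ^ a i)))"
proof -
  obtain \<Delta> where \<Delta>: "prehomogeneous fields \<Delta>" using exists_determinant by blast
  interpret P: prehomogeneous fields \<Delta> by (rule \<Delta>)
  obtain m :: nat and H where H: "\<And>i. i \<in> {1..m} \<Longrightarrow> H i \<in> P.prime_eigen"
    "\<And>i j. i \<in> {1..m} \<Longrightarrow> j \<in> {1..m} \<Longrightarrow> H i dvd H j \<Longrightarrow> i = j"
    "\<And>f. f \<in> P.prime_eigen \<Longrightarrow> \<exists>i\<in>{1..m}. H i dvd f"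
    using P.prime_eigen_representatives by blast
  interpret R: prehomogeneous_reps fields \<Delta> m H
    by unfold_locales (use H in blast)+
  have semi: "semi_invariant L x F \<longleftrightarrow> P.eigen F" for F
    unfolding semi_invariant_def P.eigen_def lie_act_vfield by (auto simp: fields_def)
  have form_p: "\<exists>c a. c \<noteq> 0 \<and> p = Const c * R.Hprod a"
    if "\<And>I. pfaff I = p * R I" "\<not> (\<exists>f. irreducible f \<and> (\<forall>I. f dvd R I))" for p R
  proof (rule R.factorization_Hprod)
    show "p \<noteq> 0" using pfaff_nonzero that(1) by auto
    show "f \<in> P.prime_eigen" if "irreducible f" "f dvd p" for f
      using factor_of_pfaff_eigen[OF \<Delta>] \<open>\<And>I. pfaff I = p * R I\<close>
        \<open>\<not> (\<exists>f. irreducible f \<and> (\<forall>I. f dvd R I))\<close> that by blast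
  qed
  \<comment> \<open>The exponent of \<open>H i\<close> is the least multiplicity of
    \<open>H i\<close> among the coefficients of \<open>pfaff\<close>; the second decomposition
    attains it at some \<open>I\<close>. Exchanging the decompositions gives equality.\<close>
  have exponent_le: "a i \<le> b i"
    if eqs: "\<And>I. pfaff I = Const c * R.Hprod a * R I" "\<And>I. pfaff I = Const c' * R.Hprod b * R' I"
      and c': "c' \<noteq> 0" and coprime: "\<not> (\<exists>f. irreducible f \<and> (\<forall>I. f dvd R' I))"
      and i: "i \<in> {1..m}" for a b c c' R R' i
  proof -
    have irr: "irreducible (H i)" using R.H_irreducible i .
    obtain I where I: "\<not> H i dvd R' I" using coprime irr by blast
    obtain w where w: "R.Hprod b = H i ^ b i * w" "\<not> H i dvd w" using R.Hprod_split i by blast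
    obtain w' where w': "R.Hprod a = H i ^ a i * w'" using R.Hprod_split i by blast
    have "\<not> H i dvd Const c' * prod_list [w, R' I]"
      using irreducible_dvd_prod_list[OF irr _ c', of "[w, R' I]"] w(2) I by auto
    moreover have "pfaff I = H i ^ b i * (Const c' * prod_list [w, R' I])"
      unfolding eqs(2) w(1) by (simp add: mult_ac)
    moreover have "H i ^ a i dvd pfaff I" unfolding eqs(1) w' by (simp add: mult_ac)
    ultimately show ?thesis using irreducible_power_dvd_le irr by (metis not_irreducible_zero)
  qed
  obtain I0 where "pfaff I0 \<noteq> 0" using pfaff_nonzero by blast
  then obtain p0 R0 where R0: "\<And>I. pfaff I = p0 * R0 I" "\<not> (\<exists>f. irreducible f \<and> (\<forall>I. f dvd R0 I))"
    using exists_greatest_common_divisor[of pfaff] by blast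
  then obtain c0 a where p0: "c0 \<noteq> 0" "p0 = Const c0 * R.Hprod a" using form_p by blast
  have "fundamental_semi_invariant L x p \<longleftrightarrow> (\<exists>c. c \<noteq> 0 \<and> p = Const c * R.Hprod a)" for p
  proof
    assume "fundamental_semi_invariant L x p"
    then obtain R where R: "\<And>I. pfaff I = p * R I" "\<not> (\<exists>f. irreducible f \<and> (\<forall>I. f dvd R I))"
      unfolding fundamental_semi_invariant_iff by blast
    obtain c b where p: "c \<noteq> 0" "p = Const c * R.Hprod b" using form_p[OF R] by blast
    have "b i = a i" if "i \<in> {1..m}" for i
      using exponent_le[OF R(1)[unfolded p(2)] R0(1)[unfolded p0(2)] p0(1) R0(2) that]
        exponent_le[OF R0(1)[unfolded p0(2)] R(1)[unfolded p(2)] p(1) R(2) that] by simp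
    then have "R.Hprod b = R.Hprod a" by (intro prod.cong) auto
    then show "\<exists>c. c \<noteq> 0 \<and> p = Const c * R.Hprod a" using p by auto
  next
    assume "\<exists>c. c \<noteq> 0 \<and> p = Const c * R.Hprod a"
    then obtain c where c: "c \<noteq> 0" "p = Const c * R.Hprod a" by blast
    \<comment> \<open>Changing \<open>p\<close> by a constant is compensated in the
      cofactor.\<close>
    define R where "R I = Const (c0 / c) * R0 I" for I
    have "pfaff I = p * R I" for I
    proof -
      have "p * R I = Const (c * (c0 / c)) * R.Hprod a * R0 I"
        unfolding R_def c(2) by (simp only: Const_hom_simps(4) mult_ac)
      then show ?thesis using c(1) by (simp add: R0(1) p0(2))
    qed
    moreover have "\<not> (\<exists>f. irreducible f \<and> (\<forall>I. f dvd R I))"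
    proof
      assume "\<exists>f. irreducible f \<and> (\<forall>I. f dvd R I)"
      then obtain f where f: "irreducible f" "\<forall>I. f dvd R I" by blast
      have "f dvd R0 I" for I
        using irreducible_dvd_prod_list[OF f(1), of "c0 / c" "[R0 I]"] f(2) c(1) p0(1)
        by (simp add: R_def)
      then show False using R0(2) f(1) by blast
    qed
    ultimately show "fundamental_semi_invariant L x p"
      unfolding fundamental_semi_invariant_iff by blast
  qed
  moreover have "irreducible (H i) \<and> homogeneous (H i) \<and> semi_invariant L x (H i)" if "i \<in> {1..m}" for i
    using H(1)[OF that] unfolding semi P.prime_eigen_def by blast
  moreover have "is_subalgebra hull (H ` {1..m}) = semi_invariant_ring L x"
    unfolding R.subalgebra_H semi_invariant_ring_def semi ..
  ultimately show ?thesis using R.alg_independent_H by blast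
qed

end

section \<open>The Lie algebra of an affine algebraic group\<close>

context
  fixes G :: "('m \<Rightarrow> 'k::field) monoid"
begin

lemma coordinate_ring_0: "0 \<in> coordinate_ring G"
  unfolding coordinate_ring_def by (intro CollectI exI[of _ 0]) (auto simp: fun_eq_iff)

lemma coordinate_ring_add:
  assumes "f \<in> coordinate_ring G" "g \<in> coordinate_ring G"
  shows "f + g \<in> coordinate_ring G"
proof -
  obtain P Q where PQ: "f = (\<lambda>g. if g \<in> carrier G then eval g P else 0)"
    "g = (\<lambda>g. if g \<in> carrier G then eval g Q else 0)"
    using assms unfolding coordinate_ring_def by blast
  then have "f + g = (\<lambda>h. if h \<in> carrier G then eval h (P + Q) else 0)"
    by (auto simp: fun_eq_iff eval_simps)
  then show ?thesis unfolding coordinate_ring_def by blast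
qed

lemma coordinate_ring_mult:
  assumes "f \<in> coordinate_ring G" "g \<in> coordinate_ring G"
  shows "f * g \<in> coordinate_ring G"
proof -
  obtain P Q where PQ: "f = (\<lambda>g. if g \<in> carrier G then eval g P else 0)"
    "g = (\<lambda>g. if g \<in> carrier G then eval g Q else 0)"
    using assms unfolding coordinate_ring_def by blast
  then have "f * g = (\<lambda>h. if h \<in> carrier G then eval h (P * Q) else 0)"
    by (auto simp: fun_eq_iff eval_simps)
  then show ?thesis unfolding coordinate_ring_def by blast
qed

lemma coordinate_ring_scale:
  assumes "f \<in> coordinate_ring G"
  shows "(\<lambda>h. c * f h) \<in> coordinate_ring G"
proof -
  obtain P where P: "f = (\<lambda>g. if g \<in> carrier G then eval g P else 0)"
    using assms unfolding coordinate_ring_def by blast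
  then have "(\<lambda>h. c * f h) = (\<lambda>h. if h \<in> carrier G then eval h (Const c * P) else 0)"
    by (auto simp: fun_eq_iff eval_simps)
  then show ?thesis unfolding coordinate_ring_def by blast
qed

lemma coordinate_ring_diff:
  assumes "f \<in> coordinate_ring G" "g \<in> coordinate_ring G"
  shows "f - g \<in> coordinate_ring G"
proof -
  have "f - g = f + (\<lambda>h. (- 1) * g h)" by (auto simp: fun_eq_iff)
  then show ?thesis using coordinate_ring_add coordinate_ring_scale assms by metis
qed

lemma
  assumes "D \<in> lspace (Lie G)"
  shows Lie_outside: "f \<notin> coordinate_ring G \<Longrightarrow> D f = 0"
    and Lie_add: "f \<in> coordinate_ring G \<Longrightarrow> g \<in> coordinate_ring G \<Longrightarrow> D (f + g) = D f + D g"
    and Lie_scale: "f \<in> coordinate_ring G \<Longrightarrow> D (\<lambda>h. c * f h) = (\<lambda>h. c * D f h)"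
    and Lie_mult: "f \<in> coordinate_ring G \<Longrightarrow> g \<in> coordinate_ring G \<Longrightarrow> D (f * g) = D f * g + f * D g"
    and Lie_translate: "a \<in> carrier G \<Longrightarrow> f \<in> coordinate_ring G \<Longrightarrow>
      D (left_translate G a f) = left_translate G a (D f)"
    and Lie_in: "D f \<in> coordinate_ring G"
  using assms coordinate_ring_0 by (cases "f \<in> coordinate_ring G"; auto simp: Lie_def Let_def)+

lemma Lie_0:
  assumes "D \<in> lspace (Lie G)"
  shows "D 0 = 0"
  using Lie_add[OF assms coordinate_ring_0 coordinate_ring_0] by simp

lemma Lie_diff:
  assumes D: "D \<in> lspace (Lie G)" and fg: "f \<in> coordinate_ring G" "g \<in> coordinate_ring G"
  shows "D (f - g) = D f - D g"
  using Lie_add[OF D coordinate_ring_diff[OF fg] fg(2)] by (simp add: algebra_simps)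

lemma lbracket_Lie: "lbracket (Lie G) D E = (\<lambda>f. D (E f) - E (D f))"
  by (simp add: Lie_def)

lemma lscale_Lie: "lscale (Lie G) c D = (\<lambda>f h. c * D f h)"
  by (simp add: Lie_def)

lemma left_translate_diff: "left_translate G a (f - g) = left_translate G a f - left_translate G a g"
  by (auto simp: left_translate_def fun_eq_iff)

lemma Lie_bracket_closed:
  assumes D: "D \<in> lspace (Lie G)" and E: "E \<in> lspace (Lie G)"
  shows "lbracket (Lie G) D E \<in> lspace (Lie G)"
proof -
  let ?B = "\<lambda>f. D (E f) - E (D f)"
  have "?B f = 0" if "f \<notin> coordinate_ring G" for f
    using Lie_outside[OF D that] Lie_outside[OF E that] Lie_0[OF D] Lie_0[OF E] by simp
  moreover have "?B f \<in> coordinate_ring G" for f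
    using Lie_in[OF D] Lie_in[OF E] by (intro coordinate_ring_diff)
  moreover have "?B (f + g) = ?B f + ?B g" if "f \<in> coordinate_ring G" "g \<in> coordinate_ring G" for f g
    using that by (simp add: Lie_add[OF D] Lie_add[OF E] Lie_in[OF D] Lie_in[OF E])
  moreover have "?B (\<lambda>h. c * f h) = (\<lambda>h. c * ?B f h)" if "f \<in> coordinate_ring G" for c f
    using that by (auto simp: Lie_scale[OF D] Lie_scale[OF E] Lie_in[OF D] Lie_in[OF E] fun_eq_iff algebra_simps)
  moreover have "?B (f * g) = ?B f * g + f * ?B g" if "f \<in> coordinate_ring G" "g \<in> coordinate_ring G" for f g
    using that
    by (simp add: Lie_mult[OF D] Lie_mult[OF E] Lie_add[OF D] Lie_add[OF E] Lie_in[OF D] Lie_in[OF E]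
        coordinate_ring_mult algebra_simps)
  moreover have "?B (left_translate G a f) = left_translate G a (?B f)"
    if "a \<in> carrier G" "f \<in> coordinate_ring G" for a f
    using that by (simp add: Lie_translate[OF D] Lie_translate[OF E] Lie_in[OF D] Lie_in[OF E] left_translate_diff)
  ultimately show ?thesis
    unfolding lbracket_Lie by (simp add: Lie_def Let_def)
qed

lemma vector_space_Lie: "vector_space (lscale (Lie G))"
  by unfold_locales (auto simp: lscale_Lie fun_eq_iff algebra_simps)

text \<open>Members of \<open>Lie G\<close> are additive on the coordinate ring only, so expanding
  the nested commutators relies on \<open>Lie_in\<close> to keep all inner values there.\<close>

lemma Lie_jacobi:
  assumes D: "D \<in> lspace (Lie G)" and E: "E \<in> lspace (Lie G)" and F: "F \<in> lspace (Lie G)"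
  shows "lbracket (Lie G) D (lbracket (Lie G) E F) =
    lbracket (Lie G) (lbracket (Lie G) D E) F + lbracket (Lie G) E (lbracket (Lie G) D F)"
  unfolding lbracket_Lie
  by (rule ext) (simp add: Lie_diff[OF D] Lie_diff[OF E] Lie_diff[OF F] Lie_in[OF D] Lie_in[OF E] Lie_in[OF F]
      algebra_simps)

lemma Lie_bracket_add:
  assumes D: "D \<in> lspace (Lie G)" and E: "E \<in> lspace (Lie G)" and F: "F \<in> lspace (Lie G)"
  shows "lbracket (Lie G) D (E + F) = lbracket (Lie G) D E + lbracket (Lie G) D F"
  unfolding lbracket_Lie
  by (rule ext) (simp add: Lie_add[OF D] Lie_in[OF E] Lie_in[OF F] algebra_simps)

lemma Lie_bracket_scale:
  assumes D: "D \<in> lspace (Lie G)" and E: "E \<in> lspace (Lie G)"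
  shows "lbracket (Lie G) D (lscale (Lie G) c E) = lscale (Lie G) c (lbracket (Lie G) D E)"
  unfolding lbracket_Lie lscale_Lie
  by (rule ext) (simp add: Lie_scale[OF D] Lie_in[OF E] fun_eq_iff algebra_simps)

end

theorem proposition3p6:
  fixes Q :: "('m::finite \<Rightarrow> 'k::{alg_closed_field, field_char_0}) monoid"
    and x :: "'n::{finite,linorder} \<Rightarrow> (('m \<Rightarrow> 'k) \<Rightarrow> 'k) \<Rightarrow> (('m \<Rightarrow> 'k) \<Rightarrow> 'k)"
  assumes "affine_algebraic_group Q"
    and "connectedin zariski (carrier Q)"
    and "lie_basis (Lie Q) x"
    and "contact (Lie Q) x"
  shows "\<exists>(m::nat) (H :: nat \<Rightarrow> ('n, 'k) mpoly).
    (\<forall>i\<in>{1..m}. irreducible (H i) \<and> homogeneous (H i) \<and> semi_invariant (Lie Q) x (H i)) \<and>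
    alg_independent {1..m} H \<and>
    is_subalgebra hull (H ` {1..m}) = semi_invariant_ring (Lie Q) x \<and>
    (\<exists>a :: nat \<Rightarrow> nat. \<forall>p :: ('n, 'k) mpoly.
       fundamental_semi_invariant (Lie Q) x p \<longleftrightarrow>
       (\<exists>c. c \<noteq> 0 \<and> p = Const c * (\<Prod>i\<in>{1..m}. H i ^ a i)))"
proof -
  interpret contact_lie_algebra "Lie Q" x
  proof (rule contact_lie_algebra.intro)
    show "vector_space (lscale (Lie Q))" by (rule vector_space_Lie)
    show "lbracket (Lie Q) u v = - lbracket (Lie Q) v u" for u v
      by (simp add: lbracket_Lie fun_eq_iff)
  qed (use assms Lie_bracket_closed Lie_bracket_add Lie_bracket_scale Lie_jacobi in blast)+
  show ?thesis by (rule semi_invariants_contact)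
qed

end
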